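(* Let $A$, $(\varepsilon_n)$, $(\xi_n)$, $(e_n)$, $(\gamma_n)$ and $(\Delta_n)$ be as in the context and satisfy conditions (i)–(v). Then $\bar\Delta_n=\frac1n\sum_{i=1}^n\Delta_i$ satisfies $$\sqrt n\,\bar\Delta_n\xrightarrow{D}\mathcal N(0,A^{-1}\Sigma A^{-1}).$$
   Context: Let $(\mathcal F_n)_{n\ge0}$ be an increasing sequence of $\sigma$-fields, $A$ a $d\times d$ matrix, $(\gamma_n)$ positive step sizes, $(\varepsilon_n),(\xi_n),(e_n)$ random vectors in $\mathbb R^d$ adapted to $(\mathcal F_n)$, $\Delta_0\in\mathbb R^d$, and $\Delta_n=\Delta_{n-1}-\gamma_nA\Delta_{n-1}+\gamma_n(\varepsilon_n+\xi_n+e_n)$. Conditions: (i) $A$ is symmetric positive definite. (ii) $(\varepsilon_n)$ is a martingale-difference sequence ($\mathbb E[\varepsilon_n\mid\mathcal F_{n-1}]=0$, $\sup_n\mathbb E\|\varepsilon_n\|^2<\infty$), there is $C>0$ with $\mathbb E[\|\varepsilon_n\|^4\mid\mathcal F_{n-1}]\le C$ for all $n$, and there is a matrix $\Sigma\succ0$ with $\mathbb E[\varepsilon_n\varepsilon_n^\top\mid\mathcal F_{n-1}]\to\Sigma$ in probability. (iii) $(\xi_n)$ is a martingale-difference sequence ($\mathbb E[\xi_n\mid\mathcal F_{n-1}]=0$, $\sup_n\mathbb E\|\xi_n\|^2<\infty$) and there are $N$ and $K>0$ such that $\mathbb E[\|\xi_n\|^2\mid\mathcal F_{n-1}]\le K\gamma_n$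 a.s. for all $n\ge N$. (iv) $\mathbb E[\|e_n\|]=O(\gamma_n)$. (v) $\gamma_n\to0$, $\frac{\gamma_n-\gamma_{n-1}}{\gamma_n}=o(\gamma_n)$, and $\sum_{j\ge1}\gamma_j/\sqrt j<\infty$. *)

theory Defs
  imports "HOL-Probability.Probability" "HOL-Library.Landau_Symbols"
begin

definition sym_pos_def :: "real^'d^'d \<Rightarrow> bool" where
  "sym_pos_def A \<longleftrightarrow> transpose A = A \<and> (\<forall>x::real^'d. x \<noteq> 0 \<longrightarrow> 0 < x \<bullet> (A *v x))"

definition cond_cov :: "'a measure \<Rightarrow> 'a measure \<Rightarrow> ('a \<Rightarrow> real^'d) \<Rightarrow> 'a \<Rightarrow> real^'d^'d" where
  "cond_cov M G X = (\<lambda>\<omega>. \<chi> i j. real_cond_exp M G (\<lambda>x. X x $ i * X x $ j) \<omega>)"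

definition conv_in_prob :: "'a measure \<Rightarrow> (nat \<Rightarrow> 'a \<Rightarrow> 'b::real_normed_vector) \<Rightarrow> 'b \<Rightarrow> bool" where
  "conv_in_prob M Y L \<longleftrightarrow>
     (\<forall>e>0. (\<lambda>n. measure M {x \<in> space M. norm (Y n x - L) > e}) \<longlonglongrightarrow> 0)"

definition gaussian_density :: "real^'d^'d \<Rightarrow> real^'d \<Rightarrow> real" where
  "gaussian_density V x =
     exp (- (x \<bullet> (matrix_inv V *v x)) / 2) / sqrt ((2 * pi) ^ CARD('d) * det V)"

definition mv_normal :: "real^'d^'d \<Rightarrow> (real^'d) measure" where
  "mv_normal V = density lborel (\<lambda>x. ennreal (gaussian_density V x))"

definition weak_conv_eucl :: "(nat \<Rightarrow> 'b::euclidean_space measure) \<Rightarrow> 'b measure \<Rightarrow> bool" where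
  "weak_conv_eucl \<mu>s \<mu> \<longleftrightarrow>
     (\<forall>f :: 'b \<Rightarrow> real. continuous_on UNIV f \<and> bounded (range f) \<longrightarrow>
        (\<lambda>n. \<integral>x. f x \<partial>\<mu>s n) \<longlonglongrightarrow> (\<integral>x. f x \<partial>\<mu>))"

definition conv_in_distr :: "'a measure \<Rightarrow> (nat \<Rightarrow> 'a \<Rightarrow> 'b::euclidean_space) \<Rightarrow> 'b measure \<Rightarrow> bool" where
  "conv_in_distr M X \<mu> \<longleftrightarrow> weak_conv_eucl (\<lambda>n. distr M borel (X n)) \<mu>"

end

theory Submission
  imports Defs "HOL-Real_Asymp.Real_Asymp"
begin

text \<open>
  Split \<open>\<Delta> = Y + D\<close>, where \<open>Y\<close> starts at 0 and is driven by the martingale differences \<open>Z = \<epsilon> + \<xi>\<close> only,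
  and \<open>D\<close> is driven by \<open>e\<close>. The maps \<open>x - \<gamma> A x\<close> contract by \<open>1 - a \<gamma>\<close>, so pathwise the sum of the \<open>norm (D i)\<close>
  is controlled by the sum of the \<open>norm (e i)\<close>, which is negligible after division by \<open>sqrt n\<close>
  by Kronecker's lemma. Summing the recursion for \<open>Y\<close> by parts gives
  \<open>A (Y 0 + ... + Y (n-1)) = (Z 1 + ... + Z n) + V n - Y n / \<gamma> n\<close> with
  \<open>V n = (\<Sum>i<n. (1 / \<gamma> (i+1) - 1 / \<gamma> i) Y i)\<close>. The second moment of \<open>Y n\<close> is \<open>O(\<gamma> n)\<close>, that of \<open>V n\<close> is \<open>o(n)\<close>
  because the cross moments of \<open>V\<close> and \<open>Y\<close> stay bounded, and that of the sum of the \<open>\<xi>\<close> is \<open>o(n)\<close>.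
  What remains is \<open>A\<^sup>-\<^sup>1 (\<epsilon> 1 + ... + \<epsilon> n) / sqrt n\<close>, whose characteristic function converges
  by a one-step comparison with the Gaussian one. Convergence of characteristic functions gives weak
  convergence after Gaussian smoothing of the test function.
\<close>

subsection \<open>Sequences\<close>

text \<open>The perturbation \<open>e\<close> is controlled only in first moment, and only from some
  index on, whereas every estimate for the noise rests on orthogonality in second moment. This
  forces the split: \<open>D\<close> is bounded path by path with deterministic constants, and
  second moments are taken of \<open>Y\<close> alone. Beyond \<gamma> tending to 0, condition (v)
  enters in three ways. The ratio condition says that the increments \<delta> of 1/\<gamma> tend to
  0, hence 1/\<gamma> n = o(n), which makes the boundary term negligible. It also gives \<gamma> n /
  \<gamma> (n+1) <= 1 + o(\<gamma> (n+1)), so dividing a damped quantity by \<gamma> costs only part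
  of the damping. Summability is the input to Kronecker's lemma. No rate is known for \<delta>, so
  the sizes of the correlated summands of \<open>V\<close> cannot simply be added up. Since \<Sigma>
  is deterministic, the central limit theorem compares each step with one fixed Gaussian factor; the
  conditional fourth moment bounds the conditional variances, which turns their convergence in
  probability into convergence in mean.\<close>

lemma cesaro_null:
  fixes x :: "nat \<Rightarrow> real"
  assumes "x \<longlonglongrightarrow> 0"
  shows "(\<lambda>n. (\<Sum>i<n. x i) / real n) \<longlonglongrightarrow> 0"
proof (rule LIMSEQ_I)
  fix r :: real assume r: "0 < r"
  obtain N where N: "\<And>n. n \<ge> N \<Longrightarrow> \<bar>x n\<bar> < r / 2"
    using LIMSEQ_D[OF assms, of "r/2"] r by auto
  define S where "S = (\<Sum>i<N. \<bar>x i\<bar>)"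
  have bd: "\<bar>\<Sum>i<n. x i\<bar> \<le> S + real n * (r/2)" for n
  proof -
    have "\<bar>\<Sum>i<n. x i\<bar> \<le> (\<Sum>i<n. \<bar>x i\<bar>)" by (rule sum_abs)
    also have "\<dots> \<le> (\<Sum>i<n. (if i < N then \<bar>x i\<bar> else 0) + r/2)"
      using r N by (intro sum_mono) (auto simp: not_less intro: less_imp_le)
    also have "\<dots> = (\<Sum>i | i < n \<and> i < N. \<bar>x i\<bar>) + real n * (r/2)"
      by (simp add: sum.distrib sum.If_cases Int_def)
    also have "\<dots> \<le> S + real n * (r/2)"
      unfolding S_def by (intro add_right_mono sum_mono2) auto
    finally show ?thesis .
  qed
  have "(\<lambda>n. S / real n) \<longlonglongrightarrow> 0" by (rule lim_const_over_n)
  from LIMSEQ_D[OF this, of "r/2"] r obtain N' where N': "\<And>n. n \<ge> N' \<Longrightarrow> \<bar>S / real n\<bar> < r / 2"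
    by auto
  show "\<exists>no. \<forall>n\<ge>no. norm ((\<Sum>i<n. x i) / real n - 0) < r"
  proof (intro exI allI impI)
    fix n assume n: "n \<ge> max 1 N'"
    have "\<bar>(\<Sum>i<n. x i)\<bar> / real n \<le> (S + real n * (r/2)) / real n"
      using bd[of n] by (intro divide_right_mono) auto
    also have "\<dots> = S / real n + r/2" using n by (simp add: field_simps)
    also have "\<dots> < r" using abs_ge_self[of "S / real n"] N'[of n] n by linarith
    finally show "norm ((\<Sum>i<n. x i) / real n - 0) < r" by simp
  qed
qed

text \<open>Telescoping from the index where the step bound starts leaves a constant plus a partial
  sum of \<bar>d\<bar>, which is o(n) by Cesaro; nonnegativity of \<open>y\<close> supplies the
  lower bound, so a one-sided step suffices. It yields the o(n) bounds for 1/\<gamma>, for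
  \<open>V\<close> and for martingale sums.\<close>

lemma increments_null_imp_sublinear:
  fixes y d :: "nat \<Rightarrow> real"
  assumes y: "\<And>n. 0 \<le> y n" and step: "\<forall>\<^sub>F n in sequentially. y (Suc n) \<le> y n + d n" and d: "d \<longlonglongrightarrow> 0"
  shows "(\<lambda>n. y n / real n) \<longlonglongrightarrow> 0"
proof -
  obtain N where N: "\<And>n. n \<ge> N \<Longrightarrow> y (Suc n) \<le> y n + d n"
    using step by (auto simp: eventually_sequentially)
  define S where "S = y N + (\<Sum>i<N. \<bar>d i\<bar>)"
  have bd: "y n \<le> S + (\<Sum>i<n. \<bar>d i\<bar>)" if "n \<ge> N" for n
    using that
  proof (induction n rule: dec_induct)
    case base then show ?case by (simp add: S_def sum_nonneg)
  next
    case (step n) then show ?case using N[of n] by simp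
  qed
  have lim: "(\<lambda>n. S / real n + (\<Sum>i<n. \<bar>d i\<bar>) / real n) \<longlonglongrightarrow> 0 + 0"
    using d by (intro tendsto_add lim_const_over_n cesaro_null) (simp add: tendsto_rabs_zero)
  show ?thesis
  proof (rule tendsto_sandwich[OF _ _ tendsto_const])
    show "\<forall>\<^sub>F n in sequentially. 0 \<le> y n / real n" using y by simp
    show "\<forall>\<^sub>F n in sequentially. y n / real n \<le> S / real n + (\<Sum>i<n. \<bar>d i\<bar>) / real n"
      using bd by (intro eventually_sequentiallyI[of N])
        (auto simp: add_divide_distrib[symmetric] intro!: divide_right_mono)
  qed (use lim in simp)
qed

text \<open>Past the index \<open>N\<close> where the weighted tail is below r/2, each term is at
  most sqrt n times its weighted version, because sqrt (j+1) <= sqrt n for j < n; the terms before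
  \<open>N\<close> form a constant.\<close>

lemma kronecker_sqrt:
  fixes g :: "nat \<Rightarrow> real"
  assumes g: "\<And>n. n \<ge> 1 \<Longrightarrow> 0 \<le> g n" and summ: "summable (\<lambda>j. g (Suc j) / sqrt (real (Suc j)))"
  shows "(\<lambda>n. (\<Sum>i=1..n. g i) / sqrt (real n)) \<longlonglongrightarrow> 0"
proof (rule LIMSEQ_I)
  fix r :: real assume r: "0 < r"
  obtain N where N: "\<And>m n. m \<ge> N \<Longrightarrow> norm (\<Sum>j=m..<n. g (Suc j) / sqrt (real (Suc j))) < r/2"
    using summ[unfolded summable_Cauchy, rule_format, of "r/2"] r by auto
  define S where "S = (\<Sum>j<N. g (Suc j))"
  have bd: "(\<Sum>i=1..n. g i) \<le> S + sqrt (real n) * (r/2)" if n: "n \<ge> N" for n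
  proof -
    have "(\<Sum>i=1..n. g i) = (\<Sum>j<n. g (Suc j))"
      by (simp add: sum.atLeast1_atMost_eq)
    also have "\<dots> = S + (\<Sum>j=N..<n. g (Suc j))"
      unfolding S_def using n by (metis lessThan_atLeast0 sum.atLeastLessThan_concat zero_le)
    also have "(\<Sum>j=N..<n. g (Suc j)) \<le> (\<Sum>j=N..<n. sqrt (real n) * (g (Suc j) / sqrt (real (Suc j))))"
    proof (rule sum_mono)
      fix j assume j: "j \<in> {N..<n}"
      have "g (Suc j) * sqrt (real (Suc j)) \<le> g (Suc j) * sqrt (real n)"
        using j by (intro mult_left_mono g) auto
      then show "g (Suc j) \<le> sqrt (real n) * (g (Suc j) / sqrt (real (Suc j)))"
        by (simp add: field_simps)
    qed
    also have "\<dots> = sqrt (real n) * (\<Sum>j=N..<n. g (Suc j) / sqrt (real (Suc j)))"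
      by (simp add: sum_distrib_left)
    also have "\<dots> \<le> sqrt (real n) * (r/2)"
      using N[of N n] by (intro mult_left_mono) auto
    finally show ?thesis by simp
  qed
  have "(\<lambda>n. S / sqrt (real n)) \<longlonglongrightarrow> 0"
    by real_asymp
  from LIMSEQ_D[OF this, of "r/2"] r obtain N' where N': "\<And>n. n \<ge> N' \<Longrightarrow> \<bar>S / sqrt (real n)\<bar> < r / 2"
    by auto
  show "\<exists>no. \<forall>n\<ge>no. norm ((\<Sum>i=1..n. g i) / sqrt (real n) - 0) < r"
  proof (intro exI allI impI)
    fix n assume n: "n \<ge> max (max 1 N) N'"
    have "(\<Sum>i=1..n. g i) / sqrt (real n) \<le> (S + sqrt (real n) * (r/2)) / sqrt (real n)"
      using bd[of n] n by (intro divide_right_mono) auto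
    also have "\<dots> = S / sqrt (real n) + r/2" using n by (simp add: field_simps)
    also have "\<dots> < r" using abs_ge_self[of "S / sqrt (real n)"] N'[of n] n by linarith
    finally have "(\<Sum>i=1..n. g i) / sqrt (real n) < r" .
    moreover have "0 \<le> (\<Sum>i=1..n. g i)" by (intro sum_nonneg g) auto
    ultimately show "norm ((\<Sum>i=1..n. g i) / sqrt (real n) - 0) < r" by simp
  qed
qed

text \<open>The map u -> (1 - a g) u + B g fixes B / a, and for 0 <= a g <= 1 it is a convex
  combination of u and B / a. An upper bound that is at least B / a therefore persists: noise of the
  same order g as the damping is harmless.\<close>

lemma damped_recursion_bounded:
  fixes b g :: "nat \<Rightarrow> real"
  assumes a: "0 < a" and B: "0 \<le> B"
    and step: "\<forall>\<^sub>F n in sequentially. 0 \<le> g n \<and> a * g n \<le> 1 \<and> b (Suc n) \<le> (1 - a * g n) * b n + B * g n"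
  shows "\<exists>K\<ge>0. \<forall>n. b n \<le> K"
proof -
  obtain N where N: "\<And>n. n \<ge> N \<Longrightarrow> 0 \<le> g n \<and> a * g n \<le> 1 \<and> b (Suc n) \<le> (1 - a * g n) * b n + B * g n"
    using step by (auto simp: eventually_sequentially)
  define K where "K = max (B / a) (Max (b ` {..N}))"
  have init: "b n \<le> K" if "n \<le> N" for n
    unfolding K_def using that by (intro max.coboundedI2 Max_ge) auto
  have late: "b n \<le> K" if "n \<ge> N" for n
    using that
  proof (induction n rule: dec_induct)
    case base show ?case by (rule init) simp
  next
    case (step n)
    have "B \<le> a * K" using a by (simp add: K_def field_simps max_def split: if_splits)
    with N[of n] step have "B * g n \<le> a * K * g n" by (intro mult_right_mono) auto
    moreover have "(1 - a * g n) * b n \<le> (1 - a * g n) * K"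
      using N[of n] step by (intro mult_left_mono) auto
    ultimately have "b (Suc n) \<le> (1 - a * g n) * K + a * K * g n" using N[of n] step by linarith
    then show ?case by (simp add: algebra_simps)
  qed
  have "0 \<le> K" using a B by (simp add: K_def le_max_iff_disj)
  then show ?thesis using init late by (meson linear)
qed

subsection \<open>The standard Gaussian measure and Levy continuity\<close>

text \<open>The density is a product over \<open>Basis\<close>, so that mass and characteristic
  function factor by Fubini in any Euclidean space; \<open>mv_normal\<close> is later obtained as a
  linear image of this measure.\<close>

definition std_gaussian :: "'b::euclidean_space measure" where
  "std_gaussian = density lborel (\<lambda>x. ennreal (\<Prod>b\<in>Basis. std_normal_density (x \<bullet> b)))"

lemma sets_std_gaussian [simp, measurable_cong]: "sets std_gaussian = sets borel"
  by (simp add: std_gaussian_def)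

lemma space_std_gaussian [simp]: "space std_gaussian = UNIV"
  by (simp add: std_gaussian_def)

lemma prod_std_normal_density_nonneg: "0 \<le> (\<Prod>b\<in>S. std_normal_density (f b))"
  by (intro prod_nonneg) (simp add: normal_density_nonneg)

lemma prod_std_normal_density_Basis:
  fixes x :: "'b::euclidean_space"
  shows "(\<Prod>b\<in>Basis. std_normal_density (x \<bullet> b)) = exp (- (norm x)\<^sup>2 / 2) / sqrt (2 * pi) ^ DIM('b)"
proof -
  have "(norm x)\<^sup>2 = (\<Sum>b\<in>Basis. (x \<bullet> b)\<^sup>2)"
    unfolding power2_norm_eq_inner by (subst euclidean_inner) (simp add: power2_eq_square)
  then have "exp (- (norm x)\<^sup>2 / 2) = (\<Prod>b\<in>Basis. exp (- (x \<bullet> b)\<^sup>2 / 2))"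
    by (simp add: exp_sum[symmetric] sum_divide_distrib sum_negf)
  then show ?thesis
    by (simp add: std_normal_density_def prod_dividef)
qed

lemma prob_space_std_gaussian: "prob_space (std_gaussian :: 'b::euclidean_space measure)"
proof
  have "emeasure (std_gaussian :: 'b measure) (space std_gaussian)
      = (\<integral>\<^sup>+x. (\<Prod>b\<in>Basis. ennreal (std_normal_density (x \<bullet> b))) \<partial>(lborel :: 'b measure))"
    by (simp add: std_gaussian_def emeasure_density prod_ennreal normal_density_nonneg)
  also have "\<dots> = (\<Prod>b\<in>(Basis::'b set). (\<integral>\<^sup>+x. ennreal (std_normal_density x) \<partial>lborel))"
    by (rule nn_integral_lborel_prod) auto
  also have "(\<integral>\<^sup>+x. ennreal (std_normal_density x) \<partial>lborel) = 1"
    using prob_space.emeasure_space_1[OF prob_space_normal_density[of 1 0]] by (simp add: emeasure_density)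
  finally show "emeasure (std_gaussian :: 'b measure) (space std_gaussian) = 1" by simp
qed

text \<open>\<open>lborel\<close> is the image of a product of one-dimensional Lebesgue measures, so
  the integral splits into characteristic functions of the standard normal law on the line.\<close>

lemma char_std_gaussian:
  fixes t :: "'b::euclidean_space"
  shows "(CLINT x|std_gaussian. iexp (t \<bullet> x)) = complex_of_real (exp (- (norm t)\<^sup>2 / 2))"
proof -
  interpret P: product_sigma_finite "\<lambda>b::'b. lborel :: real measure" ..
  define h where "h b x = std_normal_density x *\<^sub>R iexp ((t \<bullet> b) * x)" for b :: 'b and x
  have [measurable]: "h b \<in> borel_measurable borel" for b unfolding h_def by measurable
  have int_h: "integrable lborel (h b)" for b
    unfolding h_def
    by (subst integrable_density[symmetric])
       (auto simp: normal_density_nonneg intro!: prob_space.integrable_iexp prob_space_normal_density)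
  have h1: "integral\<^sup>L lborel (h b) = complex_of_real (exp (- ((t \<bullet> b)\<^sup>2) / 2))" for b
    using fun_cong[OF char_std_normal_distribution, of "t \<bullet> b"]
    unfolding char_def h_def by (subst (asm) integral_density) (auto simp: normal_density_nonneg)
  have "(CLINT x|std_gaussian. iexp (t \<bullet> x))
      = (CLINT x|lborel. (\<Prod>b\<in>Basis. std_normal_density (x \<bullet> b)) *\<^sub>R iexp (t \<bullet> x))"
    unfolding std_gaussian_def by (subst integral_density) (auto simp: prod_std_normal_density_nonneg)
  also have "\<dots> = (CLINT x|lborel. (\<Prod>b\<in>Basis. h b (x \<bullet> b)))"
  proof (intro Bochner_Integration.integral_cong refl)
    fix x :: 'b
    have "iexp (t \<bullet> x) = (\<Prod>b\<in>Basis. iexp ((t \<bullet> b) * (x \<bullet> b)))"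
      by (subst euclidean_inner) (simp add: exp_sum[symmetric] sum_distrib_left)
    then show "(\<Prod>b\<in>Basis. std_normal_density (x \<bullet> b)) *\<^sub>R iexp (t \<bullet> x) = (\<Prod>b\<in>Basis. h b (x \<bullet> b))"
      by (simp add: h_def scaleR_conv_of_real prod.distrib)
  qed
  also have "\<dots> = (CLINT f|(\<Pi>\<^sub>M b\<in>Basis. lborel). (\<Prod>b\<in>(Basis::'b set). h b (f b)))"
    by (subst lborel_eq, subst integral_distr) (auto intro!: Bochner_Integration.integral_cong prod.cong
      simp: inner_sum_left inner_Basis if_distrib[of "\<lambda>x. _ * x"] sum.delta cong: if_cong)
  also have "\<dots> = (\<Prod>b\<in>(Basis::'b set). integral\<^sup>L lborel (h b))"
    by (rule P.product_integral_prod) (auto intro: int_h)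
  also have "\<dots> = complex_of_real (\<Prod>b\<in>Basis. exp (- ((t \<bullet> b)\<^sup>2) / 2))"
    by (simp add: h1)
  also have "(\<Prod>b\<in>Basis. exp (- ((t \<bullet> b)\<^sup>2) / 2)) = exp (- (norm t)\<^sup>2 / 2)"
    unfolding power2_norm_eq_inner
    by (simp add: euclidean_inner[of t t] exp_sum[symmetric] sum_divide_distrib sum_negf power2_eq_square)
  finally show ?thesis .
qed

text \<open>The substitution z = x + s y turns smoothing into a Lebesgue integral in which x occurs
  only in the kernel; this is the form to which Fubini and the kernel identity apply.\<close>

lemma integral_std_gaussian_affine:
  fixes f :: "'b::euclidean_space \<Rightarrow> real"
  assumes [measurable]: "f \<in> borel_measurable borel" and s: "s > 0"
  shows "(\<integral>y. f (x + s *\<^sub>R y) \<partial>std_gaussian)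
    = (\<integral>z. f z * exp (- (norm (z - x) / s)\<^sup>2 / 2) \<partial>lborel) / (s * sqrt (2 * pi)) ^ DIM('b)"
proof -
  define h where "h z = f z * exp (- (norm (z - x) / s)\<^sup>2 / 2)" for z
  have [measurable]: "h \<in> borel_measurable borel" unfolding h_def by measurable
  have "(\<integral>y. f (x + s *\<^sub>R y) \<partial>std_gaussian)
      = (\<integral>y. (exp (- (norm y)\<^sup>2 / 2) / sqrt (2 * pi) ^ DIM('b)) * f (x + s *\<^sub>R y) \<partial>lborel)"
    unfolding std_gaussian_def prod_std_normal_density_Basis by (subst integral_density) auto
  also have "\<dots> = (\<integral>y. h (x + s *\<^sub>R y) / sqrt (2 * pi) ^ DIM('b) \<partial>lborel)"
    using s by (intro Bochner_Integration.integral_cong) (auto simp: h_def)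
  finally have 1: "(\<integral>y. f (x + s *\<^sub>R y) \<partial>std_gaussian) = (\<integral>y. h (x + s *\<^sub>R y) \<partial>lborel) / sqrt (2 * pi) ^ DIM('b)"
    by simp
  have "(\<integral>z. h z \<partial>lborel) = s ^ DIM('b) * (\<integral>y. h (x + s *\<^sub>R y) \<partial>lborel)"
    using s by (subst lborel_affine[of s x]) (simp_all add: integral_density integral_distr)
  then show ?thesis using s 1 by (simp add: h_def power_mult_distrib)
qed

definition cfun :: "'b::euclidean_space measure \<Rightarrow> 'b \<Rightarrow> complex" where
  "cfun \<nu> t = (CLINT x|\<nu>. iexp (t \<bullet> x))"

lemma norm_cfun_le_1:
  assumes "prob_space \<nu>" "sets \<nu> = sets borel"
  shows "norm (cfun \<nu> t) \<le> 1"
proof -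
  interpret prob_space \<nu> by fact
  note assms(2)[measurable_cong]
  have "norm (cfun \<nu> t) \<le> (\<integral>x. norm (iexp (t \<bullet> x)) \<partial>\<nu>)"
    unfolding cfun_def by (rule integral_norm_bound)
  also have "\<dots> = 1" by (simp add: prob_space)
  finally show ?thesis .
qed

lemma borel_measurable_cfun [measurable]:
  fixes \<nu> :: "'b::euclidean_space measure"
  assumes "prob_space \<nu>" "sets \<nu> = sets borel"
  shows "cfun \<nu> \<in> borel_measurable borel"
proof -
  interpret prob_space \<nu> by fact
  note assms(2)[measurable_cong]
  show ?thesis unfolding cfun_def
    by (rule borel_measurable_lebesgue_integral) measurable
qed

text \<open>The Gaussian kernel is itself a Gaussian characteristic function, so smoothing a measure with
  it only involves the characteristic function of the measure.\<close>

lemma gaussian_kernel_integral: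
  fixes \<nu> :: "'b::euclidean_space measure"
  assumes "prob_space \<nu>" "sets \<nu> = sets borel"
  shows "complex_of_real (\<integral>x. exp (- (norm (z - x) / s)\<^sup>2 / 2) \<partial>\<nu>)
     = (CLINT t|std_gaussian. iexp (t \<bullet> ((1/s) *\<^sub>R z)) * cfun \<nu> (- (1/s) *\<^sub>R t))"
proof -
  interpret N: prob_space \<nu> by fact
  interpret G: prob_space "std_gaussian :: 'b measure" by (rule prob_space_std_gaussian)
  interpret P: pair_prob_space \<nu> "std_gaussian :: 'b measure" ..
  note assms(2)[measurable_cong]
  have "complex_of_real (\<integral>x. exp (- (norm (z - x) / s)\<^sup>2 / 2) \<partial>\<nu>)
     = (CLINT x|\<nu>. CLINT t|std_gaussian. iexp ((1/s) *\<^sub>R (z - x) \<bullet> t))"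
    by (simp only: char_std_gaussian integral_complex_of_real[symmetric])
       (simp add: power_divide power_mult_distrib)
  also have "\<dots> = (CLINT t|std_gaussian. CLINT x|\<nu>. iexp ((1/s) *\<^sub>R (z - x) \<bullet> t))"
    by (rule P.Fubini_integral[symmetric]) (auto intro!: P.integrable_const_bound[where B=1])
  also have "\<dots> = (CLINT t|std_gaussian. iexp (t \<bullet> ((1/s) *\<^sub>R z)) * cfun \<nu> (- (1/s) *\<^sub>R t))"
    unfolding cfun_def
    by (subst integral_mult_right_zero[symmetric])
       (auto simp: exp_add[symmetric] algebra_simps inner_diff_left inner_diff_right inner_commute diff_divide_distrib
          intro!: Bochner_Integration.integral_cong)
  finally show ?thesis .
qed

text \<open>Fubini moves the integral over \<nu> onto the kernel, after which \<nu> enters only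
  through quantities determined by its characteristic function. The exchange rests on Lebesgue
  integrability of f, which is why test functions are first taken with compact support.\<close>

lemma integral_gaussian_smoothing:
  fixes \<nu> :: "'b::euclidean_space measure" and f :: "'b \<Rightarrow> real"
  assumes "prob_space \<nu>" "sets \<nu> = sets borel" and f: "integrable lborel f" and s: "s > 0"
  shows "(\<integral>x. (\<integral>y. f (x + s *\<^sub>R y) \<partial>std_gaussian) \<partial>\<nu>)
     = (\<integral>z. f z * (\<integral>x. exp (- (norm (z - x) / s)\<^sup>2 / 2) \<partial>\<nu>) \<partial>lborel) / (s * sqrt (2 * pi)) ^ DIM('b)"
proof -
  interpret N: prob_space \<nu> by fact
  interpret P: pair_sigma_finite \<nu> "lborel :: 'b measure" ..
  note assms(2)[measurable_cong]
  have [measurable]: "f \<in> borel_measurable borel" using f by auto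
  have i1: "integrable lborel (\<lambda>z. f z * exp (- (norm (z - x) / s)\<^sup>2 / 2))" for x
    by (rule Bochner_Integration.integrable_bound[OF f]) (auto simp: abs_mult mult_left_le)
  have "integrable (\<nu> \<Otimes>\<^sub>M lborel) (\<lambda>(x, z). f z * exp (- (norm (z - x) / s)\<^sup>2 / 2))"
  proof (rule P.Fubini_integrable)
    have "\<bar>\<integral>z. norm (f z * exp (- (norm (z - x) / s)\<^sup>2 / 2)) \<partial>lborel\<bar> \<le> (\<integral>z. \<bar>f z\<bar> \<partial>lborel)" for x
      using f integrable_norm[OF i1[of x]]
      by (subst abs_of_nonneg) (auto intro!: integral_mono simp: abs_mult mult_left_le)
    then show "integrable \<nu> (\<lambda>x. \<integral>z. norm (case (x, z) of (x, z) \<Rightarrow> f z * exp (- (norm (z - x) / s)\<^sup>2 / 2)) \<partial>lborel)"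
      by (intro N.integrable_const_bound[where B="\<integral>z. \<bar>f z\<bar> \<partial>lborel"]) auto
  qed (use i1 in auto)
  then have "(\<integral>x. (\<integral>z. f z * exp (- (norm (z - x) / s)\<^sup>2 / 2) \<partial>lborel) \<partial>\<nu>)
      = (\<integral>z. (\<integral>x. f z * exp (- (norm (z - x) / s)\<^sup>2 / 2) \<partial>\<nu>) \<partial>lborel)"
    by (rule P.Fubini_integral[symmetric])
  then show ?thesis
    using s by (simp add: integral_std_gaussian_affine)
qed

text \<open>Dominated convergence is used twice: in t under the Gaussian measure, where
  characteristic functions are bounded by 1, to get the kernel integral \<open>q\<close> at each z;
  then in z under Lebesgue measure, dominated by \<bar>f\<bar>.\<close>

lemma tendsto_gaussian_smoothing:
  fixes \<nu> :: "nat \<Rightarrow> 'b::euclidean_space measure" and \<mu> :: "'b measure" and f :: "'b \<Rightarrow> real"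
  assumes \<nu>: "\<And>n. prob_space (\<nu> n)" "\<And>n. sets (\<nu> n) = sets borel"
    and \<mu>: "prob_space \<mu>" "sets \<mu> = sets borel"
    and conv: "\<And>t. (\<lambda>n. cfun (\<nu> n) t) \<longlonglongrightarrow> cfun \<mu> t"
    and f: "integrable lborel f" and s: "s > 0"
  shows "(\<lambda>n. \<integral>x. (\<integral>y. f (x + s *\<^sub>R y) \<partial>std_gaussian) \<partial>\<nu> n)
     \<longlonglongrightarrow> (\<integral>x. (\<integral>y. f (x + s *\<^sub>R y) \<partial>std_gaussian) \<partial>\<mu>)"
proof -
  interpret G: prob_space "std_gaussian :: 'b measure" by (rule prob_space_std_gaussian)
  define q where "q \<rho> z = (\<integral>x. exp (- (norm (z - x) / s)\<^sup>2 / 2) \<partial>\<rho>)" for \<rho> and z :: 'b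
  have [measurable]: "f \<in> borel_measurable borel" using f by auto
  note [measurable] = borel_measurable_cfun[OF \<nu>] borel_measurable_cfun[OF \<mu>]
  have q: "q \<rho> \<in> borel_measurable borel \<and> (\<forall>z. \<bar>q \<rho> z\<bar> \<le> 1)" if "prob_space \<rho>" "sets \<rho> = sets borel" for \<rho>
  proof -
    interpret prob_space \<rho> by fact
    note that(2)[measurable_cong]
    have "\<bar>q \<rho> z\<bar> \<le> (\<integral>x. 1 \<partial>\<rho>)" for z
      unfolding q_def by (subst abs_of_nonneg)
        (auto intro!: integral_mono integrable_const_bound[where B=1] simp del: lebesgue_integral_const)
    moreover have "q \<rho> \<in> borel_measurable borel" unfolding q_def
      by (rule borel_measurable_lebesgue_integral) measurable
    ultimately show ?thesis by (simp add: prob_space)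
  qed
  note [measurable] = q[OF \<nu>, THEN conjunct1] q[OF \<mu>, THEN conjunct1]
  have "(\<lambda>n. complex_of_real (q (\<nu> n) z)) \<longlonglongrightarrow> complex_of_real (q \<mu> z)" for z
    unfolding q_def gaussian_kernel_integral[OF \<nu>] gaussian_kernel_integral[OF \<mu>]
  proof (rule integral_dominated_convergence[where w="\<lambda>_. 1"])
    show "AE t in std_gaussian. norm (iexp (t \<bullet> ((1/s) *\<^sub>R z)) * cfun (\<nu> n) (- (1/s) *\<^sub>R t)) \<le> 1" for n
      using norm_cfun_le_1[OF \<nu>] by (simp add: norm_mult)
  qed (auto intro!: tendsto_intros conv)
  then have q_lim: "(\<lambda>n. q (\<nu> n) z) \<longlonglongrightarrow> q \<mu> z" for z
    by (simp add: tendsto_of_real_iff)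
  have "(\<lambda>n. \<integral>z. f z * q (\<nu> n) z \<partial>lborel) \<longlonglongrightarrow> (\<integral>z. f z * q \<mu> z \<partial>lborel)"
  proof (rule integral_dominated_convergence[where w="\<lambda>z. \<bar>f z\<bar>"])
    show "AE z in lborel. norm (f z * q (\<nu> n) z) \<le> \<bar>f z\<bar>" for n
      using q[OF \<nu>, of n] by (auto simp: abs_mult intro!: mult_left_le)
  qed (use f in \<open>auto intro!: tendsto_intros q_lim\<close>)
  then show ?thesis
    unfolding integral_gaussian_smoothing[OF \<nu> f s] integral_gaussian_smoothing[OF \<mu> f s] q_def[symmetric]
    using s by (intro tendsto_intros) auto
qed

lemma gaussian_smoothing_uniform:
  fixes f :: "'b::euclidean_space \<Rightarrow> real"
  assumes uc: "uniformly_continuous_on UNIV f" and bd: "\<And>x. \<bar>f x\<bar> \<le> B" and r: "0 < r"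
  shows "\<exists>s>0. \<forall>x. \<bar>(\<integral>y. f (x + s *\<^sub>R y) \<partial>std_gaussian) - f x\<bar> \<le> r"
proof -
  interpret G: prob_space "std_gaussian :: 'b measure" by (rule prob_space_std_gaussian)
  have [measurable]: "f \<in> borel_measurable borel"
    using uniformly_continuous_imp_continuous[OF uc] by (rule borel_measurable_continuous_onI)
  have B0: "0 \<le> B" using bd[of 0] by linarith
  obtain d where d: "d > 0" "\<And>x y. dist y x < d \<Longrightarrow> dist (f y) (f x) < r/2"
    using uc[unfolded uniformly_continuous_on_def, rule_format, of "r/2"] r by auto
  have tail: "(\<lambda>n. measure (std_gaussian :: 'b measure) {y. real n < norm y}) \<longlonglongrightarrow> measure (std_gaussian::'b measure) (\<Inter>n. {y. real n < norm y})"
    by (rule G.finite_Lim_measure_decseq) (auto simp: decseq_def)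
  have "(\<Inter>n. {y::'b. real n < norm y}) = {}"
  proof -
    have "\<exists>n. \<not> real n < norm y" for y :: 'b
      using reals_Archimedean2[of "norm y"] by (auto simp: not_less intro: less_imp_le)
    then show ?thesis by auto
  qed
  with tail have "(\<lambda>n. measure (std_gaussian :: 'b measure) {y. real n < norm y}) \<longlonglongrightarrow> 0" by simp
  from LIMSEQ_D[OF this, of "r / (4 * (B + 1))"] r B0
  obtain n where n: "measure (std_gaussian :: 'b measure) {y. real n < norm y} < r / (4 * (B + 1))"
    by auto
  \<comment> \<open>With this \<open>s\<close>, every y of norm at most n moves x by less than d.
    Larger y have Gaussian mass below r / (4 (B + 1)) and cost at most 2 B; the summand 1 keeps the
    divisor positive when B = 0.\<close>
  define s where "s = d / (2 * (real n + 1))"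
  have s: "s > 0" using d by (simp add: s_def)
  have pt: "\<bar>f (x + s *\<^sub>R y) - f x\<bar> \<le> r/2 + 2 * B * indicator {y. real n < norm y} y" for x y
  proof (cases "real n < norm y")
    case True
    then show ?thesis using bd[of "x + s *\<^sub>R y"] bd[of x] r by simp
  next
    case False
    have "s * norm y \<le> s * real n" using False s by simp
    also have "\<dots> < d" using d by (simp add: s_def field_simps add_nonneg_pos)
    finally have "dist (x + s *\<^sub>R y) x < d" using s by (simp add: dist_norm)
    then show ?thesis using d(2)[of "x + s *\<^sub>R y" x] False by (simp add: dist_real_def)
  qed
  have "\<bar>(\<integral>y. f (x + s *\<^sub>R y) \<partial>std_gaussian) - f x\<bar> \<le> r" for x
  proof -
    have i: "integrable std_gaussian (\<lambda>y. f (x + s *\<^sub>R y))"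
      using bd by (intro G.integrable_const_bound[where B=B]) auto
    then have "\<bar>(\<integral>y. f (x + s *\<^sub>R y) \<partial>std_gaussian) - f x\<bar> = \<bar>\<integral>y. f (x + s *\<^sub>R y) - f x \<partial>std_gaussian\<bar>"
      by (simp add: G.prob_space[simplified])
    also have "\<dots> \<le> (\<integral>y. \<bar>f (x + s *\<^sub>R y) - f x\<bar> \<partial>std_gaussian)" by (rule integral_abs_bound)
    also have "\<dots> \<le> (\<integral>y. r/2 + 2 * B * indicator {y. real n < norm y} y \<partial>(std_gaussian::'b measure))"
      using i pt
      by (intro integral_mono Bochner_Integration.integrable_add integrable_mult_right integrable_real_indicator)
         (auto simp: less_top[symmetric])
    also have "\<dots> = r/2 + 2 * B * measure (std_gaussian::'b measure) {y. real n < norm y}"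
      by (subst Bochner_Integration.integral_add)
         (auto simp: G.prob_space[simplified] less_top[symmetric] intro!: integrable_mult_right integrable_real_indicator)
    also have "\<dots> \<le> r/2 + 2 * B * (r / (4 * (B + 1)))"
      using n B0 by (intro add_left_mono mult_left_mono) auto
    also have "\<dots> \<le> r" using B0 r by (simp add: field_simps)
    finally show ?thesis .
  qed
  with s show ?thesis by blast
qed

text \<open>f is uniformly within r/4 of a Gaussian smoothing of itself, so its integral against any
  probability measure changes by at most r/4; the smoothed integrals converge. Compact support
  supplies both uniform continuity and Lebesgue integrability.\<close>

lemma levy_continuity_compact_support:
  fixes \<nu> :: "nat \<Rightarrow> 'b::euclidean_space measure" and \<mu> :: "'b measure" and f :: "'b \<Rightarrow> real"
  assumes \<nu>: "\<And>n. prob_space (\<nu> n)" "\<And>n. sets (\<nu> n) = sets borel"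
    and \<mu>: "prob_space \<mu>" "sets \<mu> = sets borel"
    and conv: "\<And>t. (\<lambda>n. cfun (\<nu> n) t) \<longlonglongrightarrow> cfun \<mu> t"
    and f: "continuous_on UNIV f" and supp: "\<And>x. norm x > R \<Longrightarrow> f x = 0" and bd: "\<And>x. \<bar>f x\<bar> \<le> B"
  shows "(\<lambda>n. \<integral>x. f x \<partial>\<nu> n) \<longlonglongrightarrow> (\<integral>x. f x \<partial>\<mu>)"
proof -
  interpret G: prob_space "std_gaussian :: 'b measure" by (rule prob_space_std_gaussian)
  have [measurable]: "f \<in> borel_measurable borel"
    using f by (rule borel_measurable_continuous_onI)
  have uc: "uniformly_continuous_on UNIV f"
    unfolding uniformly_continuous_on_def
  proof (intro allI impI)
    fix r :: real assume "r > 0"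
    moreover have "uniformly_continuous_on (cball 0 (R+1)) f"
      using f by (intro compact_uniformly_continuous) (auto intro: continuous_on_subset)
    ultimately obtain d where d: "d > 0"
      "\<And>x y. x \<in> cball 0 (R+1) \<Longrightarrow> y \<in> cball 0 (R+1) \<Longrightarrow> dist y x < d \<Longrightarrow> dist (f y) (f x) < r"
      unfolding uniformly_continuous_on_def by meson
    \<comment> \<open>The radius R + 1 leaves a margin: if the points are closer than 1 and one of
      them lies outside \<open>cball 0 (R+1)\<close>, both have norm above R and f vanishes at
      both.\<close>
    have "dist (f y) (f x) < r" if "dist y x < min d 1" for x y
    proof (cases "x \<in> cball 0 (R+1) \<and> y \<in> cball 0 (R+1)")
      case True then show ?thesis using d that by simp
    next
      case False
      moreover have "norm x \<le> norm y + dist y x" "norm y \<le> norm x + dist y x"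
        by (metis dist_commute dist_norm norm_triangle_sub) (metis dist_norm norm_triangle_sub)
      ultimately have "norm x > R" "norm y > R" using that by auto
      then show ?thesis using supp \<open>r > 0\<close> by simp
    qed
    then show "\<exists>d>0. \<forall>x\<in>UNIV. \<forall>x'\<in>UNIV. dist x' x < d \<longrightarrow> dist (f x') (f x) < r"
      using d(1) by (intro exI[of _ "min d 1"]) auto
  qed
  have fi: "integrable lborel f"
  proof (rule Bochner_Integration.integrable_bound[where f="\<lambda>x. B * indicator (cball 0 R) x"])
    show "integrable lborel (\<lambda>x. B * indicator (cball (0::'b) R) x)"
      by (intro integrable_mult_right integrable_real_indicator emeasure_lborel_cball_finite) simp
    show "AE x in lborel. norm (f x) \<le> norm (B * indicator (cball 0 R) x)"
      using bd supp by (intro AE_I2) (auto simp: indicator_def not_le intro: order_trans[OF _ abs_ge_self])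
  qed auto
  show ?thesis
  proof (rule LIMSEQ_I)
    fix r :: real assume r: "r > 0"
    obtain s where s: "s > 0" "\<And>x. \<bar>(\<integral>y. f (x + s *\<^sub>R y) \<partial>std_gaussian) - f x\<bar> \<le> r/4"
      using gaussian_smoothing_uniform[OF uc bd, of "r/4"] r by auto
    define fs where "fs x = (\<integral>y. f (x + s *\<^sub>R y) \<partial>std_gaussian)" for x
    have [measurable]: "fs \<in> borel_measurable borel" unfolding fs_def
      by (rule G.borel_measurable_lebesgue_integral) measurable
    have fs_bd: "\<bar>fs x\<bar> \<le> B + r/4" for x using s(2)[of x] bd[of x] unfolding fs_def by linarith
    have close: "\<bar>(\<integral>x. fs x \<partial>\<rho>) - (\<integral>x. f x \<partial>\<rho>)\<bar> \<le> r/4" if "prob_space \<rho>" "sets \<rho> = sets borel" for \<rho>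
    proof -
      interpret prob_space \<rho> by fact
      note that(2)[measurable_cong]
      have i: "integrable \<rho> fs" "integrable \<rho> f"
        using fs_bd bd integrable_const_bound[of fs "B + r/4"] integrable_const_bound[of f B] by auto
      then have "\<bar>(\<integral>x. fs x \<partial>\<rho>) - (\<integral>x. f x \<partial>\<rho>)\<bar> = \<bar>\<integral>x. fs x - f x \<partial>\<rho>\<bar>" by simp
      also have "\<dots> \<le> (\<integral>x. \<bar>fs x - f x\<bar> \<partial>\<rho>)" by (rule integral_abs_bound)
      also have "\<dots> \<le> (\<integral>x. r/4 \<partial>\<rho>)" using i s(2) unfolding fs_def by (intro integral_mono) auto
      finally show ?thesis by (simp add: prob_space)
    qed
    have "(\<lambda>n. \<integral>x. fs x \<partial>\<nu> n) \<longlonglongrightarrow> (\<integral>x. fs x \<partial>\<mu>)"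
      unfolding fs_def by (rule tendsto_gaussian_smoothing[OF \<nu> \<mu> conv fi s(1)])
    from LIMSEQ_D[OF this, of "r/4"] r obtain N where
      N: "\<And>n. n \<ge> N \<Longrightarrow> \<bar>(\<integral>x. fs x \<partial>\<nu> n) - (\<integral>x. fs x \<partial>\<mu>)\<bar> < r/4" by auto
    have "\<bar>(\<integral>x. f x \<partial>\<nu> n) - (\<integral>x. f x \<partial>\<mu>)\<bar> < r" if "n \<ge> N" for n
      using N[OF that] close[OF \<nu>, of n] close[OF \<mu>] r by linarith
    then show "\<exists>no. \<forall>n\<ge>no. norm ((\<integral>x. f x \<partial>\<nu> n) - (\<integral>x. f x \<partial>\<mu>)) < r" by auto
  qed
qed

text \<open>The cutoffs \<kappa> m are themselves continuous with compact support, so their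
  integrals against \<nu> n converge, and \<nu> n eventually puts nearly as little mass outside
  large balls as \<mu> does. Tightness thus comes out of the compactly supported case, and a bounded
  f may be replaced by f times \<kappa> m.\<close>

theorem levy_continuity_euclidean:
  fixes \<nu> :: "nat \<Rightarrow> 'b::euclidean_space measure" and \<mu> :: "'b measure"
  assumes \<nu>: "\<And>n. prob_space (\<nu> n)" "\<And>n. sets (\<nu> n) = sets borel"
    and \<mu>: "prob_space \<mu>" "sets \<mu> = sets borel"
    and conv: "\<And>t. (\<lambda>n. cfun (\<nu> n) t) \<longlonglongrightarrow> cfun \<mu> t"
  shows "weak_conv_eucl \<nu> \<mu>"
  unfolding weak_conv_eucl_def
proof (intro allI impI, elim conjE)
  fix f :: "'b \<Rightarrow> real" assume f: "continuous_on UNIV f" and "bounded (range f)"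
  then obtain B where bd: "\<And>x. \<bar>f x\<bar> \<le> B" by (auto simp: bounded_iff)
  have B0: "0 \<le> B" using bd[of 0] by linarith
  interpret mu: prob_space \<mu> by fact
  note \<mu>(2)[measurable_cong]
  define \<kappa> where "\<kappa> m x = max 0 (min 1 (real m + 1 - norm x))" for m and x :: 'b
  have \<kappa>_cont: "continuous_on UNIV (\<kappa> m)" for m unfolding \<kappa>_def by (intro continuous_intros)
  have \<kappa>_bd: "0 \<le> \<kappa> m x" "\<kappa> m x \<le> 1" for m x by (auto simp: \<kappa>_def)
  have [measurable]: "\<kappa> m \<in> borel_measurable borel" "f \<in> borel_measurable borel" for m
    using \<kappa>_cont f by (auto intro: borel_measurable_continuous_onI)
  have "(\<lambda>m. \<integral>x. \<kappa> m x \<partial>\<mu>) \<longlonglongrightarrow> (\<integral>x. 1 \<partial>\<mu>)"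
  proof (rule integral_dominated_convergence[where w="\<lambda>_. 1"])
    have "(\<lambda>m. \<kappa> m x) \<longlonglongrightarrow> 1" for x
    proof (rule tendsto_eventually, rule eventually_sequentiallyI[of "nat \<lceil>norm x\<rceil>"])
      fix m assume "m \<ge> nat \<lceil>norm x\<rceil>"
      then have "norm x \<le> real m" by linarith
      then show "\<kappa> m x = 1" by (simp add: \<kappa>_def)
    qed
    then show "AE x in \<mu>. (\<lambda>m. \<kappa> m x) \<longlonglongrightarrow> 1" by simp
  qed (use \<kappa>_bd in auto)
  then have \<kappa>_lim: "(\<lambda>m. \<integral>x. \<kappa> m x \<partial>\<mu>) \<longlonglongrightarrow> 1" by (simp add: mu.prob_space)
  have cut: "\<bar>(\<integral>x. f x \<partial>\<rho>) - (\<integral>x. f x * \<kappa> m x \<partial>\<rho>)\<bar> \<le> B * (1 - (\<integral>x. \<kappa> m x \<partial>\<rho>))"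
    if "prob_space \<rho>" "sets \<rho> = sets borel" for \<rho> m
  proof -
    interpret prob_space \<rho> by fact
    note that(2)[measurable_cong]
    have fx: "\<bar>f x * \<kappa> m x\<bar> \<le> B" for x
      using bd[of x] \<kappa>_bd[of m x] by (simp add: abs_mult) (meson mult_left_le order_trans abs_ge_zero)
    have i: "integrable \<rho> f" "integrable \<rho> (\<kappa> m)" "integrable \<rho> (\<lambda>x. f x * \<kappa> m x)"
      using \<kappa>_bd bd fx integrable_const_bound[of f B] integrable_const_bound[of "\<kappa> m" 1]
        integrable_const_bound[of "\<lambda>x. f x * \<kappa> m x" B] by auto
    then have "\<bar>(\<integral>x. f x \<partial>\<rho>) - (\<integral>x. f x * \<kappa> m x \<partial>\<rho>)\<bar> = \<bar>\<integral>x. f x - f x * \<kappa> m x \<partial>\<rho>\<bar>" by simp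
    also have "\<dots> \<le> (\<integral>x. \<bar>f x - f x * \<kappa> m x\<bar> \<partial>\<rho>)" by (rule integral_abs_bound)
    also have "\<dots> \<le> (\<integral>x. B * (1 - \<kappa> m x) \<partial>\<rho>)"
    proof (rule integral_mono)
      fix x
      have "f x - f x * \<kappa> m x = f x * (1 - \<kappa> m x)" by (simp add: algebra_simps)
      then have "\<bar>f x - f x * \<kappa> m x\<bar> = \<bar>f x\<bar> * (1 - \<kappa> m x)"
        using \<kappa>_bd[of m x] by (simp add: abs_mult)
      then show "\<bar>f x - f x * \<kappa> m x\<bar> \<le> B * (1 - \<kappa> m x)"
        using bd \<kappa>_bd by (simp add: mult_right_mono)
    qed (use i in auto)
    also have "\<dots> = B * (1 - (\<integral>x. \<kappa> m x \<partial>\<rho>))" using i by (simp add: prob_space)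
    finally show ?thesis .
  qed
  show "(\<lambda>n. \<integral>x. f x \<partial>\<nu> n) \<longlonglongrightarrow> (\<integral>x. f x \<partial>\<mu>)"
  proof (rule LIMSEQ_I)
    fix r :: real assume r: "r > 0"
    \<comment> \<open>Error budget in units of r/5: two for cutting f off under \<nu> n, one for
      cutting it off under \<mu>, one for the convergence of the cut-off integrals.\<close>
    define r' where "r' = r / (5 * (B + 1))"
    have r': "r' > 0" "B * r' \<le> r / 5" using r B0 by (auto simp: r'_def field_simps)
    obtain m where m: "1 - (\<integral>x. \<kappa> m x \<partial>\<mu>) < r'"
      using LIMSEQ_D[OF \<kappa>_lim r'(1)] by (auto simp: abs_less_iff)
    have supp: "\<kappa> m x = 0" if "norm x > real m + 1" for x using that by (simp add: \<kappa>_def)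
    have l1: "(\<lambda>n. \<integral>x. \<kappa> m x \<partial>\<nu> n) \<longlonglongrightarrow> (\<integral>x. \<kappa> m x \<partial>\<mu>)"
      using supp \<kappa>_bd by (intro levy_continuity_compact_support[OF \<nu> \<mu> conv \<kappa>_cont, where B=1]) auto
    have l2: "(\<lambda>n. \<integral>x. f x * \<kappa> m x \<partial>\<nu> n) \<longlonglongrightarrow> (\<integral>x. f x * \<kappa> m x \<partial>\<mu>)"
    proof (rule levy_continuity_compact_support[OF \<nu> \<mu> conv, where R="real m + 1"])
      show "continuous_on UNIV (\<lambda>x. f x * \<kappa> m x)" using f \<kappa>_cont by (intro continuous_intros)
      show "\<bar>f x * \<kappa> m x\<bar> \<le> B" for x
        using bd[of x] \<kappa>_bd[of m x] by (simp add: abs_mult) (meson mult_left_le order_trans abs_ge_zero)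
    qed (simp add: supp)
    obtain N1 where N1: "\<And>n. n \<ge> N1 \<Longrightarrow> \<bar>(\<integral>x. \<kappa> m x \<partial>\<nu> n) - (\<integral>x. \<kappa> m x \<partial>\<mu>)\<bar> < r'"
      using LIMSEQ_D[OF l1 r'(1)] by auto
    obtain N2 where N2: "\<And>n. n \<ge> N2 \<Longrightarrow> \<bar>(\<integral>x. f x * \<kappa> m x \<partial>\<nu> n) - (\<integral>x. f x * \<kappa> m x \<partial>\<mu>)\<bar> < r/5"
      using LIMSEQ_D[OF l2, of "r/5"] r by auto
    have "\<bar>(\<integral>x. f x \<partial>\<nu> n) - (\<integral>x. f x \<partial>\<mu>)\<bar> < r" if n: "n \<ge> max N1 N2" for n
    proof -
      have "B * (1 - (\<integral>x. \<kappa> m x \<partial>\<nu> n)) \<le> B * (2 * r')"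
        using N1[of n] m n B0 by (intro mult_left_mono) auto
      moreover have "B * (1 - (\<integral>x. \<kappa> m x \<partial>\<mu>)) \<le> B * r'"
        using m B0 by (intro mult_left_mono) auto
      moreover have "\<bar>(\<integral>x. f x * \<kappa> m x \<partial>\<nu> n) - (\<integral>x. f x * \<kappa> m x \<partial>\<mu>)\<bar> < r/5" using N2 n by simp
      ultimately show ?thesis using cut[OF \<nu>, of n m] cut[OF \<mu>, of m] r'(2) by linarith
    qed
    then show "\<exists>no. \<forall>n\<ge>no. norm ((\<integral>x. f x \<partial>\<nu> n) - (\<integral>x. f x \<partial>\<mu>)) < r"
      by (intro exI[of _ "max N1 N2"]) auto
  qed
qed

subsection \<open>Multivariate normal distributions\<close>

lemma inner_transpose_vector:
  fixes B :: "real^'n^'m"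
  shows "(transpose B *v x) \<bullet> y = x \<bullet> (B *v y)"
  by (simp add: dot_lmul_matrix)

lemma borel_measurable_matrix_vector_mult [measurable]:
  fixes B :: "real^'n^'m"
  shows "(*v) B \<in> borel_measurable borel"
  by (intro borel_measurable_continuous_onI linear_continuous_on matrix_vector_mul_bounded_linear)

lemma
  fixes A :: "real^'n^'m"
  assumes "invertible A"
  shows matrix_inv_right: "A ** matrix_inv A = mat 1"
    and matrix_inv_left: "matrix_inv A ** A = mat 1"
  using someI_ex[OF assms[unfolded invertible_def]] by (simp_all add: matrix_inv_def)

lemma sym_pos_def_invertible:
  assumes "sym_pos_def (A :: real^'d^'d)"
  shows "invertible A"
proof -
  have "x = 0" if "A *v x = 0" for x
    using assms that unfolding sym_pos_def_def by (metis inner_zero_right less_irrefl)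
  then show ?thesis
    by (simp add: invertible_left_inverse matrix_left_invertible_ker)
qed

lemma matrix_inv_eqI:
  fixes A B :: "real^'d^'d"
  assumes "A ** B = mat 1"
  shows "matrix_inv A = B"
  using assms by (metis invertible_def matrix_inv_left matrix_left_right_inverse matrix_mul_assoc matrix_mul_lid matrix_mul_rid)

lemma sym_pos_def_matrix_inv:
  assumes "sym_pos_def (A :: real^'d^'d)"
  shows "sym_pos_def (matrix_inv A)"
proof -
  note inv = sym_pos_def_invertible[OF assms]
  have AI: "A ** matrix_inv A = mat 1" "matrix_inv A ** A = mat 1"
    using inv by (simp_all add: matrix_inv_right matrix_inv_left)
  have "A ** transpose (matrix_inv A) = transpose (matrix_inv A ** A)"
    using assms by (simp add: matrix_transpose_mul sym_pos_def_def)
  then have sym: "transpose (matrix_inv A) = matrix_inv A"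
    by (metis AI(2) matrix_inv_eqI transpose_mat)
  have "0 < x \<bullet> (matrix_inv A *v x)" if "x \<noteq> 0" for x
  proof -
    define y where "y = matrix_inv A *v x"
    have x: "x = A *v y" by (simp add: y_def matrix_vector_mul_assoc AI)
    with that have "y \<noteq> 0" by auto
    then have "0 < y \<bullet> (A *v y)" using assms by (simp add: sym_pos_def_def)
    then show ?thesis by (simp add: x[symmetric] y_def[symmetric] inner_commute)
  qed
  with sym show ?thesis by (simp add: sym_pos_def_def)
qed

lemma sym_pos_def_congruence:
  fixes S C :: "real^'d^'d"
  assumes "sym_pos_def S" "invertible C"
  shows "sym_pos_def (C ** S ** transpose C)"
proof -
  have "transpose (C ** S ** transpose C) = C ** S ** transpose C"
    using assms by (simp add: matrix_transpose_mul sym_pos_def_def matrix_mul_assoc)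
  moreover have "0 < x \<bullet> (C ** S ** transpose C *v x)" if "x \<noteq> 0" for x
  proof -
    have "invertible (transpose C)" using assms(2) by (rule transpose_invertible)
    then have "transpose C *v x \<noteq> 0" using that
      by (metis invertible_left_inverse matrix_left_invertible_ker)
    then have "0 < (transpose C *v x) \<bullet> (S *v (transpose C *v x))"
      using assms by (simp add: sym_pos_def_def)
    also have "\<dots> = x \<bullet> (C ** S ** transpose C *v x)"
      unfolding inner_transpose_vector by (simp only: matrix_vector_mul_assoc matrix_mul_assoc)
    finally show ?thesis .
  qed
  ultimately show ?thesis by (simp add: sym_pos_def_def)
qed

text \<open>Gram-Schmidt for the scalar product x . Q y, by induction on the index set. Fewer than
  \<open>CARD('d)\<close> vectors do not span, so some v lies outside their span; subtracting its
  Q-projections leaves a nonzero vector, which is normalised. Indexing by \<open>'d\<close> lets the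
  vectors become the columns of a matrix.\<close>

lemma conjugate_basis_exists:
  fixes Q :: "real^'d^'d" and I :: "'d set"
  assumes Q: "sym_pos_def Q"
  shows "\<exists>b. \<forall>i\<in>I. \<forall>j\<in>I. b i \<bullet> (Q *v b j) = (if i = j then 1 else 0)"
proof (induction I rule: finite_induct[OF finite])
  case 1 then show ?case by simp
next
  case (2 k I)
  have sym: "x \<bullet> (Q *v y) = y \<bullet> (Q *v x)" for x y
    using Q unfolding sym_pos_def_def by (metis dot_lmul_matrix inner_commute transpose_matrix_vector)
  obtain b where b: "\<And>i j. i \<in> I \<Longrightarrow> j \<in> I \<Longrightarrow> b i \<bullet> (Q *v b j) = (if i = j then 1 else 0)"
    using 2 by blast
  have "card (b ` I) < DIM(real^'d)"
  proof -
    have "card (b ` I) \<le> card I" by (rule card_image_le) simp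
    also have "\<dots> < CARD('d)" using 2 by (metis UNIV_I finite_code psubsetI psubset_card_mono subset_UNIV)
    finally show ?thesis by simp
  qed
  then have "span (b ` I) \<noteq> UNIV"
    by (metis dim_UNIV dim_le_card' dim_span finite_code finite_imageI leD)
  then obtain v where v: "v \<notin> span (b ` I)" by auto
  define w where "w = v - (\<Sum>i\<in>I. (b i \<bullet> (Q *v v)) *\<^sub>R b i)"
  have "w \<noteq> 0"
  proof
    assume "w = 0"
    then have "v = (\<Sum>i\<in>I. (b i \<bullet> (Q *v v)) *\<^sub>R b i)" by (simp add: w_def)
    also have "\<dots> \<in> span (b ` I)" by (intro span_sum span_scale span_base) auto
    finally show False using v by simp
  qed
  then have pos: "0 < w \<bullet> (Q *v w)" using Q by (simp add: sym_pos_def_def)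
  have orth: "b j \<bullet> (Q *v w) = 0" if "j \<in> I" for j
  proof -
    have "w \<bullet> (Q *v b j) = v \<bullet> (Q *v b j) - (\<Sum>i\<in>I. (b i \<bullet> (Q *v v)) * (b i \<bullet> (Q *v b j)))"
      by (simp add: w_def inner_diff_left inner_sum_left)
    also have "(\<Sum>i\<in>I. (b i \<bullet> (Q *v v)) * (b i \<bullet> (Q *v b j))) = (\<Sum>i\<in>I. if i = j then b j \<bullet> (Q *v v) else 0)"
      using that by (intro sum.cong) (auto simp: b)
    also have "\<dots> = b j \<bullet> (Q *v v)" using that by simp
    finally show ?thesis by (simp add: sym[of v] sym[of w])
  qed
  define c where "c = 1 / sqrt (w \<bullet> (Q *v w))"
  have c: "c * c * (w \<bullet> (Q *v w)) = 1" using pos by (simp add: c_def field_simps)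
  define b' where "b' = b(k := c *\<^sub>R w)"
  have "b' i \<bullet> (Q *v b' j) = (if i = j then 1 else 0)" if "i \<in> insert k I" "j \<in> insert k I" for i j
  proof (cases "i = k"; cases "j = k")
    assume "i = k" "j = k"
    then show ?thesis using c by (simp add: b'_def matrix_vector_mult_scaleR mult.assoc)
  next
    assume "i = k" "j \<noteq> k"
    then show ?thesis using that orth[of j] by (simp add: b'_def sym[of w])
  next
    assume "i \<noteq> k" "j = k"
    then show ?thesis using that orth[of i] by (simp add: b'_def matrix_vector_mult_scaleR)
  next
    assume "i \<noteq> k" "j \<noteq> k"
    then show ?thesis using that b by (simp add: b'_def)
  qed
  then show ?case by blast
qed

text \<open>The columns of \<open>B\<close> are orthonormal for the scalar product of the inverse of
  \<open>V\<close>, which is the third equation; the first follows by inverting it. The third is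
  exported too, because it turns the exponent of the normal density at B y into the squared norm of
  y.\<close>

lemma sym_pos_def_factor:
  fixes V :: "real^'d^'d"
  assumes V: "sym_pos_def V"
  obtains B :: "real^'d^'d" where "V = B ** transpose B" "invertible B" "transpose B ** matrix_inv V ** B = mat 1"
proof -
  define Q where "Q = matrix_inv V"
  have VQ: "Q ** V = mat 1" unfolding Q_def
    using sym_pos_def_invertible[OF V] by (simp add: matrix_inv_left)
  obtain b :: "'d \<Rightarrow> real^'d" where b: "\<And>i j. b i \<bullet> (Q *v b j) = (if i = j then 1 else 0)"
    using conjugate_basis_exists[OF sym_pos_def_matrix_inv[OF V], of UNIV] unfolding Q_def by auto
  define B where "B = (\<chi> i j. b j $ i)"
  have BQB: "transpose B ** Q ** B = mat 1"
  proof -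
    have "(transpose B ** (Q ** B)) $ i $ j = b i \<bullet> (Q *v b j)" for i j
      by (simp add: matrix_matrix_mult_def matrix_vector_mult_def B_def transpose_def inner_vec_def)
    then show ?thesis by (simp add: vec_eq_iff b mat_def matrix_mul_assoc)
  qed
  then have inv: "invertible B" using invertible_left_inverse by blast
  have "B ** (transpose B ** Q) = mat 1"
    using BQB by (simp add: matrix_left_right_inverse)
  then have "V = B ** transpose B"
    using VQ by (metis matrix_mul_assoc matrix_mul_lid matrix_mul_rid)
  then show thesis by (rule that[OF _ inv BQB[unfolded Q_def]])
qed

text \<open>Lebesgue measure is characterised by the volumes of boxes. The preimage of a box under
  \<open>B\<close> is its image under the inverse \<open>C\<close>, whose volume carries the factor
  \<bar>det C\<bar>, and the density \<bar>det B\<bar> cancels it.\<close>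

lemma lborel_linear_image_wellorder:
  fixes B :: "real^('d::{finite,wellorder})^('d::{finite,wellorder})"
  assumes B: "invertible B"
  shows "lborel = density (distr lborel borel ((*v) B)) (\<lambda>_. ennreal \<bar>det B\<bar>)"
proof (rule lborel_eqI)
  fix l u :: "(real, 'd) vec" assume lu: "\<And>b. b \<in> Basis \<Longrightarrow> l \<bullet> b \<le> u \<bullet> b"
  define C where "C = matrix_inv B"
  have CB: "C ** B = mat 1" "B ** C = mat 1" using B by (simp_all add: C_def matrix_inv_left matrix_inv_right)
  have det: "\<bar>det B\<bar> * \<bar>det C\<bar> = 1"
    using CB(2) by (metis abs_mult abs_one det_I det_mul)
  have vim: "(*v) B -` box l u = (*v) C ` box l u"
  proof safe
    fix x assume "B *v x \<in> box l u"
    moreover have "x = C *v (B *v x)" by (simp add: matrix_vector_mul_assoc CB)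
    ultimately show "x \<in> (*v) C ` box l u" by blast
  qed (simp add: matrix_vector_mul_assoc CB)
  have lin: "linear ((*v) C)" by (rule matrix_vector_mul_linear)
  have meas: "(*v) C ` box l u \<in> lmeasurable" by (rule measurable_linear_image[OF lin]) simp
  have sb: "(*v) C ` box l u \<in> sets borel"
    unfolding vim[symmetric] using measurable_sets[of "(*v) B" borel borel "box l u"] by simp
  have "emeasure lborel ((*v) C ` box l u) = emeasure lebesgue ((*v) C ` box l u)"
    using sb by simp
  also have "\<dots> = ennreal (measure lebesgue ((*v) C ` box l u))"
    by (rule emeasure_eq_measure2[OF meas])
  also have "measure lebesgue ((*v) C ` box l u) = \<bar>det C\<bar> * measure lebesgue (box l u)"
    by (subst measure_linear_image[OF lin]) auto
  also have "measure lebesgue (box l u) = (\<Prod>b\<in>Basis. (u - l) \<bullet> b)"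
    using lu by (subst measure_completion)
      (auto simp: measure_def emeasure_lborel_box[OF lu] inner_diff_left intro!: enn2real_ennreal prod_nonneg)
  finally have em: "emeasure lborel ((*v) C ` box l u) = ennreal (\<bar>det C\<bar> * (\<Prod>b\<in>Basis. (u - l) \<bullet> b))" .
  have "emeasure (density (distr lborel borel ((*v) B)) (\<lambda>_. ennreal \<bar>det B\<bar>)) (box l u)
      = ennreal \<bar>det B\<bar> * emeasure lborel ((*v) C ` box l u)"
    by (simp add: emeasure_density nn_integral_cmult emeasure_distr vim)
  also have "\<dots> = ennreal (\<Prod>b\<in>Basis. (u - l) \<bullet> b)"
    unfolding em using det
    by (simp add: ennreal_mult'[symmetric] mult.assoc[symmetric])
  finally show "emeasure (density (distr lborel borel ((*v) B)) (\<lambda>_. ennreal \<bar>det B\<bar>)) (box l u)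
      = ennreal (\<Prod>b\<in>Basis. (u - l) \<bullet> b)" .
qed simp

text \<open>The change of variables formula of the library asks for well-ordered index types, so it is
  transported from an initial segment of the naturals of the right size.\<close>

typedef (overloaded) ('d::finite) segment = "{..<CARD('d)}"
  by (rule exI[of _ 0]) simp

instance segment :: (finite) finite
proof
  show "finite (UNIV :: 'a segment set)"
    using type_definition.univ[OF type_definition_segment] by (metis finite_imageI finite_lessThan)
qed

lemma card_segment: "CARD('d::finite segment) = CARD('d)"
  using type_definition.card[OF type_definition_segment] by (metis card_lessThan)

instantiation segment :: (finite) linorder
begin
definition less_segment :: "'a segment \<Rightarrow> 'a segment \<Rightarrow> bool" where
  "less_segment a b \<longleftrightarrow> Rep_segment a < Rep_segment b"
definition less_eq_segment :: "'a segment \<Rightarrow> 'a segment \<Rightarrow> bool" where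
  "less_eq_segment a b \<longleftrightarrow> Rep_segment a \<le> Rep_segment b"
instance
  by intro_classes (auto simp: less_segment_def less_eq_segment_def Rep_segment_inject)
end

instance segment :: (finite) wellorder
proof -
  have "wf {(x :: 'a segment, y). x < y}"
    by (rule wf_subset[OF wf_measure[of Rep_segment]]) (auto simp: less_segment_def)
  then show "OFCLASS('a segment, wellorder_class)"
    by (rule wf_wellorderI) intro_classes
qed

text \<open>Conjugation by \<open>g\<close> is a sign-preserving bijection between the permutations
  of the two index types, and it matches the Leibniz expansions term by term.\<close>

lemma det_reindex:
  fixes A :: "real^'d^'d" and g :: "'e::finite \<Rightarrow> 'd"
  assumes g: "bij g"
  shows "det (\<chi> a b. A $ g a $ g b) = det A"
proof -
  let ?m = "map_permutation UNIV g"
  have inj: "inj g" and gU: "bij_betw g UNIV UNIV" using g by (auto simp: bij_def)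
  have bij: "bij_betw ?m {p. p permutes UNIV} {p. p permutes UNIV}"
  proof (rule bij_betwI[where g="map_permutation UNIV (inv g)"])
    show "?m \<in> {p. p permutes UNIV} \<rightarrow> {p. p permutes UNIV}"
      using map_permutation_permutes[OF gU] by auto
    show "map_permutation UNIV (inv g) \<in> {p. p permutes UNIV} \<rightarrow> {p. p permutes UNIV}"
      using map_permutation_permutes[of "inv g" UNIV UNIV] g by (auto simp: bij_imp_bij_inv)
  qed (use g in \<open>auto intro!: map_permutation_compose_inv simp: bij_imp_bij_inv bij_is_inj bij_is_surj surj_f_inv_f\<close>)
  have "det (\<chi> a b. A $ g a $ g b) = (\<Sum>p | p permutes UNIV. of_int (sign p) * (\<Prod>a\<in>UNIV. A $ g a $ g (p a)))"
    by (simp add: det_def)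
  also have "\<dots> = (\<Sum>p | p permutes UNIV. of_int (sign (?m p)) * (\<Prod>i\<in>UNIV. A $ i $ (?m p i)))"
  proof (rule sum.cong[OF refl], clarify)
    fix p :: "'e \<Rightarrow> 'e" assume p: "p permutes UNIV"
    have "(\<Prod>i\<in>UNIV. A $ i $ (?m p i)) = (\<Prod>a\<in>UNIV. A $ g a $ (?m p (g a)))"
      by (rule prod.reindex_bij_betw[OF gU, symmetric])
    also have "\<dots> = (\<Prod>a\<in>UNIV. A $ g a $ g (p a))"
      using inj by (simp add: map_permutation_apply)
    finally show "of_int (sign p) * (\<Prod>a\<in>UNIV. A $ g a $ g (p a))
        = of_int (sign (?m p)) * (\<Prod>i\<in>UNIV. A $ i $ (?m p i))"
      using p inj by (simp add: sign_map_permutation)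
  qed
  also have "\<dots> = (\<Sum>p | p permutes UNIV. of_int (sign p) * (\<Prod>i\<in>UNIV. A $ i $ (p i)))"
    by (rule sum.reindex_bij_betw[OF bij])
  finally show ?thesis by (simp add: det_def)
qed

text \<open>The preimage of a box is the box with relabelled sides, so its volume is the same
  product taken in another order.\<close>

lemma lborel_reindex:
  fixes h :: "'d::finite \<Rightarrow> 'e::finite"
  assumes h: "bij h"
  shows "(lborel :: (real^'d) measure) = distr lborel borel (\<lambda>y::real^'e. \<chi> i. y $ h i)"
proof (rule lborel_eqI)
  let ?r = "\<lambda>y::real^'e. (\<chi> i. y $ h i) :: real^'d"
  have [measurable]: "?r \<in> borel_measurable borel"
    by (intro borel_measurable_continuous_onI continuous_intros)
  fix l u :: "real^'d" assume lu: "\<And>b. b \<in> Basis \<Longrightarrow> l \<bullet> b \<le> u \<bullet> b"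
  define l' u' where "l' = (\<chi> j. l $ inv h j)" and "u' = (\<chi> j. u $ inv h j)"
  have le: "l $ i \<le> u $ i" for i using lu[of "axis i 1"] by (simp add: inner_axis)
  have eq: "?r -` box l u = box l' u'"
    using h by (auto simp: mem_box_cart l'_def u'_def bij_inv_eq_iff)
      (metis bij_inv_eq_iff)+
  have "emeasure (distr lborel borel ?r) (box l u) = emeasure lborel (box l' u')"
    by (simp add: emeasure_distr eq)
  also have "\<dots> = (\<Prod>b\<in>Basis. (u' - l') \<bullet> b)"
    using le by (intro emeasure_lborel_box) (auto simp: Basis_vec_def inner_axis l'_def u'_def)
  also have "(\<Prod>b\<in>Basis. (u' - l') \<bullet> b) = (\<Prod>j\<in>UNIV. (u' - l') $ j)"
    by (simp add: Basis_vec_def prod.UNION_disjoint UNION_singleton_eq_range prod.reindex inj_on_def axis_eq_axis inner_axis)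
  also have "\<dots> = (\<Prod>i\<in>UNIV. (u' - l') $ h i)"
    using h by (intro prod.reindex_bij_betw[symmetric]) auto
  also have "\<dots> = (\<Prod>i\<in>UNIV. (u - l) $ i)"
    using h by (simp add: l'_def u'_def bij_is_inj)
  also have "\<dots> = (\<Prod>b\<in>Basis. (u - l) \<bullet> b)"
    by (simp add: Basis_vec_def UNION_singleton_eq_range prod.reindex inj_on_def axis_eq_axis inner_axis)
  finally show "emeasure (distr lborel borel ?r) (box l u) = ennreal (\<Prod>b\<in>Basis. (u - l) \<bullet> b)" .
qed simp

text \<open>Let \<open>r\<close> relabel the coordinates along \<open>g\<close>. Then B after r
  equals r after B', and the two determinants agree, so the formula for B' on the well-ordered index
  type is carried over by \<open>r\<close>.\<close>

lemma lborel_linear_image: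
  fixes B :: "real^'d^'d"
  assumes B: "invertible B"
  shows "lborel = density (distr lborel borel ((*v) B)) (\<lambda>_. ennreal \<bar>det B\<bar>)"
proof -
  obtain g :: "'d segment \<Rightarrow> 'd" where g: "bij g"
    using finite_same_card_bij[of "UNIV :: 'd segment set" "UNIV :: 'd set"] by (auto simp: card_segment)
  define B' where "B' = (\<chi> a b. B $ g a $ g b)"
  define r :: "real^('d segment) \<Rightarrow> real^'d" where "r y = (\<chi> i. y $ inv g i)" for y
  have [measurable]: "r \<in> borel_measurable borel" unfolding r_def
    by (intro borel_measurable_continuous_onI continuous_intros)
  have det: "det B' = det B" unfolding B'_def by (rule det_reindex[OF g])
  then have B': "invertible B'" using B by (simp add: invertible_det_nz)
  have L: "(lborel :: (real^'d) measure) = distr lborel borel r"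
    unfolding r_def by (rule lborel_reindex) (simp add: bij_imp_bij_inv g)
  have comm: "r (B' *v y) = B *v r y" for y
  proof -
    have "(\<Sum>b\<in>UNIV. B $ i $ g b * y $ b) = (\<Sum>j\<in>UNIV. B $ i $ j * y $ inv g j)" for i
      using sum.reindex_bij_betw[OF g, of "\<lambda>j. B $ i $ j * y $ inv g j"] g by (simp add: bij_is_inj)
    then show ?thesis
      using g by (simp add: vec_eq_iff r_def B'_def matrix_vector_mult_def bij_is_surj surj_f_inv_f)
  qed
  have "(lborel :: (real^'d) measure)
      = distr (density (distr lborel borel ((*v) B')) (\<lambda>_. ennreal \<bar>det B'\<bar>)) borel r"
    by (subst L, subst lborel_linear_image_wellorder[OF B']) simp
  also have "\<dots> = density (distr (distr lborel borel ((*v) B')) borel r) (\<lambda>_. ennreal \<bar>det B'\<bar>)"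
    by (subst density_distr) auto
  also have "distr (distr lborel borel ((*v) B')) borel r = distr lborel borel (\<lambda>y. B *v r y)"
    by (subst distr_distr) (auto simp: comp_def comm)
  also have "\<dots> = distr (distr lborel borel r) borel ((*v) B)"
    by (subst distr_distr) (auto simp: comp_def)
  finally show ?thesis by (simp add: L[symmetric] det)
qed

text \<open>The Jacobian \<bar>det B\<bar> cancels against the square root of det V = (det B)^2 in
  the normalising constant, and the third hypothesis makes the quadratic form at B y equal to the
  squared norm of y.\<close>

lemma mv_normal_eq_distr:
  fixes V B :: "real^'d^'d"
  assumes VB: "V = B ** transpose B" and B: "invertible B" and BQB: "transpose B ** matrix_inv V ** B = mat 1"
  shows "mv_normal V = distr std_gaussian borel ((*v) B)"
proof -
  have [measurable]: "gaussian_density V \<in> borel_measurable borel"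
    unfolding gaussian_density_def by measurable
  have detB: "det B \<noteq> 0" using B by (simp add: invertible_det_nz)
  have dens: "\<bar>det B\<bar> * gaussian_density V (B *v y) = (\<Prod>b\<in>Basis. std_normal_density (y \<bullet> b))" for y
  proof -
    have "(B *v y) \<bullet> (matrix_inv V *v (B *v y)) = y \<bullet> ((transpose B ** matrix_inv V ** B) *v y)"
      using inner_transpose_vector[of "transpose B" y] by (simp only: matrix_vector_mul_assoc[symmetric] transpose_transpose)
    also have "\<dots> = (norm y)\<^sup>2" by (simp add: BQB power2_norm_eq_inner)
    finally have 1: "(B *v y) \<bullet> (matrix_inv V *v (B *v y)) = (norm y)\<^sup>2" .
    have 2: "sqrt ((2 * pi) ^ CARD('d) * det V) = sqrt (2 * pi) ^ CARD('d) * \<bar>det B\<bar>"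
      by (simp add: VB det_mul real_sqrt_mult real_sqrt_power power_mult_distrib)
    show ?thesis unfolding gaussian_density_def 1 2 prod_std_normal_density_Basis
      using detB by simp
  qed
  have "mv_normal V = density (density (distr lborel borel ((*v) B)) (\<lambda>_. ennreal \<bar>det B\<bar>))
      (\<lambda>x. ennreal (gaussian_density V x))"
    unfolding mv_normal_def by (subst lborel_linear_image[OF B]) simp
  also have "\<dots> = density (distr lborel borel ((*v) B)) (\<lambda>x. ennreal \<bar>det B\<bar> * ennreal (gaussian_density V x))"
    by (subst density_density_eq) auto
  also have "\<dots> = distr (density lborel (\<lambda>y. ennreal \<bar>det B\<bar> * ennreal (gaussian_density V (B *v y)))) borel ((*v) B)"
    by (subst density_distr) auto
  also have "\<dots> = distr std_gaussian borel ((*v) B)"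
    unfolding std_gaussian_def by (simp add: ennreal_mult'[symmetric] dens)
  finally show ?thesis .
qed

lemma
  fixes V :: "real^'d^'d"
  assumes V: "sym_pos_def V"
  shows prob_space_mv_normal: "prob_space (mv_normal V)"
    and cfun_mv_normal: "cfun (mv_normal V) t = complex_of_real (exp (- (t \<bullet> (V *v t)) / 2))"
proof -
  obtain B :: "real^'d^'d" where B: "V = B ** transpose B" "invertible B" "transpose B ** matrix_inv V ** B = mat 1"
    using sym_pos_def_factor[OF V] by blast
  interpret G: prob_space "std_gaussian :: (real^'d) measure" by (rule prob_space_std_gaussian)
  show "prob_space (mv_normal V)"
    unfolding mv_normal_eq_distr[OF B] by (rule G.prob_space_distr) measurable
  have "cfun (mv_normal V) t = (CLINT x|std_gaussian. iexp ((transpose B *v t) \<bullet> x))"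
    unfolding mv_normal_eq_distr[OF B] cfun_def
    by (subst integral_distr) (auto simp only: inner_transpose_vector, measurable)
  also have "\<dots> = complex_of_real (exp (- (norm (transpose B *v t))\<^sup>2 / 2))"
    by (rule char_std_gaussian)
  also have "(norm (transpose B *v t))\<^sup>2 = t \<bullet> (V *v t)"
    unfolding power2_norm_eq_inner inner_transpose_vector by (simp only: B(1) matrix_vector_mul_assoc)
  finally show "cfun (mv_normal V) t = complex_of_real (exp (- (t \<bullet> (V *v t)) / 2))" .
qed

subsection \<open>A martingale central limit theorem\<close>

lemma (in prob_space) sigma_finite_subalgebraI:
  assumes "subalgebra M F"
  shows "sigma_finite_subalgebra M F"
  using assms by (intro finite_measure_subalgebra_is_sigma_finite finite_measure_subalgebra.intro
      finite_measure_subalgebra_axioms.intro finite_measure_axioms)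

text \<open>The version \<open>v\<close> of the conditional expectation is left free, so that the
  rule serves both for v = 0 (martingale differences) and for an explicit formula for a conditional
  variance.\<close>

lemma (in prob_space) integral_mult_cond_exp:
  assumes F: "subalgebra M F" and f: "f \<in> borel_measurable F" and g: "g \<in> borel_measurable M"
    and fg: "integrable M (\<lambda>x. f x * g x)" and v: "AE x in M. real_cond_exp M F g x = v x"
    and vm: "v \<in> borel_measurable M"
  shows "(\<integral>x. f x * g x \<partial>M) = (\<integral>x. f x * v x \<partial>M)"
proof -
  interpret S: sigma_finite_subalgebra M F by (rule sigma_finite_subalgebraI[OF F])
  have [measurable]: "f \<in> borel_measurable M" by (rule measurable_from_subalg[OF F f])
  note [measurable] = vm
  have "(\<integral>x. f x * g x \<partial>M) = (\<integral>x. f x * real_cond_exp M F g x \<partial>M)"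
    by (rule S.real_cond_exp_intg(2)[OF fg f g, symmetric])
  also have "\<dots> = (\<integral>x. f x * v x \<partial>M)"
    using v by (intro integral_cong_AE) auto
  finally show ?thesis .
qed

lemma (in prob_space) integral_complex_mult_cond_exp:
  fixes U :: "'a \<Rightarrow> complex"
  assumes F: "subalgebra M F" and U: "U \<in> borel_measurable F" "\<And>x. norm (U x) \<le> 1"
    and g: "integrable M g" and v: "AE x in M. real_cond_exp M F g x = v x" and vi: "integrable M v"
  shows "(CLINT x|M. U x * of_real (g x)) = (CLINT x|M. U x * of_real (v x))"
proof -
  have UM[measurable]: "U \<in> borel_measurable M" by (rule measurable_from_subalg[OF F U(1)])
  have [measurable]: "g \<in> borel_measurable M" "v \<in> borel_measurable M" using g vi by auto
  have i: "integrable M (\<lambda>x. U x * of_real (h x))" if "integrable M h" for h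
  proof (rule Bochner_Integration.integrable_bound[OF that])
    show "AE x in M. norm (U x * of_real (h x)) \<le> norm (h x)"
      using U(2) by (auto simp: norm_mult intro!: mult_left_le_one_le)
    show "(\<lambda>x. U x * of_real (h x)) \<in> borel_measurable M"
      using borel_measurable_integrable[OF that] by measurable
  qed
  have ri: "integrable M (\<lambda>x. Re (U x) * g x)" "integrable M (\<lambda>x. Im (U x) * g x)"
    using integrable_Re[OF i[OF g]] integrable_Im[OF i[OF g]] by simp_all
  have "(\<lambda>x. Re (U x)) \<in> borel_measurable F" "(\<lambda>x. Im (U x)) \<in> borel_measurable F"
    using U(1) by measurable
  then have "(\<integral>x. Re (U x) * g x \<partial>M) = (\<integral>x. Re (U x) * v x \<partial>M)"
      "(\<integral>x. Im (U x) * g x \<partial>M) = (\<integral>x. Im (U x) * v x \<partial>M)"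
    using ri v by (auto intro!: integral_mult_cond_exp[OF F])
  then show ?thesis
    using integral_Re[OF i[OF g]] integral_Re[OF i[OF vi]] integral_Im[OF i[OF g]] integral_Im[OF i[OF vi]]
    by (auto intro!: complex_eqI)
qed

lemma exp_minus_quadratic_bound:
  fixes y :: real
  assumes "0 \<le> y"
  shows "\<bar>exp (- y) - (1 - y)\<bar> \<le> y\<^sup>2"
proof -
  have "exp (- y) \<le> 1 / (1 + y)"
    using assms exp_ge_add_one_self[of y] by (simp add: exp_minus field_simps)
  also have "\<dots> \<le> 1 - y + y\<^sup>2"
    using assms by (simp add: field_simps power2_eq_square)
  finally show ?thesis using exp_ge_add_one_self[of "- y"] by simp
qed

text \<open>Bounds the third-order Taylor remainder of the exponential by second and fourth moments,
  which are the ones at hand.\<close>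

lemma abs_cube_le: "\<bar>x :: real\<bar> ^ 3 \<le> x\<^sup>2 + x ^ 4"
proof (cases "\<bar>x\<bar> \<le> 1")
  case True
  then have "\<bar>x\<bar> ^ 3 \<le> \<bar>x\<bar> ^ 2" by (intro power_decreasing) auto
  then show ?thesis by (simp add: add_increasing2)
next
  case False
  then have "\<bar>x\<bar> ^ 3 \<le> \<bar>x\<bar> ^ 4" by (intro power_increasing) auto
  then show ?thesis by (simp add: add_increasing)
qed

lemma iexp_second_order:
  "norm (iexp y - (1 + \<i> * of_real y - of_real (y\<^sup>2 / 2))) \<le> \<bar>y\<bar> ^ 3 / 6"
proof -
  have "(\<Sum>k\<le>2. (\<i> * y) ^ k / fact k) = 1 + \<i> * of_real y - of_real (y\<^sup>2 / 2)"
    by (simp add: numeral_2_eq_2 power2_eq_square) (simp add: complex_eq_iff)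
  then show ?thesis using iexp_approx1[of y 2] by (simp add: fact_numeral numeral_3_eq_3)
qed

text \<open>Here \<open>U\<close> is the phase accumulated by the past and \<open>c\<close> the
  sample size. In the second-order expansion of \<open>iexp (X x / sqrt c)\<close>, conditioning on
  \<open>F\<close> removes the linear term and turns the square of X into \<open>v\<close>. The
  three error terms are the Taylor remainder, the replacement of \<open>v\<close> by the constant
  \<open>s2\<close>, and that of 1 - s2 / (2 c) by the exponential.\<close>

lemma (in prob_space) cfun_increment_bound:
  fixes U :: "'a \<Rightarrow> complex" and X v :: "'a \<Rightarrow> real"
  assumes F: "subalgebra M F" and U: "U \<in> borel_measurable F" "\<And>x. norm (U x) \<le> 1"
    and X: "X \<in> borel_measurable M" and X2: "integrable M (\<lambda>x. (X x)\<^sup>2)" and X4: "integrable M (\<lambda>x. X x ^ 4)"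
    and mds: "AE x in M. real_cond_exp M F X x = 0"
    and v: "AE x in M. real_cond_exp M F (\<lambda>x. (X x)\<^sup>2) x = v x" and vi: "integrable M v"
    and s2: "0 \<le> s2" and c: "0 < c"
  shows "norm ((CLINT x|M. U x * iexp (X x / sqrt c)) - of_real (exp (- (s2 / (2 * c)))) * (CLINT x|M. U x))
     \<le> ((\<integral>x. (X x)\<^sup>2 \<partial>M) + (\<integral>x. X x ^ 4 \<partial>M)) / (6 * (c * sqrt c)) + (\<integral>x. \<bar>v x - s2\<bar> \<partial>M) / (2 * c) + (s2 / (2 * c))\<^sup>2"
proof -
  note [measurable] = X
  have UM[measurable]: "U \<in> borel_measurable M" by (rule measurable_from_subalg[OF F U(1)])
  have [measurable]: "v \<in> borel_measurable M" using vi by auto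
  have X1: "integrable M X"
    by (rule square_integrable_imp_integrable[OF X X2])
  have iU: "integrable M (\<lambda>x. U x * of_real (h x))" if "integrable M h" for h
  proof (rule Bochner_Integration.integrable_bound[OF that])
    show "AE x in M. norm (U x * of_real (h x)) \<le> norm (h x)"
      using U(2) by (auto simp: norm_mult intro!: mult_left_le_one_le)
    show "(\<lambda>x. U x * of_real (h x)) \<in> borel_measurable M"
      using borel_measurable_integrable[OF that] by measurable
  qed
  have iU0: "integrable M U" using U(2) by (intro integrable_const_bound[where B=1]) auto
  have iE: "integrable M (\<lambda>x. U x * iexp (X x / sqrt c))"
    using U(2) by (intro integrable_const_bound[where B=1]) (auto simp: norm_mult)
  define r where "r x = iexp (X x / sqrt c) - (1 + \<i> * of_real (X x / sqrt c) - of_real ((X x / sqrt c)\<^sup>2 / 2))" for x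
  have [measurable]: "r \<in> borel_measurable M" unfolding r_def by measurable
  have r: "norm (r x) \<le> ((X x)\<^sup>2 + X x ^ 4) / (6 * (c * sqrt c))" for x
  proof -
    have "norm (r x) \<le> \<bar>X x / sqrt c\<bar> ^ 3 / 6"
      unfolding r_def by (rule iexp_second_order)
    also have "\<bar>X x / sqrt c\<bar> ^ 3 = \<bar>X x\<bar> ^ 3 / (c * sqrt c)"
      using c by (simp add: power_divide power3_eq_cube)
    also have "\<dots> / 6 \<le> (((X x)\<^sup>2 + X x ^ 4) / (c * sqrt c)) / 6"
      using c by (intro divide_right_mono abs_cube_le) auto
    finally show ?thesis by (simp add: field_simps)
  qed
  have ir: "integrable M (\<lambda>x. U x * r x)"
  proof (rule Bochner_Integration.integrable_bound)
    show "integrable M (\<lambda>x. ((X x)\<^sup>2 + X x ^ 4) / (6 * (c * sqrt c)))" using X2 X4 by auto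
    show "AE x in M. norm (U x * r x) \<le> norm (((X x)\<^sup>2 + X x ^ 4) / (6 * (c * sqrt c)))"
    proof (rule AE_I2)
      fix x
      have "norm (U x * r x) \<le> 1 * norm (r x)" unfolding norm_mult by (intro mult_right_mono U(2)) auto
      then show "norm (U x * r x) \<le> norm (((X x)\<^sup>2 + X x ^ 4) / (6 * (c * sqrt c)))"
        using r[of x] abs_ge_self[of "((X x)\<^sup>2 + X x ^ 4) / (6 * (c * sqrt c))"]
        unfolding real_norm_def by linarith
    qed
  qed measurable
  have m0: "(CLINT x|M. U x * of_real (X x)) = 0"
    using integral_complex_mult_cond_exp[OF F U X1 mds] by simp
  have m2: "(CLINT x|M. U x * of_real ((X x)\<^sup>2)) = (CLINT x|M. U x * of_real (v x))"
    by (rule integral_complex_mult_cond_exp[OF F U X2 v vi])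
  have "(CLINT x|M. U x * iexp (X x / sqrt c))
      = (CLINT x|M. U x * r x + U x + (\<i> / sqrt c) * (U x * of_real (X x)) - (1 / (2 * c)) * (U x * of_real ((X x)\<^sup>2)))"
    using c by (intro Bochner_Integration.integral_cong)
      (auto simp: r_def algebra_simps power_divide of_real_power[symmetric] simp del: of_real_power)
  also have "\<dots> = (CLINT x|M. U x * r x) + (CLINT x|M. U x) - (1 / (2 * c)) * (CLINT x|M. U x * of_real (v x))"
    using ir iU0 iU[OF X1] iU[OF X2] m0 m2 by simp
  also have "(CLINT x|M. U x * of_real (v x)) = (CLINT x|M. U x * of_real (v x - s2)) + s2 * (CLINT x|M. U x)"
  proof -
    have "(CLINT x|M. U x * of_real (v x - s2)) = (CLINT x|M. U x * of_real (v x) - s2 * U x)"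
      by (simp add: algebra_simps)
    also have "\<dots> = (CLINT x|M. U x * of_real (v x)) - s2 * (CLINT x|M. U x)"
      using iU[OF vi] iU0 by simp
    finally show ?thesis by simp
  qed
  finally have dec: "(CLINT x|M. U x * iexp (X x / sqrt c)) - of_real (exp (- (s2 / (2 * c)))) * (CLINT x|M. U x)
     = (CLINT x|M. U x * r x) - (1 / (2 * c)) * (CLINT x|M. U x * of_real (v x - s2))
       - of_real (exp (- (s2 / (2 * c))) - (1 - s2 / (2 * c))) * (CLINT x|M. U x)"
    by (simp add: algebra_simps)
  have b1: "norm (CLINT x|M. U x * r x) \<le> ((\<integral>x. (X x)\<^sup>2 \<partial>M) + (\<integral>x. X x ^ 4 \<partial>M)) / (6 * (c * sqrt c))"
  proof -
    have "norm (CLINT x|M. U x * r x) \<le> (\<integral>x. norm (U x * r x) \<partial>M)" by (rule integral_norm_bound)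
    also have "\<dots> \<le> (\<integral>x. ((X x)\<^sup>2 + X x ^ 4) / (6 * (c * sqrt c)) \<partial>M)"
    proof (rule integral_mono)
      fix x
      have "norm (U x * r x) \<le> 1 * norm (r x)" unfolding norm_mult by (intro mult_right_mono U(2)) auto
      then show "norm (U x * r x) \<le> ((X x)\<^sup>2 + X x ^ 4) / (6 * (c * sqrt c))" using r[of x] by auto
    qed (use ir X2 X4 in auto)
    also have "\<dots> = ((\<integral>x. (X x)\<^sup>2 \<partial>M) + (\<integral>x. X x ^ 4 \<partial>M)) / (6 * (c * sqrt c))"
      using X2 X4 by simp
    finally show ?thesis .
  qed
  have b2: "norm ((1 / (2 * c)) * (CLINT x|M. U x * of_real (v x - s2))) \<le> (\<integral>x. \<bar>v x - s2\<bar> \<partial>M) / (2 * c)"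
  proof -
    have "norm (CLINT x|M. U x * of_real (v x - s2)) \<le> (\<integral>x. norm (U x * of_real (v x - s2)) \<partial>M)"
      by (rule integral_norm_bound)
    also have "\<dots> \<le> (\<integral>x. \<bar>v x - s2\<bar> \<partial>M)"
    proof (rule integral_mono)
      fix x
      have "norm (U x * of_real (v x - s2)) \<le> 1 * norm (v x - s2)"
        unfolding norm_mult norm_of_real real_norm_def by (intro mult_right_mono U(2)) auto
      then show "norm (U x * of_real (v x - s2)) \<le> \<bar>v x - s2\<bar>" by simp
    next
      show "integrable M (\<lambda>x. norm (U x * of_real (v x - s2)))"
        using iU[of "\<lambda>x. v x - s2"] vi by (intro integrable_norm) auto
    qed (use vi in auto)
    finally show ?thesis using c by (simp add: norm_mult norm_divide divide_right_mono)
  qed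
  have b3: "norm (of_real (exp (- (s2 / (2 * c))) - (1 - s2 / (2 * c))) * (CLINT x|M. U x)) \<le> (s2 / (2 * c))\<^sup>2"
  proof -
    have "norm (CLINT x|M. U x) \<le> (\<integral>x. norm (U x) \<partial>M)" by (rule integral_norm_bound)
    also have "\<dots> \<le> (\<integral>x. 1 \<partial>M)" using iU0 U(2) by (intro integral_mono) auto
    finally have "norm (CLINT x|M. U x) \<le> 1" by (simp add: prob_space)
    then have "\<bar>exp (- (s2 / (2 * c))) - (1 - s2 / (2 * c))\<bar> * norm (CLINT x|M. U x) \<le> (s2 / (2 * c))\<^sup>2 * 1"
      using s2 c by (intro mult_mono exp_minus_quadratic_bound) auto
    then show ?thesis unfolding norm_mult norm_of_real by simp
  qed
  show ?thesis unfolding dec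
    using b1 b2 b3 by (intro order_trans[OF norm_triangle_ineq4] add_mono) auto
qed

text \<open>With the normalisation sqrt n fixed, \<phi> n k is compared with the k-th power of
  \<open>q n\<close>. Errors only add up along k because \<open>q n\<close> is at most 1. After n
  steps they total O(1 / sqrt n), half a Cesaro mean of the mean deviations of \<open>v\<close> from
  \<open>s2\<close>, and O(1 / n), while the n-th power of \<open>q n\<close> is exactly the
  Gaussian value.\<close>

theorem martingale_clt:
  fixes M :: "'a measure" and F :: "nat \<Rightarrow> 'a measure" and X v :: "nat \<Rightarrow> 'a \<Rightarrow> real"
  assumes "prob_space M"
    and F: "\<And>n. subalgebra M (F n)" "\<And>n. sets (F n) \<subseteq> sets (F (Suc n))"
    and X: "\<And>n. n \<ge> 1 \<Longrightarrow> X n \<in> borel_measurable (F n)"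
    and X2: "\<And>n. n \<ge> 1 \<Longrightarrow> integrable M (\<lambda>x. (X n x)\<^sup>2)" "\<And>n. n \<ge> 1 \<Longrightarrow> (\<integral>x. (X n x)\<^sup>2 \<partial>M) \<le> K"
    and X4: "\<And>n. n \<ge> 1 \<Longrightarrow> integrable M (\<lambda>x. X n x ^ 4)" "\<And>n. n \<ge> 1 \<Longrightarrow> (\<integral>x. X n x ^ 4 \<partial>M) \<le> K"
    and mds: "\<And>n. n \<ge> 1 \<Longrightarrow> AE x in M. real_cond_exp M (F (n - 1)) (X n) x = 0"
    and v: "\<And>n. n \<ge> 1 \<Longrightarrow> AE x in M. real_cond_exp M (F (n - 1)) (\<lambda>x. (X n x)\<^sup>2) x = v n x"
    and vi: "\<And>n. n \<ge> 1 \<Longrightarrow> integrable M (v n)"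
    and v_lim: "(\<lambda>n. \<integral>x. \<bar>v n x - s2\<bar> \<partial>M) \<longlonglongrightarrow> 0" and s2: "0 \<le> s2"
  shows "(\<lambda>n. CLINT x|M. iexp ((\<Sum>i=1..n. X i x) / sqrt (real n))) \<longlonglongrightarrow> of_real (exp (- s2 / 2))"
proof -
  interpret prob_space M by fact
  have Fmono: "sets (F m) \<subseteq> sets (F n)" if "m \<le> n" for m n
    using that F(2) by (induction rule: dec_induct) auto
  have Fspace: "space (F n) = space M" for n using F(1)[of n] by (simp add: subalgebra_def)
  have XF: "X i \<in> borel_measurable (F n)" if "i \<ge> 1" "i \<le> n" for i n
    using X[OF that(1)] Fmono[OF that(2)] Fspace by (auto simp: measurable_def)
  have XM: "X i \<in> borel_measurable M" if "i \<ge> 1" for i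
    by (rule measurable_from_subalg[OF F(1) X[OF that]])
  define \<phi> where "\<phi> n k = (CLINT x|M. iexp ((\<Sum>i=1..k. X i x) / sqrt (real n)))" for n k
  define \<delta> where "\<delta> n k = 2 * K / (6 * (real n * sqrt (real n))) + (\<integral>x. \<bar>v k x - s2\<bar> \<partial>M) / (2 * real n)
     + (s2 / (2 * real n))\<^sup>2" for n k
  define q where "q n = exp (- (s2 / (2 * real n)))" for n
  have step: "norm (\<phi> n (Suc k) - q n * \<phi> n k) \<le> \<delta> n (Suc k)" if n: "n \<ge> 1" for n k
  proof -
    define U where "U x = iexp ((\<Sum>i=1..k. X i x) / sqrt (real n))" for x
    have "(\<lambda>x. \<Sum>i=1..k. X i x) \<in> borel_measurable (F k)"
      by (intro borel_measurable_sum XF) auto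
    then have UF: "U \<in> borel_measurable (F k)" unfolding U_def by measurable
    have "norm (\<phi> n (Suc k) - q n * \<phi> n k)
      = norm ((CLINT x|M. U x * iexp (X (Suc k) x / sqrt (real n))) - of_real (exp (- (s2 / (2 * real n)))) * (CLINT x|M. U x))"
      unfolding \<phi>_def q_def U_def by (simp add: exp_add[symmetric] add_divide_distrib algebra_simps)
    also have "\<dots> \<le> ((\<integral>x. (X (Suc k) x)\<^sup>2 \<partial>M) + (\<integral>x. X (Suc k) x ^ 4 \<partial>M)) / (6 * (real n * sqrt (real n)))
        + (\<integral>x. \<bar>v (Suc k) x - s2\<bar> \<partial>M) / (2 * real n) + (s2 / (2 * real n))\<^sup>2"
      using mds[of "Suc k"] v[of "Suc k"] n s2
      by (intro cfun_increment_bound[OF F(1)[of k] UF]) (auto simp: U_def XM X2 X4 vi)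
    also have "\<dots> \<le> \<delta> n (Suc k)"
      unfolding \<delta>_def using X2(2)[of "Suc k"] X4(2)[of "Suc k"]
      by (intro add_right_mono divide_right_mono) auto
    finally show ?thesis .
  qed
  have tele: "norm (\<phi> n k - q n ^ k) \<le> (\<Sum>j=1..k. \<delta> n j)" if n: "n \<ge> 1" for n k
  proof (induction k)
    case 0 then show ?case by (simp add: \<phi>_def prob_space)
  next
    case (Suc k)
    have "\<phi> n (Suc k) - q n ^ Suc k = (\<phi> n (Suc k) - q n * \<phi> n k) + q n * (\<phi> n k - q n ^ k)"
      by (simp add: algebra_simps)
    also have "norm \<dots> \<le> \<delta> n (Suc k) + 1 * (\<Sum>j=1..k. \<delta> n j)"
    proof (rule order_trans[OF norm_triangle_ineq], intro add_mono step[OF n])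
      have "norm (complex_of_real (q n)) \<le> 1" using s2 by (simp add: q_def)
      then show "norm (q n * (\<phi> n k - q n ^ k)) \<le> 1 * (\<Sum>j=1..k. \<delta> n j)"
        unfolding norm_mult using Suc by (intro mult_mono) auto
    qed
    finally show ?case by simp
  qed
  have qn: "q n ^ n = exp (- s2 / 2)" if "n \<ge> 1" for n
    using that by (simp add: q_def exp_of_nat_mult[symmetric])
  have sum\<delta>: "(\<Sum>j=1..n. \<delta> n j) = 2 * K / 6 / sqrt (real n) + (\<Sum>j<n. \<integral>x. \<bar>v (Suc j) x - s2\<bar> \<partial>M) / real n / 2
      + (s2 / 2)\<^sup>2 / real n" if "n \<ge> 1" for n
  proof -
    have "(\<Sum>j=1..n. \<delta> n j) = real n * (2 * K / (6 * (real n * sqrt (real n))))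
        + (\<Sum>j<n. \<integral>x. \<bar>v (Suc j) x - s2\<bar> \<partial>M) / (2 * real n) + real n * (s2 / (2 * real n))\<^sup>2"
      unfolding \<delta>_def by (simp add: sum.distrib sum.atLeast1_atMost_eq sum_divide_distrib)
    then show ?thesis using that by (simp add: field_simps power2_eq_square)
  qed
  have "(\<lambda>n. 2 * K / 6 / sqrt (real n) + (\<Sum>j<n. \<integral>x. \<bar>v (Suc j) x - s2\<bar> \<partial>M) / real n / 2 + (s2 / 2)\<^sup>2 / real n) \<longlonglongrightarrow> 0 + 0 / 2 + 0"
  proof (intro tendsto_add tendsto_divide cesaro_null tendsto_const)
    show "(\<lambda>n. 2 * K / 6 / sqrt (real n)) \<longlonglongrightarrow> 0" by real_asymp
    show "(\<lambda>n. (s2 / 2)\<^sup>2 / real n) \<longlonglongrightarrow> 0" by (rule lim_const_over_n)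
    show "(\<lambda>n. \<integral>x. \<bar>v (Suc n) x - s2\<bar> \<partial>M) \<longlonglongrightarrow> 0" using v_lim by (rule LIMSEQ_Suc)
  qed auto
  then have lim: "(\<lambda>n. 2 * K / 6 / sqrt (real n) + (\<Sum>j<n. \<integral>x. \<bar>v (Suc j) x - s2\<bar> \<partial>M) / real n / 2 + (s2 / 2)\<^sup>2 / real n) \<longlonglongrightarrow> 0"
    by simp
  have "(\<lambda>n. \<phi> n n - exp (- s2 / 2)) \<longlonglongrightarrow> 0"
  proof (rule Lim_null_comparison[OF _ lim])
    show "\<forall>\<^sub>F n in sequentially. norm (\<phi> n n - exp (- s2 / 2)) \<le>
        2 * K / 6 / sqrt (real n) + (\<Sum>j<n. \<integral>x. \<bar>v (Suc j) x - s2\<bar> \<partial>M) / real n / 2 + (s2 / 2)\<^sup>2 / real n"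
      using tele qn sum\<delta> by (intro eventually_sequentiallyI[of 1]) (metis of_real_power)
  qed
  then show ?thesis unfolding \<phi>_def by (rule Lim_null[THEN iffD2])
qed

subsection \<open>Step sizes and contraction\<close>

lemma sym_pos_def_coercive:
  fixes A :: "real^'d^'d"
  assumes "sym_pos_def A"
  obtains l where "l > 0" "\<And>x. l * (norm x)\<^sup>2 \<le> x \<bullet> (A *v x)"
proof -
  have "continuous_on (sphere 0 1) (\<lambda>x. x \<bullet> (A *v x))"
    by (intro continuous_intros linear_continuous_on matrix_vector_mul_bounded_linear)
  moreover have "sphere (0::real^'d) 1 \<noteq> {}" by simp
  ultimately obtain u where u: "u \<in> sphere 0 1" "\<And>x. x \<in> sphere 0 1 \<Longrightarrow> u \<bullet> (A *v u) \<le> x \<bullet> (A *v x)"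
    using continuous_attains_inf[OF compact_sphere] by blast
  define l where "l = u \<bullet> (A *v u)"
  have "u \<noteq> 0" using u(1) by auto
  then have "l > 0" using assms by (simp add: l_def sym_pos_def_def)
  moreover have "l * (norm x)\<^sup>2 \<le> x \<bullet> (A *v x)" for x
  proof (cases "x = 0")
    case False
    define y where "y = (1 / norm x) *\<^sub>R x"
    have "y \<in> sphere 0 1" using False by (simp add: y_def)
    then have "l \<le> y \<bullet> (A *v y)" unfolding l_def by (rule u(2))
    moreover have x: "x = norm x *\<^sub>R y" using False by (simp add: y_def)
    have "x \<bullet> (A *v x) = (norm x)\<^sup>2 * (y \<bullet> (A *v y))"
      by (subst x, subst (2) x) (simp add: matrix_vector_mult_scaleR power2_eq_square)
    ultimately show ?thesis by (simp add: mult.commute mult_right_mono)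
  qed simp
  ultimately show thesis by (rule that)
qed

text \<open>Expanding the square with coercivity \<open>l\<close> and operator bound
  \<open>L\<close> gives the factor 1 - 2 g l + (g L)^2. For g <= l / L^2 this is at most 1 - g l <=
  (1 - g l / 2)^2, whence a = l / 2; g <= 1 / l keeps 1 - a g nonnegative.\<close>

lemma sym_pos_def_contraction:
  fixes A :: "real^'d^'d"
  assumes "sym_pos_def A"
  obtains a g0 where "a > 0" "g0 > 0"
    "\<And>g x. 0 \<le> g \<Longrightarrow> g \<le> g0 \<Longrightarrow> a * g \<le> 1 \<and> norm (x - g *\<^sub>R (A *v x)) \<le> (1 - a * g) * norm x"
proof -
  obtain l where l: "l > 0" "\<And>x. l * (norm x)\<^sup>2 \<le> x \<bullet> (A *v x)"
    using sym_pos_def_coercive[OF assms] by blast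
  obtain L where L: "L > 0" "\<And>x. norm (A *v x) \<le> norm x * L"
    using bounded_linear.pos_bounded[OF matrix_vector_mul_bounded_linear[of A]] by blast
  define g0 where "g0 = min (l / L\<^sup>2) (1 / l)"
  have "a * g \<le> 1 \<and> norm (x - g *\<^sub>R (A *v x)) \<le> (1 - a * g) * norm x"
    if g: "0 \<le> g" "g \<le> g0" and a: "a = l / 2" for a g x
  proof -
    have g1: "g * L\<^sup>2 \<le> l" using g L(1) by (simp add: g0_def field_simps)
    have g2: "l * g \<le> 1" using g l(1) by (simp add: g0_def field_simps)
    have ag: "0 \<le> a * g" "a * g \<le> 1" using g2 g l(1) by (auto simp: a)
    have "(norm (A *v x))\<^sup>2 \<le> (norm x * L)\<^sup>2" using L(2)[of x] by (intro power_mono) auto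
    then have "g\<^sup>2 * (norm (A *v x))\<^sup>2 \<le> g\<^sup>2 * (norm x * L)\<^sup>2" by (intro mult_left_mono) auto
    also have "\<dots> = (g * (norm x)\<^sup>2) * (g * L\<^sup>2)" by (simp add: power2_eq_square)
    also have "\<dots> \<le> (g * (norm x)\<^sup>2) * l" using g g1 by (intro mult_left_mono) auto
    finally have 1: "g\<^sup>2 * (norm (A *v x))\<^sup>2 \<le> g * l * (norm x)\<^sup>2" by (simp add: algebra_simps)
    have 2: "g * (l * (norm x)\<^sup>2) \<le> g * (x \<bullet> (A *v x))" using l(2)[of x] g by (intro mult_left_mono) auto
    have "(norm (x - g *\<^sub>R (A *v x)))\<^sup>2 = (norm x)\<^sup>2 - 2 * (g * (x \<bullet> (A *v x))) + g\<^sup>2 * (norm (A *v x))\<^sup>2"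
      unfolding power2_norm_eq_inner
      by (simp add: inner_diff_left inner_diff_right inner_commute power2_eq_square)
    also have "\<dots> \<le> (norm x)\<^sup>2 - g * l * (norm x)\<^sup>2" using 1 2 by (simp add: algebra_simps)
    also have "\<dots> \<le> ((1 - a * g) * norm x)\<^sup>2"
    proof -
      have "0 \<le> (a * g)\<^sup>2 * (norm x)\<^sup>2" by simp
      then show ?thesis by (simp add: power2_eq_square a algebra_simps)
    qed
    finally have "norm (x - g *\<^sub>R (A *v x)) \<le> (1 - a * g) * norm x"
      by (rule power2_le_imp_le) (use ag in auto)
    with ag show ?thesis by simp
  qed
  moreover have "g0 > 0" "l / 2 > 0" using l(1) L(1) by (auto simp: g0_def)
  ultimately show thesis using that by blast
qed

locale step_sizes =
  fixes \<gamma> :: "nat \<Rightarrow> real"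
  assumes pos: "\<And>n. n \<ge> 1 \<Longrightarrow> \<gamma> n > 0"
    and lim: "\<gamma> \<longlonglongrightarrow> 0"
    and ratio: "(\<lambda>n. (\<gamma> n - \<gamma> (n - 1)) / \<gamma> n) \<in> o(\<gamma>)"
begin

lemma ratio_lim: "(\<lambda>n. ((\<gamma> (Suc n) - \<gamma> n) / \<gamma> (Suc n)) / \<gamma> (Suc n)) \<longlonglongrightarrow> 0"
proof -
  have "(\<lambda>n. ((\<gamma> n - \<gamma> (n - 1)) / \<gamma> n) / \<gamma> n) \<longlonglongrightarrow> 0"
    by (rule smalloD_tendsto[OF ratio])
  from LIMSEQ_Suc[OF this] show ?thesis by simp
qed

lemma quotient_lim: "(\<lambda>n. \<gamma> n / \<gamma> (Suc n)) \<longlonglongrightarrow> 1"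
proof -
  have "(\<lambda>n. 1 - ((\<gamma> (Suc n) - \<gamma> n) / \<gamma> (Suc n)) / \<gamma> (Suc n) * \<gamma> (Suc n)) \<longlonglongrightarrow> 1 - 0 * 0"
    by (intro tendsto_intros ratio_lim LIMSEQ_Suc lim)
  moreover have "1 - ((\<gamma> (Suc n) - \<gamma> n) / \<gamma> (Suc n)) / \<gamma> (Suc n) * \<gamma> (Suc n) = \<gamma> n / \<gamma> (Suc n)" for n
    using pos[of "Suc n"] by (simp add: field_simps)
  ultimately show ?thesis by simp
qed

text \<open>The weights that summation by parts leaves on \<open>Y\<close>. The value \<delta> 0
  involves \<gamma> 0, which is unconstrained; in \<open>V\<close> it multiplies \<open>Y 0\<close>,
  which is zero.\<close>

definition "\<delta> n = 1 / \<gamma> (Suc n) - 1 / \<gamma> n"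

lemma \<delta>_lim: "\<delta> \<longlonglongrightarrow> 0"
proof -
  have "(\<lambda>n. - (((\<gamma> (Suc n) - \<gamma> n) / \<gamma> (Suc n)) / \<gamma> (Suc n)) / (\<gamma> n / \<gamma> (Suc n))) \<longlonglongrightarrow> - 0 / 1"
    by (intro tendsto_intros ratio_lim quotient_lim) simp
  moreover have "\<forall>\<^sub>F n in sequentially.
      - (((\<gamma> (Suc n) - \<gamma> n) / \<gamma> (Suc n)) / \<gamma> (Suc n)) / (\<gamma> n / \<gamma> (Suc n)) = \<delta> n"
  proof (rule eventually_sequentiallyI[of 1])
    fix n :: nat assume "n \<ge> 1"
    then have "\<gamma> n > 0" "\<gamma> (Suc n) > 0" by (auto intro: pos)
    then show "- (((\<gamma> (Suc n) - \<gamma> n) / \<gamma> (Suc n)) / \<gamma> (Suc n)) / (\<gamma> n / \<gamma> (Suc n)) = \<delta> n"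
      by (simp add: \<delta>_def field_simps)
  qed
  ultimately show ?thesis by (simp add: filterlim_cong)
qed

text \<open>Equivalently, n times \<gamma> n tends to infinity: the increments of 1/\<gamma> are
  \<delta>, a null sequence. The absolute value in the proof guards against the free sign of
  \<gamma> 0.\<close>

lemma inverse_sublinear: "(\<lambda>n. 1 / \<gamma> n / real n) \<longlonglongrightarrow> 0"
proof -
  have "(\<lambda>n. \<bar>1 / \<gamma> n\<bar> / real n) \<longlonglongrightarrow> 0"
  proof (rule increments_null_imp_sublinear[OF _ _ \<delta>_lim])
    show "\<forall>\<^sub>F n in sequentially. \<bar>1 / \<gamma> (Suc n)\<bar> \<le> \<bar>1 / \<gamma> n\<bar> + \<delta> n"
    proof (rule eventually_sequentiallyI[of 1])
      fix n :: nat assume "n \<ge> 1"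
      then have "\<gamma> n > 0" "\<gamma> (Suc n) > 0" by (auto intro: pos)
      then show "\<bar>1 / \<gamma> (Suc n)\<bar> \<le> \<bar>1 / \<gamma> n\<bar> + \<delta> n" by (simp add: \<delta>_def)
    qed
  qed simp
  then show ?thesis by (rule Lim_null_comparison[rotated]) (simp add: abs_mult)
qed

lemma eventually_quotient:
  assumes "a > 0"
  shows "\<forall>\<^sub>F n in sequentially. \<gamma> n / \<gamma> (Suc n) \<le> 1 + a * \<gamma> (Suc n) \<and> 1/2 \<le> \<gamma> n / \<gamma> (Suc n) \<and> \<gamma> n / \<gamma> (Suc n) \<le> 2"
proof -
  have "\<forall>\<^sub>F n in sequentially. ((\<gamma> (Suc n) - \<gamma> n) / \<gamma> (Suc n)) / \<gamma> (Suc n) > - a"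
    using order_tendstoD(1)[OF ratio_lim, of "- a"] assms by simp
  moreover have "\<forall>\<^sub>F n in sequentially. \<gamma> n / \<gamma> (Suc n) > 1/2"
    using order_tendstoD(1)[OF quotient_lim, of "1/2"] by simp
  moreover have "\<forall>\<^sub>F n in sequentially. \<gamma> n / \<gamma> (Suc n) < 2"
    using order_tendstoD(2)[OF quotient_lim, of 2] by simp
  ultimately show ?thesis
  proof eventually_elim
    case (elim n)
    have g: "\<gamma> (Suc n) > 0" by (rule pos) simp
    then have "- a * \<gamma> (Suc n) \<le> (\<gamma> (Suc n) - \<gamma> n) / \<gamma> (Suc n)"
      using elim(1) by (simp add: field_simps)
    also have "\<dots> = 1 - \<gamma> n / \<gamma> (Suc n)" using g by (simp add: field_simps)
    finally show ?case using elim by simp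
  qed
qed

text \<open>Passing from u to u / \<gamma> costs half of the damping rate, because \<gamma> n /
  \<gamma> (n+1) is eventually at most 1 + (a/2) \<gamma> (n+1). The quantification over real u and
  w lets the rule serve both pathwise norms and second moments.\<close>

lemma eventually_rescaled_damping:
  assumes a: "a > 0"
  shows "\<forall>\<^sub>F n in sequentially. \<forall>u w::real. 0 \<le> u \<longrightarrow> w \<le> (1 - a * \<gamma> (Suc n)) * u \<longrightarrow>
     w / \<gamma> (Suc n) \<le> (1 - a / 2 * \<gamma> (Suc n)) * (u / \<gamma> n)"
proof -
  have "a / 2 > 0" using a by simp
  from eventually_quotient[OF this] eventually_ge_at_top[of 1] show ?thesis
  proof eventually_elim
    case (elim n)
    have g: "\<gamma> (Suc n) > 0" "\<gamma> n > 0" using elim by (auto intro: pos)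
    have q: "0 \<le> \<gamma> n / \<gamma> (Suc n)" using g by simp
    show ?case
    proof (intro allI impI)
      fix u w :: real assume u: "0 \<le> u" and w: "w \<le> (1 - a * \<gamma> (Suc n)) * u"
      have "w / \<gamma> (Suc n) \<le> (1 - a * \<gamma> (Suc n)) * u / \<gamma> (Suc n)"
        using w g by (intro divide_right_mono) auto
      also have "\<dots> = (\<gamma> n / \<gamma> (Suc n) * (1 - a * \<gamma> (Suc n))) * (u / \<gamma> n)" using g by simp
      also have "\<dots> \<le> (1 - a / 2 * \<gamma> (Suc n)) * (u / \<gamma> n)"
      proof (rule mult_right_mono)
        show "\<gamma> n / \<gamma> (Suc n) * (1 - a * \<gamma> (Suc n)) \<le> 1 - a / 2 * \<gamma> (Suc n)"
        proof (cases "a * \<gamma> (Suc n) \<le> 1")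
          case True
          then have "\<gamma> n / \<gamma> (Suc n) * (1 - a * \<gamma> (Suc n)) \<le> (1 + a / 2 * \<gamma> (Suc n)) * (1 - a * \<gamma> (Suc n))"
            using elim by (intro mult_right_mono) auto
          also have "\<dots> \<le> 1 - a / 2 * \<gamma> (Suc n)" using a g by (simp add: algebra_simps)
          finally show ?thesis .
        next
          case False
          \<comment> \<open>Here 1 - a \<gamma> (n+1) is negative, so the lower bound 1/2 on the
            quotient is the relevant one.\<close>
          have "\<gamma> n / \<gamma> (Suc n) * (1 - a * \<gamma> (Suc n)) \<le> (1/2) * (1 - a * \<gamma> (Suc n))"
            using elim False by (intro mult_right_mono_neg) auto
          also have "\<dots> \<le> 1 - a / 2 * \<gamma> (Suc n)" by (simp add: algebra_simps)
          finally show ?thesis .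
        qed
        show "0 \<le> u / \<gamma> n" using u g by simp
      qed
      finally show "w / \<gamma> (Suc n) \<le> (1 - a / 2 * \<gamma> (Suc n)) * (u / \<gamma> n)" .
    qed
  qed
qed

lemma eventually_contraction:
  fixes A :: "real^'d^'d"
  assumes "sym_pos_def A"
  obtains a where "a > 0" "\<forall>\<^sub>F n in sequentially. a * \<gamma> (Suc n) \<le> 1 \<and>
     (\<forall>x. norm (x - \<gamma> (Suc n) *\<^sub>R (A *v x)) \<le> (1 - a * \<gamma> (Suc n)) * norm x)"
proof -
  obtain a g0 where a: "a > 0" "g0 > 0"
    "\<And>g x. 0 \<le> g \<Longrightarrow> g \<le> g0 \<Longrightarrow> a * g \<le> 1 \<and> norm (x - g *\<^sub>R (A *v x)) \<le> (1 - a * g) * norm x"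
    using sym_pos_def_contraction[OF assms] by blast
  have "\<forall>\<^sub>F n in sequentially. \<gamma> (Suc n) < g0"
    using order_tendstoD(2)[OF LIMSEQ_Suc[OF lim], of g0] a by simp
  then have "\<forall>\<^sub>F n in sequentially. a * \<gamma> (Suc n) \<le> 1 \<and>
     (\<forall>x. norm (x - \<gamma> (Suc n) *\<^sub>R (A *v x)) \<le> (1 - a * \<gamma> (Suc n)) * norm x)"
  proof eventually_elim
    case (elim n)
    then show ?case using a(3)[of "\<gamma> (Suc n)"] pos[of "Suc n"] by auto
  qed
  with a(1) show thesis by (rule that)
qed

text \<open>\<open>C\<close> and \<open>n0\<close> are fixed before \<open>D\<close> and
  \<open>e\<close>, so one pair serves all sample paths. The quantity norm (D n) / \<gamma> n gains
  at most norm (e (n+1)) in a step, and damping takes away at least (a/4) norm (D n), as \<gamma> n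
  <= 2 \<gamma> (n+1); summing the losses gives the bound. \<open>N\<close> lets \<open>n0\<close>
  be chosen beyond the index where \<open>e\<close> becomes integrable.\<close>

lemma perturbed_linear_recursion:
  fixes A :: "real^'d^'d"
  assumes "sym_pos_def A"
  obtains C n0 where "C \<ge> 0" "n0 \<ge> N" "n0 \<ge> 1"
    "\<And>D e n. (\<And>n. D (Suc n) = D n - \<gamma> (Suc n) *\<^sub>R (A *v D n) + \<gamma> (Suc n) *\<^sub>R e (Suc n)) \<Longrightarrow> n \<ge> n0 \<Longrightarrow>
       (\<Sum>i=n0..n. norm (D i)) \<le> C * (norm (D n0) / \<gamma> n0 + (\<Sum>i=Suc n0..n. norm (e i)))"
proof -
  obtain a where a: "a > 0" and contr: "\<forall>\<^sub>F n in sequentially. a * \<gamma> (Suc n) \<le> 1 \<and>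
     (\<forall>x. norm (x - \<gamma> (Suc n) *\<^sub>R (A *v x)) \<le> (1 - a * \<gamma> (Suc n)) * norm x)"
    using eventually_contraction[OF assms] by blast
  have small: "\<forall>\<^sub>F n in sequentially. \<gamma> n < 4 / a"
    using order_tendstoD(2)[OF lim, of "4 / a"] a by simp
  obtain n1 where n1: "\<And>n. n \<ge> n1 \<Longrightarrow> a * \<gamma> (Suc n) \<le> 1 \<and>
     (\<forall>x. norm (x - \<gamma> (Suc n) *\<^sub>R (A *v x)) \<le> (1 - a * \<gamma> (Suc n)) * norm x)"
    "\<And>n. n \<ge> n1 \<Longrightarrow> \<forall>u w::real. 0 \<le> u \<longrightarrow> w \<le> (1 - a * \<gamma> (Suc n)) * u \<longrightarrow>
     w / \<gamma> (Suc n) \<le> (1 - a / 2 * \<gamma> (Suc n)) * (u / \<gamma> n)"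
    "\<And>n. n \<ge> n1 \<Longrightarrow> \<gamma> n / \<gamma> (Suc n) \<le> 2" "\<And>n. n \<ge> n1 \<Longrightarrow> \<gamma> n < 4 / a"
    using eventually_conj[OF contr eventually_conj[OF eventually_rescaled_damping[OF a] eventually_conj[OF eventually_quotient[OF a] small]]]
    unfolding eventually_sequentially by blast
  define n0 where "n0 = max n1 (max N 1)"
  have "(\<Sum>i=n0..n. norm (D i)) \<le> 4 / a * (norm (D n0) / \<gamma> n0 + (\<Sum>i=Suc n0..n. norm (e i)))"
    if rec: "\<And>n. D (Suc n) = D n - \<gamma> (Suc n) *\<^sub>R (A *v D n) + \<gamma> (Suc n) *\<^sub>R e (Suc n)" and n: "n \<ge> n0"
    for D e :: "nat \<Rightarrow> real^'d" and n
  proof -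
    have pot: "norm (D n) / \<gamma> n + a / 4 * (\<Sum>i=n0..<n. norm (D i)) \<le> norm (D n0) / \<gamma> n0 + (\<Sum>i=Suc n0..n. norm (e i))"
      if "n \<ge> n0" for n
      using that
    proof (induction n rule: dec_induct)
      case base then show ?case by simp
    next
      case (step n)
      then have n1': "n \<ge> n1" "n \<ge> 1" by (auto simp: n0_def)
      have g: "\<gamma> (Suc n) > 0" "\<gamma> n > 0" using n1' by (auto intro: pos)
      define w where "w = norm (D n - \<gamma> (Suc n) *\<^sub>R (A *v D n))"
      have "norm (D (Suc n)) \<le> w + \<gamma> (Suc n) * norm (e (Suc n))"
        unfolding rec[of n] w_def using g by (intro order_trans[OF norm_triangle_ineq]) auto
      then have "norm (D (Suc n)) / \<gamma> (Suc n) \<le> w / \<gamma> (Suc n) + norm (e (Suc n))"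
        using g by (simp add: field_simps)
      also have "w / \<gamma> (Suc n) \<le> (1 - a / 2 * \<gamma> (Suc n)) * (norm (D n) / \<gamma> n)"
        using n1(1)[OF n1'(1)] n1(2)[OF n1'(1)] unfolding w_def by simp
      also have "\<dots> \<le> norm (D n) / \<gamma> n - a / 4 * norm (D n)"
      proof -
        have "1 \<le> 2 * \<gamma> (Suc n) / \<gamma> n" using n1(3)[OF n1'(1)] g by (simp add: field_simps)
        then have "a / 4 * norm (D n) * 1 \<le> a / 4 * norm (D n) * (2 * \<gamma> (Suc n) / \<gamma> n)"
          using a by (intro mult_left_mono) auto
        then show ?thesis by (simp add: algebra_simps)
      qed
      finally show ?case using step by (simp add: algebra_simps)
    qed
    \<comment> \<open>The potential bounds the sum up to n - 1 only; since \<gamma> n < 4 / a, its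
      term norm (D n) / \<gamma> n also absorbs the last summand.\<close>
    have g: "\<gamma> n > 0" "\<gamma> n < 4 / a" using n n1(4)[of n] by (auto simp: n0_def intro: pos)
    then have "a / 4 * norm (D n) \<le> norm (D n) / \<gamma> n"
    proof -
      have "a / 4 \<le> 1 / \<gamma> n" using g a by (simp add: field_simps)
      from mult_right_mono[OF this, of "norm (D n)"] show ?thesis by simp
    qed
    moreover have "(\<Sum>i=n0..n. norm (D i)) = (\<Sum>i=n0..<n. norm (D i)) + norm (D n)"
      using n by (simp add: sum.last_plus add.commute)
    ultimately have "a / 4 * (\<Sum>i=n0..n. norm (D i)) \<le> norm (D n0) / \<gamma> n0 + (\<Sum>i=Suc n0..n. norm (e i))"
      using pot[OF n] by (simp only: distrib_left)
    then show ?thesis using a by (simp add: field_simps)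
  qed
  moreover have "4 / a \<ge> 0" "n0 \<ge> N" "n0 \<ge> 1" using a by (auto simp: n0_def)
  ultimately show thesis using that by blast
qed

end

subsection \<open>Second moments of the averaged recursion\<close>

text \<open>Measurability is a separate conjunct because integrability of the squared norm says
  nothing about the direction of \<open>X\<close>.\<close>

definition sq_int :: "'a measure \<Rightarrow> ('a \<Rightarrow> real^'d) \<Rightarrow> bool" where
  "sq_int M X \<longleftrightarrow> X \<in> borel_measurable M \<and> integrable M (\<lambda>x. (norm (X x))\<^sup>2)"

lemma sq_int_measurable: "sq_int M X \<Longrightarrow> X \<in> borel_measurable M"
  by (simp add: sq_int_def)

lemma sq_int_integrable: "sq_int M X \<Longrightarrow> integrable M (\<lambda>x. (norm (X x))\<^sup>2)"
  by (simp add: sq_int_def)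

lemma sq_int_norm_mult:
  assumes "sq_int M X" "sq_int M Y"
  shows "integrable M (\<lambda>x. norm (X x) * norm (Y x))"
proof (rule Bochner_Integration.integrable_bound)
  note [measurable] = assms[THEN sq_int_measurable]
  show "integrable M (\<lambda>x. (norm (X x))\<^sup>2 + (norm (Y x))\<^sup>2)"
    using assms by (auto simp: sq_int_def)
  show "(\<lambda>x. norm (X x) * norm (Y x)) \<in> borel_measurable M" by measurable
  show "AE x in M. norm (norm (X x) * norm (Y x)) \<le> norm ((norm (X x))\<^sup>2 + (norm (Y x))\<^sup>2)"
  proof (rule AE_I2)
    fix x
    have "2 * (norm (X x) * norm (Y x)) \<le> (norm (X x))\<^sup>2 + (norm (Y x))\<^sup>2"
      using sum_squares_bound[of "norm (X x)" "norm (Y x)"] by simp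
    then show "norm (norm (X x) * norm (Y x)) \<le> norm ((norm (X x))\<^sup>2 + (norm (Y x))\<^sup>2)"
      by (simp add: mult_nonneg_nonneg[of "norm (X x)" "norm (Y x)"]) (smt (verit) mult_nonneg_nonneg norm_ge_zero)
  qed
qed

lemma sq_int_inner:
  assumes "sq_int M X" "sq_int M Y"
  shows "integrable M (\<lambda>x. X x \<bullet> Y x)"
proof (rule Bochner_Integration.integrable_bound[OF sq_int_norm_mult[OF assms]])
  note [measurable] = assms[THEN sq_int_measurable]
  show "(\<lambda>x. X x \<bullet> Y x) \<in> borel_measurable M" by measurable
qed (simp add: Cauchy_Schwarz_ineq2)

lemma borel_measurable_vec_nth [measurable]:
  "X \<in> borel_measurable M \<Longrightarrow> (\<lambda>x. (X x :: real^'d) $ i) \<in> borel_measurable M"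
  by (rule measurable_compose[OF _ borel_measurable_continuous_onI]) (auto intro!: continuous_intros)

text \<open>\<open>(X x $ i) *\<^sub>R Y x\<close> is row i of the matrix X Y^T. Cross moments are
  handled row by row, because a matrix applied to \<open>Y\<close> then acts on each row by
  \<open>*v\<close>.\<close>

lemma sq_int_nth_scaleR:
  fixes X Y :: "'a \<Rightarrow> real^'d"
  assumes "sq_int M X" "sq_int M Y"
  shows "integrable M (\<lambda>x. (X x $ i) *\<^sub>R Y x)"
proof (rule Bochner_Integration.integrable_bound[OF sq_int_norm_mult[OF assms]])
  note [measurable] = assms[THEN sq_int_measurable]
  show "(\<lambda>x. (X x $ i) *\<^sub>R Y x) \<in> borel_measurable M" by measurable
qed (auto simp: component_le_norm_cart mult_right_mono)

lemma sq_int_scaleR: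
  assumes "sq_int M X"
  shows "sq_int M (\<lambda>x. c *\<^sub>R X x)"
  using assms unfolding sq_int_def by (auto simp: power_mult_distrib)

lemma sq_int_add:
  assumes "sq_int M X" "sq_int M Y"
  shows "sq_int M (\<lambda>x. X x + Y x)"
proof -
  note [measurable] = assms[THEN sq_int_measurable]
  have "(norm (X x + Y x))\<^sup>2 = (norm (X x))\<^sup>2 + 2 * (X x \<bullet> Y x) + (norm (Y x))\<^sup>2" for x
    unfolding power2_norm_eq_inner by (simp add: inner_add_left inner_add_right inner_commute)
  then show ?thesis
    using sq_int_inner[OF assms] assms unfolding sq_int_def by auto
qed

lemma sq_int_matrix:
  fixes A :: "real^'d^'e"
  assumes "sq_int M X"
  shows "sq_int M (\<lambda>x. A *v X x)"
proof -
  note [measurable] = assms[THEN sq_int_measurable]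
  obtain L where L: "L > 0" "\<And>x. norm (A *v x) \<le> norm x * L"
    using bounded_linear.pos_bounded[OF matrix_vector_mul_bounded_linear[of A]] by blast
  have m: "(\<lambda>x. A *v X x) \<in> borel_measurable M" by measurable
  moreover have "integrable M (\<lambda>x. (norm (A *v X x))\<^sup>2)"
  proof (rule Bochner_Integration.integrable_bound)
    show "integrable M (\<lambda>x. L\<^sup>2 * (norm (X x))\<^sup>2)" using assms by (auto simp: sq_int_def)
    have "(norm (A *v X x))\<^sup>2 \<le> (norm (X x) * L)\<^sup>2" for x using L(2) by (intro power_mono) auto
    then show "AE x in M. norm ((norm (A *v X x))\<^sup>2) \<le> norm (L\<^sup>2 * (norm (X x))\<^sup>2)"
      by (simp add: power_mult_distrib mult.commute)
  qed (use m in measurable)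
  ultimately show ?thesis by (simp add: sq_int_def)
qed

lemma sq_int_diff:
  assumes "sq_int M X" "sq_int M Y"
  shows "sq_int M (\<lambda>x. X x - Y x)"
  using sq_int_add[OF assms(1) sq_int_scaleR[OF assms(2), of "-1"]] by simp

lemma sq_int_sum:
  assumes "\<And>i. i \<in> I \<Longrightarrow> sq_int M (X i)"
  shows "sq_int M (\<lambda>x. \<Sum>i\<in>I. X i x)"
  using assms
proof (induction I rule: infinite_finite_induct)
  case (insert i I) then show ?case by (auto intro!: sq_int_add)
qed (auto simp: sq_int_def)

lemma (in prob_space) integral_mult_martingale_difference:
  fixes U Z :: "'a \<Rightarrow> real^'d"
  assumes F: "subalgebra M F" and U: "U \<in> borel_measurable F" "sq_int M U" and Z: "sq_int M Z"
    and mds: "\<And>i. AE x in M. real_cond_exp M F (\<lambda>y. Z y $ i) x = 0"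
  shows "(\<integral>x. (U x $ i) * (Z x $ j) \<partial>M) = 0"
proof -
  note [measurable] = Z[THEN sq_int_measurable]
  have "integrable M (\<lambda>x. (U x $ i) * (Z x $ j))"
    using integrable_bounded_linear[OF bounded_linear_vec_nth[of j] sq_int_nth_scaleR[OF U(2) Z, of i]] by simp
  moreover have "(\<lambda>x. U x $ i) \<in> borel_measurable F" using U(1) by measurable
  ultimately show ?thesis
    using integral_mult_cond_exp[OF F _ _ _ mds[of j], of "\<lambda>x. U x $ i"] by simp
qed


lemma (in prob_space) integral_nth_scaleR_martingale_difference:
  fixes U Z :: "'a \<Rightarrow> real^'d"
  assumes F: "subalgebra M F" and U: "U \<in> borel_measurable F" "sq_int M U" and Z: "sq_int M Z"
    and mds: "\<And>i. AE x in M. real_cond_exp M F (\<lambda>y. Z y $ i) x = 0"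
  shows "(\<integral>x. (U x $ i) *\<^sub>R Z x \<partial>M) = 0"
proof -
  have "(\<integral>x. (U x $ i) *\<^sub>R Z x \<partial>M) $ j = (\<integral>x. (U x $ i) * (Z x $ j) \<partial>M)" for j
    using integral_bounded_linear[OF bounded_linear_vec_nth[of j] sq_int_nth_scaleR[OF U(2) Z, of i]] by simp
  then show ?thesis
    using integral_mult_martingale_difference[OF assms] by (simp add: vec_eq_iff)
qed

text \<open>The right side is the trace of the cross-moment matrix, so bounds on its rows bound the
  mean inner product.\<close>

lemma (in prob_space) integral_inner_eq_sum:
  fixes U W :: "'a \<Rightarrow> real^'d"
  assumes "sq_int M U" "sq_int M W"
  shows "(\<integral>x. U x \<bullet> W x \<partial>M) = (\<Sum>i\<in>UNIV. (\<integral>x. (U x $ i) *\<^sub>R W x \<partial>M) $ i)"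
proof -
  have c: "integrable M (\<lambda>x. (U x $ i) * (W x $ i))" for i
    using integrable_bounded_linear[OF bounded_linear_vec_nth[of i] sq_int_nth_scaleR[OF assms, of i]] by simp
  have "(\<integral>x. U x \<bullet> W x \<partial>M) = (\<integral>x. (\<Sum>i\<in>UNIV. (U x $ i) * (W x $ i)) \<partial>M)"
    by (simp add: inner_vec_def)
  also have "\<dots> = (\<Sum>i\<in>UNIV. (\<integral>x. (U x $ i) * (W x $ i) \<partial>M))"
    using c by (rule Bochner_Integration.integral_sum)
  also have "\<dots> = (\<Sum>i\<in>UNIV. (\<integral>x. (U x $ i) *\<^sub>R W x \<partial>M) $ i)"
    using integral_bounded_linear[OF bounded_linear_vec_nth sq_int_nth_scaleR[OF assms]] by simp
  finally show ?thesis .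
qed

lemma (in prob_space) second_moment_add:
  fixes U W :: "'a \<Rightarrow> real^'d"
  assumes "sq_int M U" "sq_int M W"
  shows "(\<integral>x. (norm (U x + W x))\<^sup>2 \<partial>M)
     = (\<integral>x. (norm (U x))\<^sup>2 \<partial>M) + 2 * (\<integral>x. U x \<bullet> W x \<partial>M) + (\<integral>x. (norm (W x))\<^sup>2 \<partial>M)"
proof -
  have "(norm (U x + W x))\<^sup>2 = (norm (U x))\<^sup>2 + 2 * (U x \<bullet> W x) + (norm (W x))\<^sup>2" for x
    unfolding power2_norm_eq_inner by (simp add: inner_add_left inner_add_right inner_commute)
  then show ?thesis
    using sq_int_inner[OF assms] assms[THEN sq_int_integrable] by simp
qed

text \<open>Pythagoras: a martingale difference is orthogonal to the square-integrable past.\<close>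

lemma (in prob_space) second_moment_add_martingale_difference:
  fixes U Z :: "'a \<Rightarrow> real^'d"
  assumes F: "subalgebra M F" and U: "U \<in> borel_measurable F" "sq_int M U" and Z: "sq_int M Z"
    and mds: "\<And>i. AE x in M. real_cond_exp M F (\<lambda>y. Z y $ i) x = 0"
  shows "(\<integral>x. (norm (U x + c *\<^sub>R Z x))\<^sup>2 \<partial>M) = (\<integral>x. (norm (U x))\<^sup>2 \<partial>M) + c\<^sup>2 * (\<integral>x. (norm (Z x))\<^sup>2 \<partial>M)"
proof -
  have "(\<integral>x. U x \<bullet> Z x \<partial>M) = 0"
    unfolding integral_inner_eq_sum[OF U(2) Z] integral_nth_scaleR_martingale_difference[OF assms] by simp
  then show ?thesis
    unfolding second_moment_add[OF U(2) sq_int_scaleR[OF Z]] by (simp add: power_mult_distrib)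
qed

locale vec_filtration = prob_space M for M :: "'a measure" +
  fixes F :: "nat \<Rightarrow> 'a measure"
  assumes F_sub: "\<And>n. subalgebra M (F n)" and F_Suc: "\<And>n. sets (F n) \<subseteq> sets (F (Suc n))"
begin

lemma F_mono: "m \<le> n \<Longrightarrow> f \<in> borel_measurable (F m) \<Longrightarrow> f \<in> borel_measurable (F n)"
proof -
  assume mn: "m \<le> n" and f: "f \<in> borel_measurable (F m)"
  have "sets (F m) \<subseteq> sets (F n)" using mn F_Suc by (induction rule: dec_induct) auto
  moreover have "space (F m) = space (F n)"
    using F_sub[of m] F_sub[of n] by (simp add: subalgebra_def)
  ultimately show ?thesis using f by (auto simp: measurable_def)
qed

text \<open>By orthogonality the second moment of the sum grows in each step exactly by that of the
  new difference, a null sequence.\<close>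

lemma martingale_second_moment_sublinear:
  fixes Z :: "nat \<Rightarrow> 'a \<Rightarrow> real^'d"
  assumes Z: "\<And>n. n \<ge> 1 \<Longrightarrow> Z n \<in> borel_measurable (F n)" "\<And>n. n \<ge> 1 \<Longrightarrow> sq_int M (Z n)"
    and mds: "\<And>n i. n \<ge> 1 \<Longrightarrow> AE x in M. real_cond_exp M (F (n - 1)) (\<lambda>y. Z n y $ i) x = 0"
    and lim: "(\<lambda>n. \<integral>x. (norm (Z n x))\<^sup>2 \<partial>M) \<longlonglongrightarrow> 0"
  shows "(\<lambda>n. (\<integral>x. (norm (\<Sum>i=1..n. Z i x))\<^sup>2 \<partial>M) / real n) \<longlonglongrightarrow> 0"
proof (rule increments_null_imp_sublinear[where d="\<lambda>n. \<integral>x. (norm (Z (Suc n) x))\<^sup>2 \<partial>M"])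
  show "(\<lambda>n. \<integral>x. (norm (Z (Suc n) x))\<^sup>2 \<partial>M) \<longlonglongrightarrow> 0" by (rule LIMSEQ_Suc[OF lim])
  have "(\<integral>x. (norm (\<Sum>i=1..Suc n. Z i x))\<^sup>2 \<partial>M)
      = (\<integral>x. (norm (\<Sum>i=1..n. Z i x))\<^sup>2 \<partial>M) + (\<integral>x. (norm (Z (Suc n) x))\<^sup>2 \<partial>M)" for n
  proof -
    have "(\<lambda>x. \<Sum>i=1..n. Z i x) \<in> borel_measurable (F n)"
      by (intro borel_measurable_sum F_mono[OF _ Z(1)]) auto
    moreover have "sq_int M (\<lambda>x. \<Sum>i=1..n. Z i x)" by (intro sq_int_sum Z) auto
    ultimately show ?thesis
      using second_moment_add_martingale_difference[OF F_sub[of n] _ _ Z(2)[of "Suc n"], of "\<lambda>x. \<Sum>i=1..n. Z i x" 1]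
        mds[of "Suc n"] by simp
  qed
  then show "\<forall>\<^sub>F n in sequentially. (\<integral>x. (norm (\<Sum>i=1..Suc n. Z i x))\<^sup>2 \<partial>M)
      \<le> (\<integral>x. (norm (\<Sum>i=1..n. Z i x))\<^sup>2 \<partial>M) + (\<integral>x. (norm (Z (Suc n) x))\<^sup>2 \<partial>M)"
    by simp
qed simp

end

locale averaged_recursion = vec_filtration M F + step_sizes \<gamma>
  for M :: "'a measure" and F :: "nat \<Rightarrow> 'a measure" and \<gamma> :: "nat \<Rightarrow> real" +
  fixes A :: "real^'d^'d" and Z Y :: "nat \<Rightarrow> 'a \<Rightarrow> real^'d" and B :: real
  assumes A_spd: "sym_pos_def A"
    and Z_F: "\<And>n. n \<ge> 1 \<Longrightarrow> Z n \<in> borel_measurable (F n)"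
    and Z_sq: "\<And>n. n \<ge> 1 \<Longrightarrow> sq_int M (Z n)"
    and Z_bd: "\<And>n. n \<ge> 1 \<Longrightarrow> (\<integral>x. (norm (Z n x))\<^sup>2 \<partial>M) \<le> B"
    and Z_mds: "\<And>n i. n \<ge> 1 \<Longrightarrow> AE x in M. real_cond_exp M (F (n - 1)) (\<lambda>y. Z n y $ i) x = 0"
    and Y_0: "Y 0 = (\<lambda>x. 0)"
    and Y_Suc: "\<And>n. Y (Suc n) = (\<lambda>x. Y n x - \<gamma> (Suc n) *\<^sub>R (A *v Y n x) + \<gamma> (Suc n) *\<^sub>R Z (Suc n) x)"
begin

lemma Z_mds': "AE x in M. real_cond_exp M (F n) (\<lambda>y. Z (Suc n) y $ i) x = 0"
  using Z_mds[of "Suc n" i] by simp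

lemma Y_F: "Y n \<in> borel_measurable (F n)"
proof (induction n)
  case (Suc n)
  have [measurable]: "Y n \<in> borel_measurable (F (Suc n))" using Suc by (rule F_mono[rotated]) simp
  have [measurable]: "Z (Suc n) \<in> borel_measurable (F (Suc n))" by (rule Z_F) simp
  show ?case unfolding Y_Suc by measurable
qed (simp add: Y_0)

lemma Y_sq: "sq_int M (Y n)"
proof (induction n)
  case (Suc n)
  then show ?case unfolding Y_Suc
    by (intro sq_int_add sq_int_diff sq_int_scaleR sq_int_matrix Z_sq) auto
qed (simp add: Y_0 sq_int_def)

definition "P n x = x - \<gamma> (Suc n) *\<^sub>R (A *v x)"

lemma P_bounded_linear: "bounded_linear (P n)"
  unfolding P_def by (intro bounded_linear_sub bounded_linear_ident bounded_linear_const_scaleR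
     matrix_vector_mul_bounded_linear)

lemma P_Y_F: "(\<lambda>x. P n (Y n x)) \<in> borel_measurable (F n)"
  using Y_F[of n] unfolding P_def by measurable

lemma P_Y_sq: "sq_int M (\<lambda>x. P n (Y n x))"
  unfolding P_def by (intro sq_int_diff sq_int_scaleR sq_int_matrix Y_sq)

lemma B_nonneg: "0 \<le> B"
  using Z_bd[of 1] by (rule order_trans[rotated]) auto

text \<open>In a step the damping removes the fraction a \<gamma> of the second moment, while the
  orthogonal noise adds at most B times \<gamma>^2. After division by \<gamma>, damping and noise
  are both of order \<gamma>, which is the setting of
  \<open>damped_recursion_bounded\<close>.\<close>

lemma Y_second_moment: "\<exists>K\<ge>0. \<forall>n\<ge>1. (\<integral>x. (norm (Y n x))\<^sup>2 \<partial>M) \<le> K * \<gamma> n"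
proof -
  define m where "m n = (\<integral>x. (norm (Y n x))\<^sup>2 \<partial>M)" for n
  obtain a where a: "a > 0" and contr: "\<forall>\<^sub>F n in sequentially. a * \<gamma> (Suc n) \<le> 1 \<and>
     (\<forall>x. norm (x - \<gamma> (Suc n) *\<^sub>R (A *v x)) \<le> (1 - a * \<gamma> (Suc n)) * norm x)"
    using eventually_contraction[OF A_spd] by blast
  have "\<exists>K\<ge>0. \<forall>n. m n / \<gamma> n \<le> K"
  proof (rule damped_recursion_bounded[of "a / 2" B "\<lambda>n. \<gamma> (Suc n)"])
    show "0 < a / 2" "0 \<le> B" using a B_nonneg by auto
    show "\<forall>\<^sub>F n in sequentially. 0 \<le> \<gamma> (Suc n) \<and> a / 2 * \<gamma> (Suc n) \<le> 1 \<and>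
        m (Suc n) / \<gamma> (Suc n) \<le> (1 - a / 2 * \<gamma> (Suc n)) * (m n / \<gamma> n) + B * \<gamma> (Suc n)"
      using contr eventually_rescaled_damping[OF a]
    proof eventually_elim
      case (elim n)
      have g: "\<gamma> (Suc n) > 0" by (rule pos) simp
      have "m (Suc n) = (\<integral>x. (norm (P n (Y n x) + \<gamma> (Suc n) *\<^sub>R Z (Suc n) x))\<^sup>2 \<partial>M)"
        unfolding m_def Y_Suc P_def by simp
      also have "\<dots> = (\<integral>x. (norm (P n (Y n x)))\<^sup>2 \<partial>M) + (\<gamma> (Suc n))\<^sup>2 * (\<integral>x. (norm (Z (Suc n) x))\<^sup>2 \<partial>M)"
        by (rule second_moment_add_martingale_difference[OF F_sub P_Y_F P_Y_sq Z_sq Z_mds']) simp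
      finally have ms: "m (Suc n) \<le> (\<integral>x. (norm (P n (Y n x)))\<^sup>2 \<partial>M) + (\<gamma> (Suc n))\<^sup>2 * B"
        using Z_bd[of "Suc n"] by (simp add: mult_left_mono)
      have "(\<integral>x. (norm (P n (Y n x)))\<^sup>2 \<partial>M) \<le> (\<integral>x. (1 - a * \<gamma> (Suc n)) * (norm (Y n x))\<^sup>2 \<partial>M)"
      proof (rule integral_mono)
        fix x
        have le1: "0 \<le> 1 - a * \<gamma> (Suc n)" "1 - a * \<gamma> (Suc n) \<le> 1" using elim a g by auto
        have "(norm (P n (Y n x)))\<^sup>2 \<le> ((1 - a * \<gamma> (Suc n)) * norm (Y n x))\<^sup>2"
          using elim unfolding P_def by (intro power_mono) auto
        also have "\<dots> = (1 - a * \<gamma> (Suc n)) * ((1 - a * \<gamma> (Suc n)) * (norm (Y n x))\<^sup>2)"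
          by (simp add: power2_eq_square)
        also have "\<dots> \<le> (1 - a * \<gamma> (Suc n)) * (1 * (norm (Y n x))\<^sup>2)"
          using le1 by (intro mult_left_mono mult_right_mono) auto
        finally show "(norm (P n (Y n x)))\<^sup>2 \<le> (1 - a * \<gamma> (Suc n)) * (norm (Y n x))\<^sup>2" by simp
      qed (use P_Y_sq Y_sq in \<open>auto intro: sq_int_integrable\<close>)
      also have "\<dots> = (1 - a * \<gamma> (Suc n)) * m n" by (simp add: m_def)
      finally have "(\<integral>x. (norm (P n (Y n x)))\<^sup>2 \<partial>M) / \<gamma> (Suc n) \<le> (1 - a / 2 * \<gamma> (Suc n)) * (m n / \<gamma> n)"
        using elim(2) by (auto simp: m_def)
      moreover have "m (Suc n) / \<gamma> (Suc n) \<le> (\<integral>x. (norm (P n (Y n x)))\<^sup>2 \<partial>M) / \<gamma> (Suc n) + B * \<gamma> (Suc n)"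
        using divide_right_mono[OF ms, of "\<gamma> (Suc n)"] g by (simp add: add_divide_distrib power2_eq_square mult.commute)
      ultimately show ?case using elim(1) a g by (auto intro: order_trans[rotated])
    qed
  qed
  then obtain K where K: "K \<ge> 0" "\<And>n. m n / \<gamma> n \<le> K" by blast
  have "m n \<le> K * \<gamma> n" if "n \<ge> 1" for n
    using K(2)[of n] pos[OF that] by (simp add: field_simps)
  with K(1) show ?thesis unfolding m_def by blast
qed

definition "V n x = (\<Sum>i<n. \<delta> i *\<^sub>R Y i x)"

text \<open>\<open>V (Suc n)\<close> stops at \<open>Y n\<close>, so it is known one step early and
  \<open>Z (Suc n)\<close> is orthogonal to it.\<close>

lemma V_Suc_F: "V (Suc n) \<in> borel_measurable (F n)"
  unfolding V_def[abs_def]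
  by (intro borel_measurable_sum borel_measurable_scaleR borel_measurable_const F_mono[OF _ Y_F]) auto

lemma V_sq: "sq_int M (V n)"
  unfolding V_def[abs_def] by (intro sq_int_sum sq_int_scaleR Y_sq)

lemma V_Suc: "V (Suc n) = (\<lambda>x. V n x + \<delta> n *\<^sub>R Y n x)"
  by (simp add: V_def fun_eq_iff)

text \<open>The rows of the cross moment of \<open>V\<close> and \<open>Y\<close> inherit the contraction, because the new noise is
  orthogonal to the past; this is what makes \<open>V\<close> sublinear although its summands are not small
  enough for the triangle inequality.\<close>

lemma cross_moment_bounded: "\<exists>K\<ge>0. \<forall>n. norm (\<integral>x. (V n x $ i) *\<^sub>R Y n x \<partial>M) \<le> K"
proof -
  define c where "c n = (\<integral>x. (V n x $ i) *\<^sub>R Y n x \<partial>M)" for n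
  obtain a where a: "a > 0" and contr: "\<forall>\<^sub>F n in sequentially. a * \<gamma> (Suc n) \<le> 1 \<and>
     (\<forall>x. norm (x - \<gamma> (Suc n) *\<^sub>R (A *v x)) \<le> (1 - a * \<gamma> (Suc n)) * norm x)"
    using eventually_contraction[OF A_spd] by blast
  obtain K where K: "K \<ge> 0" "\<And>n. n \<ge> 1 \<Longrightarrow> (\<integral>x. (norm (Y n x))\<^sup>2 \<partial>M) \<le> K * \<gamma> n"
    using Y_second_moment by blast
  have \<delta>1: "\<forall>\<^sub>F n in sequentially. \<bar>\<delta> n\<bar> < 1"
    using order_tendstoD(2)[OF tendsto_rabs_zero[OF \<delta>_lim], of 1] by simp
  have "\<exists>K\<ge>0. \<forall>n. norm (c n) \<le> K"
  proof (rule damped_recursion_bounded[of a "2 * K" "\<lambda>n. \<gamma> (Suc n)"])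
    show "0 < a" "0 \<le> 2 * K" using a K by auto
    show "\<forall>\<^sub>F n in sequentially. 0 \<le> \<gamma> (Suc n) \<and> a * \<gamma> (Suc n) \<le> 1 \<and>
        norm (c (Suc n)) \<le> (1 - a * \<gamma> (Suc n)) * norm (c n) + 2 * K * \<gamma> (Suc n)"
      using contr \<delta>1 eventually_quotient[OF a] eventually_ge_at_top[of 1]
    proof eventually_elim
      case (elim n)
      have g: "\<gamma> (Suc n) > 0" by (rule pos) simp
      have int: "integrable M (\<lambda>x. (V (Suc n) x $ i) *\<^sub>R Y n x)" by (rule sq_int_nth_scaleR[OF V_sq Y_sq])
      \<comment> \<open>\<open>Y\<close> is advanced first, with \<open>V (Suc n)\<close> kept: the
        noise term vanishes, and linearity of \<open>P n\<close> moves it outside the integral, so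
        the row is contracted.\<close>
      have "c (Suc n) = (\<integral>x. (V (Suc n) x $ i) *\<^sub>R P n (Y n x) + \<gamma> (Suc n) *\<^sub>R ((V (Suc n) x $ i) *\<^sub>R Z (Suc n) x) \<partial>M)"
        unfolding c_def by (intro Bochner_Integration.integral_cong) (auto simp: Y_Suc P_def algebra_simps)
      also have "\<dots> = (\<integral>x. (V (Suc n) x $ i) *\<^sub>R P n (Y n x) \<partial>M) + \<gamma> (Suc n) *\<^sub>R (\<integral>x. (V (Suc n) x $ i) *\<^sub>R Z (Suc n) x \<partial>M)"
        using sq_int_nth_scaleR[OF V_sq P_Y_sq] sq_int_nth_scaleR[OF V_sq Z_sq[of "Suc n"]]
        by (simp del: scaleR_scaleR)
      also have "(\<integral>x. (V (Suc n) x $ i) *\<^sub>R Z (Suc n) x \<partial>M) = 0"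
        by (rule integral_nth_scaleR_martingale_difference[OF F_sub V_Suc_F V_sq Z_sq Z_mds']) simp
      also have "(\<integral>x. (V (Suc n) x $ i) *\<^sub>R P n (Y n x) \<partial>M) = P n (\<integral>x. (V (Suc n) x $ i) *\<^sub>R Y n x \<partial>M)"
        using integral_bounded_linear[OF P_bounded_linear[of n] int]
        by (simp add: linear_simps[OF P_bounded_linear])
      finally have c1: "c (Suc n) = P n (\<integral>x. (V (Suc n) x $ i) *\<^sub>R Y n x \<partial>M)" by simp
      \<comment> \<open>Going from \<open>V n\<close> to \<open>V (Suc n)\<close> adds \<delta> n
        times a second moment of \<open>Y n\<close>, of order \<gamma> n. This is the same order as
        the damping, so the row stays bounded.\<close>
      have c2: "(\<integral>x. (V (Suc n) x $ i) *\<^sub>R Y n x \<partial>M) = c n + \<delta> n *\<^sub>R (\<integral>x. (Y n x $ i) *\<^sub>R Y n x \<partial>M)"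
        unfolding c_def V_Suc using sq_int_nth_scaleR[OF V_sq Y_sq] sq_int_nth_scaleR[OF Y_sq Y_sq]
        by (simp add: scaleR_add_left flip: scaleR_scaleR)
      have "norm (\<integral>x. (Y n x $ i) *\<^sub>R Y n x \<partial>M) \<le> (\<integral>x. norm ((Y n x $ i) *\<^sub>R Y n x) \<partial>M)"
        by (rule integral_norm_bound)
      also have "\<dots> \<le> (\<integral>x. (norm (Y n x))\<^sup>2 \<partial>M)"
        using sq_int_nth_scaleR[OF Y_sq Y_sq] sq_int_integrable[OF Y_sq]
        by (intro integral_mono integrable_norm) (auto simp: power2_eq_square component_le_norm_cart mult_right_mono)
      also have "\<dots> \<le> K * \<gamma> n" using K(2) elim by simp
      also have "\<dots> \<le> K * (2 * \<gamma> (Suc n))"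
        using K(1) elim g by (intro mult_left_mono) (auto simp: field_simps)
      finally have c3: "norm (\<integral>x. (Y n x $ i) *\<^sub>R Y n x \<partial>M) \<le> 2 * K * \<gamma> (Suc n)" by simp
      have "norm (c n + \<delta> n *\<^sub>R (\<integral>x. (Y n x $ i) *\<^sub>R Y n x \<partial>M)) \<le> norm (c n) + \<bar>\<delta> n\<bar> * norm (\<integral>x. (Y n x $ i) *\<^sub>R Y n x \<partial>M)"
        by (rule order_trans[OF norm_triangle_ineq]) simp
      also have "\<bar>\<delta> n\<bar> * norm (\<integral>x. (Y n x $ i) *\<^sub>R Y n x \<partial>M) \<le> 1 * (2 * K * \<gamma> (Suc n))"
        using elim c3 by (intro mult_mono) auto
      finally have c4: "norm (c n + \<delta> n *\<^sub>R (\<integral>x. (Y n x $ i) *\<^sub>R Y n x \<partial>M)) \<le> norm (c n) + 2 * K * \<gamma> (Suc n)" by simp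
      have le1: "0 \<le> 1 - a * \<gamma> (Suc n)" "1 - a * \<gamma> (Suc n) \<le> 1" using elim a g by auto
      have "norm (c (Suc n)) \<le> (1 - a * \<gamma> (Suc n)) * norm (c n + \<delta> n *\<^sub>R (\<integral>x. (Y n x $ i) *\<^sub>R Y n x \<partial>M))"
        unfolding c1 c2 P_def using elim by blast
      also have "\<dots> \<le> (1 - a * \<gamma> (Suc n)) * (norm (c n) + 2 * K * \<gamma> (Suc n))"
        using c4 le1 by (intro mult_left_mono) auto
      also have "\<dots> \<le> (1 - a * \<gamma> (Suc n)) * norm (c n) + 1 * (2 * K * \<gamma> (Suc n))"
        unfolding distrib_left using le1 K(1) g by (intro add_left_mono mult_right_mono) auto
      finally show ?case using elim g by auto
    qed
  qed
  then show ?thesis unfolding c_def .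
qed

text \<open>The increments of the second moment are 2 \<delta> n E(V n . Y n) + (\<delta> n)^2
  E(norm (Y n))^2. The mean inner product is a sum of bounded row entries, so \<delta> tending to 0
  makes the increments null.\<close>

lemma V_second_moment_sublinear: "(\<lambda>n. (\<integral>x. (norm (V n x))\<^sup>2 \<partial>M) / real n) \<longlonglongrightarrow> 0"
proof -
  obtain K where K: "K \<ge> 0" "\<And>n. n \<ge> 1 \<Longrightarrow> (\<integral>x. (norm (Y n x))\<^sup>2 \<partial>M) \<le> K * \<gamma> n"
    using Y_second_moment by blast
  have "\<forall>i. \<exists>K. \<forall>n. norm (\<integral>x. (V n x $ i) *\<^sub>R Y n x \<partial>M) \<le> K"
    using cross_moment_bounded by blast
  then obtain c where c: "\<And>i n. norm (\<integral>x. (V n x $ i) *\<^sub>R Y n x \<partial>M) \<le> c i" by metis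
  define S where "S = (\<Sum>i\<in>UNIV. c i)"
  have VY: "\<bar>\<integral>x. V n x \<bullet> Y n x \<partial>M\<bar> \<le> S" for n
    unfolding integral_inner_eq_sum[OF V_sq Y_sq] S_def
    by (intro order_trans[OF sum_abs] sum_mono order_trans[OF component_le_norm_cart c])
  show ?thesis
  proof (rule increments_null_imp_sublinear[where d="\<lambda>n. 2 * (\<bar>\<delta> n\<bar> * S) + (\<delta> n)\<^sup>2 * (K * \<gamma> n)"])
    have "(\<lambda>n. 2 * (\<bar>\<delta> n\<bar> * S) + (\<delta> n)\<^sup>2 * (K * \<gamma> n)) \<longlonglongrightarrow> 2 * (\<bar>0\<bar> * S) + 0\<^sup>2 * (K * 0)"
      by (intro tendsto_intros \<delta>_lim lim)
    then show "(\<lambda>n. 2 * (\<bar>\<delta> n\<bar> * S) + (\<delta> n)\<^sup>2 * (K * \<gamma> n)) \<longlonglongrightarrow> 0" by simp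
    show "\<forall>\<^sub>F n in sequentially. (\<integral>x. (norm (V (Suc n) x))\<^sup>2 \<partial>M)
        \<le> (\<integral>x. (norm (V n x))\<^sup>2 \<partial>M) + (2 * (\<bar>\<delta> n\<bar> * S) + (\<delta> n)\<^sup>2 * (K * \<gamma> n))"
    proof (rule eventually_sequentiallyI[of 1])
      fix n :: nat assume n: "n \<ge> 1"
      have "(\<integral>x. (norm (V (Suc n) x))\<^sup>2 \<partial>M)
          = (\<integral>x. (norm (V n x))\<^sup>2 \<partial>M) + 2 * (\<delta> n * (\<integral>x. V n x \<bullet> Y n x \<partial>M)) + (\<delta> n)\<^sup>2 * (\<integral>x. (norm (Y n x))\<^sup>2 \<partial>M)"
        unfolding V_Suc second_moment_add[OF V_sq sq_int_scaleR[OF Y_sq]] by (simp add: power_mult_distrib)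
      moreover have "\<delta> n * (\<integral>x. V n x \<bullet> Y n x \<partial>M) \<le> \<bar>\<delta> n\<bar> * S"
        using VY[of n] by (rule order_trans[OF abs_ge_self, OF eq_refl[OF abs_mult, THEN order_trans], OF mult_left_mono]) simp
      moreover have "(\<delta> n)\<^sup>2 * (\<integral>x. (norm (Y n x))\<^sup>2 \<partial>M) \<le> (\<delta> n)\<^sup>2 * (K * \<gamma> n)"
        using K(2)[OF n] by (intro mult_left_mono) auto
      ultimately show "(\<integral>x. (norm (V (Suc n) x))\<^sup>2 \<partial>M)
        \<le> (\<integral>x. (norm (V n x))\<^sup>2 \<partial>M) + (2 * (\<bar>\<delta> n\<bar> * S) + (\<delta> n)\<^sup>2 * (K * \<gamma> n))" by linarith
    qed
  qed simp
qed

text \<open>Both are boundary terms. \<open>Y n\<close> occurs because the average runs over 1..n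
  whereas summation by parts treats 0..n-1; the rescaled one has second moment at most K / \<gamma>
  n, and 1/\<gamma> n = o(n).\<close>

lemma Y_second_moment_lims:
  shows "(\<lambda>n. (\<integral>x. (norm (Y n x))\<^sup>2 \<partial>M) / real n) \<longlonglongrightarrow> 0"
    and "(\<lambda>n. (\<integral>x. (norm ((1 / \<gamma> n) *\<^sub>R Y n x))\<^sup>2 \<partial>M) / real n) \<longlonglongrightarrow> 0"
proof -
  obtain K where K: "K \<ge> 0" "\<And>n. n \<ge> 1 \<Longrightarrow> (\<integral>x. (norm (Y n x))\<^sup>2 \<partial>M) \<le> K * \<gamma> n"
    using Y_second_moment by blast
  have l1: "(\<lambda>n. K * \<gamma> n * (1 / real n)) \<longlonglongrightarrow> K * 0 * 0"
    by (intro tendsto_mult tendsto_const lim lim_1_over_n)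
  show "(\<lambda>n. (\<integral>x. (norm (Y n x))\<^sup>2 \<partial>M) / real n) \<longlonglongrightarrow> 0"
  proof (rule Lim_null_comparison)
    show "(\<lambda>n. K * \<gamma> n * (1 / real n)) \<longlonglongrightarrow> 0" using l1 by simp
    show "\<forall>\<^sub>F n in sequentially. norm ((\<integral>x. (norm (Y n x))\<^sup>2 \<partial>M) / real n) \<le> K * \<gamma> n * (1 / real n)"
      using K(2) by (intro eventually_sequentiallyI[of 1]) (auto simp: divide_right_mono)
  qed
  have l2: "(\<lambda>n. K * (1 / \<gamma> n / real n)) \<longlonglongrightarrow> K * 0"
    by (intro tendsto_mult tendsto_const inverse_sublinear)
  show "(\<lambda>n. (\<integral>x. (norm ((1 / \<gamma> n) *\<^sub>R Y n x))\<^sup>2 \<partial>M) / real n) \<longlonglongrightarrow> 0"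
  proof (rule Lim_null_comparison)
    show "(\<lambda>n. K * (1 / \<gamma> n / real n)) \<longlonglongrightarrow> 0" using l2 by simp
    show "\<forall>\<^sub>F n in sequentially. norm ((\<integral>x. (norm ((1 / \<gamma> n) *\<^sub>R Y n x))\<^sup>2 \<partial>M) / real n) \<le> K * (1 / \<gamma> n / real n)"
    proof (rule eventually_sequentiallyI[of 1])
      fix n :: nat assume n: "n \<ge> 1"
      have g: "\<gamma> n > 0" by (rule pos[OF n])
      have "(\<integral>x. (norm ((1 / \<gamma> n) *\<^sub>R Y n x))\<^sup>2 \<partial>M) = (\<integral>x. (norm (Y n x))\<^sup>2 \<partial>M) / (\<gamma> n)\<^sup>2"
        by (simp add: power_divide)
      also have "\<dots> \<le> K * \<gamma> n / (\<gamma> n)\<^sup>2" using K(2)[OF n] by (intro divide_right_mono) auto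
      also have "\<dots> = K * (1 / \<gamma> n)" using g by (simp add: power2_eq_square)
      finally show "norm ((\<integral>x. (norm ((1 / \<gamma> n) *\<^sub>R Y n x))\<^sup>2 \<partial>M) / real n) \<le> K * (1 / \<gamma> n / real n)"
        using divide_right_mono[of _ _ "real n"] by fastforce
    qed
  qed
qed

text \<open>Solving the recursion for A Y n gives (Y n - Y (n+1)) / \<gamma> (n+1) + Z (n+1).
  Changing the coefficient of Y n from 1/\<gamma> (n+1) to 1/\<gamma> n leaves \<delta> n times Y n,
  the new summand of \<open>V\<close>. At n = 1 the identity reduces to Y 1 = \<gamma> 1 times Z 1,
  as Y 0 = 0.\<close>

lemma sum_Y:
  assumes "n \<ge> 1"
  shows "A *v (\<Sum>i<n. Y i x) = (\<Sum>i=1..n. Z i x) + V n x - (1 / \<gamma> n) *\<^sub>R Y n x"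
  using assms
proof (induction n rule: dec_induct)
  case base
  have "\<gamma> 1 > 0" by (rule pos) simp
  then show ?case using Y_Suc[of 0] by (simp add: Y_0 V_def)
next
  case (step n)
  have g: "\<gamma> (Suc n) > 0" by (rule pos) simp
  have AY: "A *v Y n x = (1 / \<gamma> (Suc n)) *\<^sub>R (Y n x - Y (Suc n) x) + Z (Suc n) x"
    using g by (simp add: Y_Suc algebra_simps)
  have "A *v (\<Sum>i<Suc n. Y i x) = A *v (\<Sum>i<n. Y i x) + A *v Y n x"
    by (simp add: matrix_vector_right_distrib)
  also have "\<dots> = (\<Sum>i=1..Suc n. Z i x) + V (Suc n) x - (1 / \<gamma> (Suc n)) *\<^sub>R Y (Suc n) x"
    unfolding step AY V_Suc by (simp add: \<delta>_def algebra_simps)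
  finally show ?case .
qed

end

subsection \<open>Negligible remainders\<close>

text \<open>Convergence to 0 in probability, in a form to which integral estimates apply directly.\<close>

definition null_mean :: "'a measure \<Rightarrow> (nat \<Rightarrow> 'a \<Rightarrow> 'b::euclidean_space) \<Rightarrow> bool" where
  "null_mean M R \<longleftrightarrow> (\<forall>n. R n \<in> borel_measurable M) \<and> (\<lambda>n. \<integral>x. min 1 (norm (R n x)) \<partial>M) \<longlonglongrightarrow> 0"

lemma borel_measurable_vec_lambda:
  fixes f :: "'d::finite \<Rightarrow> 'a \<Rightarrow> 'b::euclidean_space"
  assumes "\<And>i. f i \<in> borel_measurable M"
  shows "(\<lambda>x. \<chi> i. f i x) \<in> borel_measurable M"
  using assms by (subst borel_measurable_euclidean_space) (auto simp: Basis_vec_def inner_axis)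

context prob_space
begin

lemma integrable_min_norm:
  fixes R :: "'a \<Rightarrow> 'b::euclidean_space"
  assumes "R \<in> borel_measurable M"
  shows "integrable M (\<lambda>x. min 1 (norm (R x)))"
  using assms by (intro integrable_const_bound[where B=1]) auto

lemma null_mean_bound:
  fixes R :: "nat \<Rightarrow> 'a \<Rightarrow> 'b::euclidean_space" and a :: "nat \<Rightarrow> real"
  assumes "\<And>n. R n \<in> borel_measurable M" "a \<longlonglongrightarrow> 0"
    "\<forall>\<^sub>F n in sequentially. (\<integral>x. min 1 (norm (R n x)) \<partial>M) \<le> a n"
  shows "null_mean M R"
  unfolding null_mean_def
proof (intro conjI allI assms(1) tendsto_sandwich[OF _ assms(3) tendsto_const assms(2)])
  show "\<forall>\<^sub>F n in sequentially. 0 \<le> (\<integral>x. min 1 (norm (R n x)) \<partial>M)"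
    by (intro always_eventually allI integral_nonneg_AE) simp
qed

lemma null_mean_add:
  fixes R S :: "nat \<Rightarrow> 'a \<Rightarrow> 'b::euclidean_space"
  assumes "null_mean M R" "null_mean M S"
  shows "null_mean M (\<lambda>n x. R n x + S n x)"
proof (rule null_mean_bound)
  have [measurable]: "R n \<in> borel_measurable M" "S n \<in> borel_measurable M" for n
    using assms by (auto simp: null_mean_def)
  show "(\<lambda>x. R n x + S n x) \<in> borel_measurable M" for n by measurable
  show "(\<lambda>n. (\<integral>x. min 1 (norm (R n x)) \<partial>M) + (\<integral>x. min 1 (norm (S n x)) \<partial>M)) \<longlonglongrightarrow> 0"
    using tendsto_add[of _ 0 _ _ 0] assms by (fastforce simp: null_mean_def)
  have "(\<integral>x. min 1 (norm (R n x + S n x)) \<partial>M) \<le> (\<integral>x. min 1 (norm (R n x)) + min 1 (norm (S n x)) \<partial>M)" for n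
  proof (rule integral_mono)
    fix x
    show "min 1 (norm (R n x + S n x)) \<le> min 1 (norm (R n x)) + min 1 (norm (S n x))"
      using norm_triangle_ineq[of "R n x" "S n x"] norm_ge_zero[of "R n x"] norm_ge_zero[of "S n x"]
      by (smt (verit))
  qed (auto intro!: integrable_min_norm Bochner_Integration.integrable_add)
  then show "\<forall>\<^sub>F n in sequentially. (\<integral>x. min 1 (norm (R n x + S n x)) \<partial>M)
      \<le> (\<integral>x. min 1 (norm (R n x)) \<partial>M) + (\<integral>x. min 1 (norm (S n x)) \<partial>M)"
    by (simp add: integrable_min_norm)
qed

lemma null_mean_dominated:
  fixes R :: "nat \<Rightarrow> 'a \<Rightarrow> 'b::euclidean_space" and S :: "nat \<Rightarrow> 'a \<Rightarrow> 'c::euclidean_space"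
  assumes S: "null_mean M S" and R: "\<And>n. R n \<in> borel_measurable M" and L: "L \<ge> 0"
    and le: "\<forall>\<^sub>F n in sequentially. \<forall>x\<in>space M. norm (R n x) \<le> L * norm (S n x)"
  shows "null_mean M R"
proof (rule null_mean_bound[OF R])
  note [measurable] = R
  have [measurable]: "S n \<in> borel_measurable M" for n using S by (auto simp: null_mean_def)
  show "(\<lambda>n. max 1 L * (\<integral>x. min 1 (norm (S n x)) \<partial>M)) \<longlonglongrightarrow> 0"
    using S tendsto_mult_right_zero[of "\<lambda>n. \<integral>x. min 1 (norm (S n x)) \<partial>M"] by (simp add: null_mean_def)
  show "\<forall>\<^sub>F n in sequentially. (\<integral>x. min 1 (norm (R n x)) \<partial>M) \<le> max 1 L * (\<integral>x. min 1 (norm (S n x)) \<partial>M)"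
    using le
  proof eventually_elim
    case (elim n)
    have "(\<integral>x. min 1 (norm (R n x)) \<partial>M) \<le> (\<integral>x. max 1 L * min 1 (norm (S n x)) \<partial>M)"
    proof (rule integral_mono)
      fix x assume "x \<in> space M"
      then have "norm (R n x) \<le> L * norm (S n x)" using elim by blast
      also have "\<dots> \<le> max 1 L * norm (S n x)" by (intro mult_right_mono) auto
      finally have "min 1 (norm (R n x)) \<le> min (max 1 L * 1) (max 1 L * norm (S n x))" by auto
      also have "\<dots> = max 1 L * min 1 (norm (S n x))" by (rule mult_min_right[symmetric]) simp
      finally show "min 1 (norm (R n x)) \<le> max 1 L * min 1 (norm (S n x))" .
    qed (auto intro!: integrable_min_norm)
    then show ?case by simp
  qed
qed

lemma null_mean_matrix:
  fixes R :: "nat \<Rightarrow> 'a \<Rightarrow> real^'d" and C :: "real^'d^'e"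
  assumes "null_mean M R"
  shows "null_mean M (\<lambda>n x. C *v R n x)"
proof -
  obtain L where L: "L > 0" "\<And>x. norm (C *v x) \<le> norm x * L"
    using bounded_linear.pos_bounded[OF matrix_vector_mul_bounded_linear[of C]] by blast
  have [measurable]: "R n \<in> borel_measurable M" for n using assms by (auto simp: null_mean_def)
  show ?thesis
    using L by (intro null_mean_dominated[OF assms, of _ L]) (auto simp: mult.commute)
qed

lemma null_mean_pointwise:
  fixes R :: "nat \<Rightarrow> 'a \<Rightarrow> 'b::euclidean_space"
  assumes R: "\<And>n. R n \<in> borel_measurable M" and lim: "\<And>x. x \<in> space M \<Longrightarrow> (\<lambda>n. R n x) \<longlonglongrightarrow> 0"
  shows "null_mean M R"
  unfolding null_mean_def
proof (intro conjI allI R)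
  note [measurable] = R
  have "(\<lambda>n. \<integral>x. min 1 (norm (R n x)) \<partial>M) \<longlonglongrightarrow> (\<integral>x. 0 \<partial>M)"
  proof (rule integral_dominated_convergence[where w="\<lambda>_. 1"])
    show "AE x in M. (\<lambda>n. min 1 (norm (R n x))) \<longlonglongrightarrow> 0"
    proof (rule AE_I2)
      fix x assume "x \<in> space M"
      from tendsto_min[OF tendsto_const[of 1] tendsto_norm_zero[OF lim[OF this]]]
      show "(\<lambda>n. min 1 (norm (R n x))) \<longlonglongrightarrow> 0" by simp
    qed
  qed auto
  then show "(\<lambda>n. \<integral>x. min 1 (norm (R n x)) \<partial>M) \<longlonglongrightarrow> 0" by simp
qed

lemma null_mean_L1:
  fixes R :: "nat \<Rightarrow> 'a \<Rightarrow> 'b::euclidean_space"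
  assumes R: "\<And>n. R n \<in> borel_measurable M" "\<And>n. integrable M (\<lambda>x. norm (R n x))"
    and lim: "(\<lambda>n. \<integral>x. norm (R n x) \<partial>M) \<longlonglongrightarrow> 0"
  shows "null_mean M R"
  by (rule null_mean_bound[OF R(1) lim], intro always_eventually allI integral_mono)
     (auto intro: integrable_min_norm R)

lemma null_mean_L2:
  fixes R :: "nat \<Rightarrow> 'a \<Rightarrow> real^'d"
  assumes R: "\<And>n. sq_int M (R n)" and lim: "(\<lambda>n. \<integral>x. (norm (R n x))\<^sup>2 \<partial>M) \<longlonglongrightarrow> 0"
  shows "null_mean M R"
proof (rule null_mean_bound)
  note [measurable] = R[THEN sq_int_measurable]
  show "R n \<in> borel_measurable M" for n by measurable
  show "(\<lambda>n. sqrt (\<integral>x. (norm (R n x))\<^sup>2 \<partial>M)) \<longlonglongrightarrow> 0"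
    using tendsto_real_sqrt[OF lim] by simp
  have "(\<integral>x. min 1 (norm (R n x)) \<partial>M) \<le> sqrt (\<integral>x. (norm (R n x))\<^sup>2 \<partial>M)" for n
  proof (rule real_le_rsqrt)
    have i2: "integrable M (\<lambda>x. (min 1 (norm (R n x)))\<^sup>2)"
      by (intro integrable_const_bound[where B=1]) (auto intro!: power_le_one)
    \<comment> \<open>Nonnegativity of the variance serves as Jensen's inequality for the
      square.\<close>
    have "0 \<le> variance (\<lambda>x. min 1 (norm (R n x)))" by (rule variance_positive)
    also have "\<dots> = (\<integral>x. (min 1 (norm (R n x)))\<^sup>2 \<partial>M) - (\<integral>x. min 1 (norm (R n x)) \<partial>M)\<^sup>2"
      by (rule variance_eq[OF integrable_min_norm i2]) measurable
    finally have "(\<integral>x. min 1 (norm (R n x)) \<partial>M)\<^sup>2 \<le> (\<integral>x. (min 1 (norm (R n x)))\<^sup>2 \<partial>M)" by simp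
    also have "\<dots> \<le> (\<integral>x. (norm (R n x))\<^sup>2 \<partial>M)"
      using i2 sq_int_integrable[OF R] by (intro integral_mono power_mono) auto
    finally show "(\<integral>x. min 1 (norm (R n x)) \<partial>M)\<^sup>2 \<le> (\<integral>x. (norm (R n x))\<^sup>2 \<partial>M)" .
  qed
  then show "\<forall>\<^sub>F n in sequentially. (\<integral>x. min 1 (norm (R n x)) \<partial>M) \<le> sqrt (\<integral>x. (norm (R n x))\<^sup>2 \<partial>M)" by simp
qed

lemma null_mean_L2_scaled:
  fixes R :: "nat \<Rightarrow> 'a \<Rightarrow> real^'d"
  assumes R: "\<And>n. sq_int M (R n)" and lim: "(\<lambda>n. (\<integral>x. (norm (R n x))\<^sup>2 \<partial>M) / real n) \<longlonglongrightarrow> 0"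
  shows "null_mean M (\<lambda>n x. (1 / sqrt (real n)) *\<^sub>R R n x)"
  using lim by (intro null_mean_L2 sq_int_scaleR R) (simp add: power_mult_distrib power_divide)

text \<open>The distance of iexp u from 1 is at most 2 and at most \<bar>u\<bar>, so the remainder
  changes the integrand by at most max 2 (norm t) times min 1 (norm R), the quantity that
  \<open>null_mean\<close> makes small in mean.\<close>

lemma slutsky_cfun:
  fixes X R :: "nat \<Rightarrow> 'a \<Rightarrow> 'b::euclidean_space"
  assumes X: "\<And>n. X n \<in> borel_measurable M" and R: "null_mean M R"
    and lim: "(\<lambda>n. CLINT x|M. iexp (t \<bullet> X n x)) \<longlonglongrightarrow> l"
  shows "(\<lambda>n. CLINT x|M. iexp (t \<bullet> (X n x + R n x))) \<longlonglongrightarrow> l"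
proof -
  note [measurable] = X
  have Rm[measurable]: "R n \<in> borel_measurable M" for n using R by (auto simp: null_mean_def)
  define c where "c = max 2 (norm t)"
  have pt: "norm (iexp (t \<bullet> (X n x + R n x)) - iexp (t \<bullet> X n x)) \<le> c * min 1 (norm (R n x))" for n x
  proof -
    have "iexp (t \<bullet> (X n x + R n x)) - iexp (t \<bullet> X n x) = iexp (t \<bullet> X n x) * (iexp (t \<bullet> R n x) - 1)"
      by (simp add: inner_add_right algebra_simps exp_add)
    then have "norm (iexp (t \<bullet> (X n x + R n x)) - iexp (t \<bullet> X n x)) = norm (iexp (t \<bullet> R n x) - 1)"
      by (simp add: norm_mult)
    moreover have "norm (iexp (t \<bullet> R n x) - 1) \<le> 2"
      by (rule order_trans[OF norm_triangle_ineq4]) simp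
    moreover have "norm (iexp (t \<bullet> R n x) - 1) \<le> c * norm (R n x)"
    proof -
      have "norm (iexp (t \<bullet> R n x) - 1) \<le> \<bar>t \<bullet> R n x\<bar>"
        using iexp_approx1[of "t \<bullet> R n x" 0] by simp
      also have "\<dots> \<le> norm t * norm (R n x)" by (rule Cauchy_Schwarz_ineq2)
      also have "\<dots> \<le> c * norm (R n x)" by (intro mult_right_mono) (auto simp: c_def)
      finally show ?thesis .
    qed
    ultimately have "norm (iexp (t \<bullet> (X n x + R n x)) - iexp (t \<bullet> X n x)) \<le> min (c * 1) (c * norm (R n x))"
      by (auto simp: c_def)
    also have "\<dots> = c * min 1 (norm (R n x))" by (rule mult_min_right[symmetric]) (simp add: c_def)
    finally show ?thesis .
  qed
  have i: "integrable M (\<lambda>x. iexp (t \<bullet> (X n x + R n x)))" "integrable M (\<lambda>x. iexp (t \<bullet> X n x))" for n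
    by (auto intro!: integrable_iexp)
  have "(\<lambda>n. (CLINT x|M. iexp (t \<bullet> (X n x + R n x))) - (CLINT x|M. iexp (t \<bullet> X n x))) \<longlonglongrightarrow> 0"
  proof (rule Lim_null_comparison)
    show "(\<lambda>n. c * (\<integral>x. min 1 (norm (R n x)) \<partial>M)) \<longlonglongrightarrow> 0"
      using R tendsto_mult_right_zero[of "\<lambda>n. \<integral>x. min 1 (norm (R n x)) \<partial>M"] by (simp add: null_mean_def)
    have "norm ((CLINT x|M. iexp (t \<bullet> (X n x + R n x))) - (CLINT x|M. iexp (t \<bullet> X n x)))
        \<le> c * (\<integral>x. min 1 (norm (R n x)) \<partial>M)" for n
    proof -
      have "norm ((CLINT x|M. iexp (t \<bullet> (X n x + R n x))) - (CLINT x|M. iexp (t \<bullet> X n x)))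
          = norm (CLINT x|M. iexp (t \<bullet> (X n x + R n x)) - iexp (t \<bullet> X n x))"
        using i[of n] by simp
      also have "\<dots> \<le> (\<integral>x. norm (iexp (t \<bullet> (X n x + R n x)) - iexp (t \<bullet> X n x)) \<partial>M)"
        by (rule integral_norm_bound)
      also have "\<dots> \<le> (\<integral>x. c * min 1 (norm (R n x)) \<partial>M)"
      proof (rule integral_mono)
        show "integrable M (\<lambda>x. norm (iexp (t \<bullet> (X n x + R n x)) - iexp (t \<bullet> X n x)))"
          using i[of n] by (intro integrable_norm Bochner_Integration.integrable_diff) auto
        show "integrable M (\<lambda>x. c * min 1 (norm (R n x)))"
          by (intro integrable_mult_right integrable_min_norm Rm)
      qed (rule pt)
      finally show ?thesis by simp
    qed
    then show "\<forall>\<^sub>F n in sequentially. norm ((CLINT x|M. iexp (t \<bullet> (X n x + R n x))) - (CLINT x|M. iexp (t \<bullet> X n x)))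
        \<le> c * (\<integral>x. min 1 (norm (R n x)) \<partial>M)" by simp
  qed
  from tendsto_add[OF this lim] show ?thesis by simp
qed

lemma integrable_sq_int_nth:
  fixes X :: "'a \<Rightarrow> real^'d"
  assumes "sq_int M X"
  shows "integrable M (\<lambda>x. X x $ i)"
proof (rule square_integrable_imp_integrable)
  note [measurable] = sq_int_measurable[OF assms]
  show "(\<lambda>x. X x $ i) \<in> borel_measurable M" by measurable
  show "integrable M (\<lambda>x. (X x $ i)\<^sup>2)"
    using integrable_bounded_linear[OF bounded_linear_vec_nth[of i] sq_int_nth_scaleR[OF assms assms, of i]]
    by (simp add: power2_eq_square)
qed

text \<open>The extended nonnegative conditional expectation preserves the integral of every
  nonnegative measurable f, so integrability of f comes out as a conclusion.\<close>

lemma cond_bound_imp_moment_bound: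
  assumes F: "subalgebra M F" and f[measurable]: "f \<in> borel_measurable M" and f0: "\<And>x. 0 \<le> f x" and C: "0 \<le> C"
    and bd: "AE x in M. nn_cond_exp M F (\<lambda>y. ennreal (f y)) x \<le> ennreal C"
  shows "integrable M f" "(\<integral>x. f x \<partial>M) \<le> C"
proof -
  interpret S: sigma_finite_subalgebra M F by (rule sigma_finite_subalgebraI[OF F])
  have "(\<integral>\<^sup>+x. ennreal (f x) \<partial>M) = (\<integral>\<^sup>+x. 1 * nn_cond_exp M F (\<lambda>y. ennreal (f y)) x \<partial>M)"
    by (subst S.nn_cond_exp_intg) auto
  also have "\<dots> \<le> (\<integral>\<^sup>+x. ennreal C \<partial>M)" using bd by (intro nn_integral_mono_AE) auto
  also have "\<dots> = ennreal C" by (simp add: emeasure_space_1)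
  finally have le: "(\<integral>\<^sup>+x. ennreal (f x) \<partial>M) \<le> ennreal C" .
  then show "integrable M f"
    using f0 by (intro integrableI_nonneg) (auto intro: le_less_trans)
  then show "(\<integral>x. f x \<partial>M) \<le> C"
    using le C f0 by (simp add: nn_integral_eq_integral)
qed

text \<open>\<open>v n\<close> is the conditional variance of t . \<epsilon> n. Since u^2 <= 1 +
  u^4, the fourth-moment condition bounds it almost everywhere by a constant uniform in n;
  boundedness upgrades the convergence in probability to the convergence in mean that
  \<open>martingale_clt\<close> asks for.\<close>

lemma conditional_variance_null:
  fixes \<epsilon> :: "nat \<Rightarrow> 'a \<Rightarrow> real^'d" and \<Sigma> :: "real^'d^'d" and t :: "real^'d"
  assumes F: "\<And>n. subalgebra M (F n)"
    and eps[measurable]: "\<And>n. n \<ge> 1 \<Longrightarrow> \<epsilon> n \<in> borel_measurable M"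
    and sq: "\<And>n. n \<ge> 1 \<Longrightarrow> sq_int M (\<epsilon> n)"
    and C: "C > 0" and fourth: "\<And>n. n \<ge> 1 \<Longrightarrow> AE x in M. nn_cond_exp M (F (n - 1)) (\<lambda>y. ennreal ((norm (\<epsilon> n y)) ^ 4)) x \<le> ennreal C"
    and cov: "conv_in_prob M (\<lambda>n. cond_cov M (F (n - 1)) (\<epsilon> n)) \<Sigma>"
  defines "v \<equiv> \<lambda>n x. t \<bullet> (cond_cov M (F (n - 1)) (\<epsilon> n) x *v t)"
  shows "n \<ge> 1 \<Longrightarrow> AE x in M. real_cond_exp M (F (n - 1)) (\<lambda>x. (t \<bullet> \<epsilon> n x)\<^sup>2) x = v n x"
    and "n \<ge> 1 \<Longrightarrow> integrable M (v n)"
    and "(\<lambda>n. \<integral>x. \<bar>v n x - t \<bullet> (\<Sigma> *v t)\<bar> \<partial>M) \<longlonglongrightarrow> 0"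
proof -
  have comp: "integrable M (\<lambda>x. \<epsilon> n x $ i * \<epsilon> n x $ j)" if "n \<ge> 1" for n i j
    using integrable_bounded_linear[OF bounded_linear_vec_nth[of j] sq_int_nth_scaleR[OF sq[OF that] sq[OF that], of i]] by simp
  \<comment> \<open>This includes n = 0, where n - 1 is 0 and \<epsilon> 0 is unconstrained.\<close>
  have cc[measurable]: "cond_cov M (F (n - 1)) (\<epsilon> n) \<in> borel_measurable M" for n
    unfolding cond_cov_def by (intro borel_measurable_vec_lambda) measurable
  have lin: "linear (\<lambda>S::real^'d^'d. t \<bullet> (S *v t))"
    by (intro linearI) (simp_all add: matrix_vector_mult_add_rdistrib inner_add_right scaleR_matrix_vector_assoc[symmetric])
  have v_m[measurable]: "v n \<in> borel_measurable M" for n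
  proof -
    have "(\<lambda>S::real^'d^'d. t \<bullet> (S *v t)) \<in> borel_measurable borel"
      using lin by (intro borel_measurable_continuous_onI linear_continuous_on) (simp add: linear_conv_bounded_linear)
    from measurable_compose[OF cc this] show ?thesis by (simp add: v_def)
  qed
  \<comment> \<open>Double sums over coordinates become single sums over pairs, so additivity of the
    conditional expectation is invoked once and the exceptional null sets are collected over one
    finite index type.\<close>
  have pair: "(\<Sum>p\<in>UNIV. f (fst p) (snd p)) = (\<Sum>i\<in>UNIV. \<Sum>j\<in>UNIV. f i j)" for f :: "'d \<Rightarrow> 'd \<Rightarrow> real"
    unfolding UNIV_Times_UNIV[symmetric] by (simp only: sum.cartesian_product case_prod_unfold)
  have sq_expand: "(t \<bullet> y)\<^sup>2 = (\<Sum>p\<in>UNIV. (t $ fst p * t $ snd p) * (y $ fst p * y $ snd p))" for y :: "real^'d"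
    unfolding pair[of "\<lambda>i j. (t $ i * t $ j) * (y $ i * y $ j)"]
    by (simp add: inner_vec_def power2_eq_square sum_product algebra_simps)
  have v_expand: "v n x = (\<Sum>p\<in>UNIV. (t $ fst p * t $ snd p) * real_cond_exp M (F (n - 1)) (\<lambda>x. \<epsilon> n x $ fst p * \<epsilon> n x $ snd p) x)" for n x
    unfolding pair[of "\<lambda>i j. (t $ i * t $ j) * real_cond_exp M (F (n - 1)) (\<lambda>x. \<epsilon> n x $ i * \<epsilon> n x $ j) x"]
    by (simp add: v_def inner_vec_def matrix_vector_mult_def cond_cov_def sum_distrib_left algebra_simps)
  have vAE: "AE x in M. real_cond_exp M (F (n - 1)) (\<lambda>x. (t \<bullet> \<epsilon> n x)\<^sup>2) x = v n x" if n: "n \<ge> 1" for n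
  proof -
    interpret S: sigma_finite_subalgebra M "F (n - 1)" by (rule sigma_finite_subalgebraI[OF F])
    have "AE x in M. real_cond_exp M (F (n - 1)) (\<lambda>x. \<Sum>p\<in>UNIV. (t $ fst p * t $ snd p) * (\<epsilon> n x $ fst p * \<epsilon> n x $ snd p)) x
        = (\<Sum>p\<in>UNIV. real_cond_exp M (F (n - 1)) (\<lambda>x. (t $ fst p * t $ snd p) * (\<epsilon> n x $ fst p * \<epsilon> n x $ snd p)) x)"
      by (rule S.real_cond_exp_sum) (intro integrable_mult_right comp n)
    moreover have "AE x in M. \<forall>p. real_cond_exp M (F (n - 1)) (\<lambda>x. (t $ fst p * t $ snd p) * (\<epsilon> n x $ fst p * \<epsilon> n x $ snd p)) x
        = (t $ fst p * t $ snd p) * real_cond_exp M (F (n - 1)) (\<lambda>x. \<epsilon> n x $ fst p * \<epsilon> n x $ snd p) x"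
      by (intro AE_all_countable[THEN iffD2] allI S.real_cond_exp_cmult comp n)
    ultimately show ?thesis unfolding sq_expand v_expand by eventually_elim simp
  qed
  then show "n \<ge> 1 \<Longrightarrow> AE x in M. real_cond_exp M (F (n - 1)) (\<lambda>x. (t \<bullet> \<epsilon> n x)\<^sup>2) x = v n x" .
  define B where "B = (norm t)\<^sup>2 * (1 + C)"
  have vbd: "AE x in M. 0 \<le> v n x \<and> v n x \<le> B" if n: "n \<ge> 1" for n
  proof -
    interpret S: sigma_finite_subalgebra M "F (n - 1)" by (rule sigma_finite_subalgebraI[OF F])
    note [measurable] = eps[OF n]
    have i4: "integrable M (\<lambda>x. norm (\<epsilon> n x) ^ 4)"
      using cond_bound_imp_moment_bound(1)[OF F _ _ _ fourth[OF n]] C by simp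
    have i2: "integrable M (\<lambda>x. (t \<bullet> \<epsilon> n x)\<^sup>2)"
      unfolding sq_expand by (intro Bochner_Integration.integrable_sum integrable_mult_right comp n)
    have pt: "(t \<bullet> \<epsilon> n x)\<^sup>2 \<le> (norm t)\<^sup>2 + (norm t)\<^sup>2 * norm (\<epsilon> n x) ^ 4" for x
    proof -
      have "(t \<bullet> \<epsilon> n x)\<^sup>2 \<le> (norm t * norm (\<epsilon> n x))\<^sup>2"
        using Cauchy_Schwarz_ineq2[of t "\<epsilon> n x"] by (metis abs_ge_zero power2_abs power_mono)
      also have "\<dots> = (norm t)\<^sup>2 * (norm (\<epsilon> n x))\<^sup>2" by (simp add: power_mult_distrib)
      also have "\<dots> \<le> (norm t)\<^sup>2 * (1 + norm (\<epsilon> n x) ^ 4)"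
      proof (rule mult_left_mono)
        have "2 * (norm (\<epsilon> n x))\<^sup>2 \<le> 1 + norm (\<epsilon> n x) ^ 4"
          using sum_squares_bound[of 1 "(norm (\<epsilon> n x))\<^sup>2"] by simp
        then show "(norm (\<epsilon> n x))\<^sup>2 \<le> 1 + norm (\<epsilon> n x) ^ 4"
          using zero_le_power2[of "norm (\<epsilon> n x)"] by linarith
      qed simp
      finally show ?thesis by (simp add: distrib_left)
    qed
    have "AE x in M. real_cond_exp M (F (n - 1)) (\<lambda>x. (t \<bullet> \<epsilon> n x)\<^sup>2) x
        \<le> real_cond_exp M (F (n - 1)) (\<lambda>x. (norm t)\<^sup>2 + (norm t)\<^sup>2 * norm (\<epsilon> n x) ^ 4) x"
      using i2 i4 pt by (intro S.real_cond_exp_mono) auto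
    moreover have "AE x in M. real_cond_exp M (F (n - 1)) (\<lambda>x. (norm t)\<^sup>2 + (norm t)\<^sup>2 * norm (\<epsilon> n x) ^ 4) x
        = real_cond_exp M (F (n - 1)) (\<lambda>x. (norm t)\<^sup>2) x + real_cond_exp M (F (n - 1)) (\<lambda>x. (norm t)\<^sup>2 * norm (\<epsilon> n x) ^ 4) x"
      using i4 by (intro S.real_cond_exp_add) auto
    moreover have "AE x in M. real_cond_exp M (F (n - 1)) (\<lambda>x. (norm t)\<^sup>2) x = (norm t)\<^sup>2"
      by (rule S.real_cond_exp_F_meas) auto
    moreover have "AE x in M. real_cond_exp M (F (n - 1)) (\<lambda>x. (norm t)\<^sup>2 * norm (\<epsilon> n x) ^ 4) x
        = (norm t)\<^sup>2 * real_cond_exp M (F (n - 1)) (\<lambda>x. norm (\<epsilon> n x) ^ 4) x"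
      using i4 by (rule S.real_cond_exp_cmult)
    moreover have "AE x in M. real_cond_exp M (F (n - 1)) (\<lambda>x. norm (\<epsilon> n x) ^ 4) x \<le> C"
      using fourth[OF n]
    proof eventually_elim
      case (elim x)
      have "enn2real (nn_cond_exp M (F (n - 1)) (\<lambda>y. ennreal ((norm (\<epsilon> n y)) ^ 4)) x) \<le> C"
        using elim C by (intro enn2real_leI) auto
      \<comment> \<open>The real conditional expectation is the one of the positive part minus that
        of the negative part; dropping the nonnegative subtrahend gives the upper bound.\<close>
      then show ?case unfolding real_cond_exp_def
        using enn2real_nonneg[of "nn_cond_exp M (F (n - 1)) (\<lambda>y. ennreal (- (norm (\<epsilon> n y) ^ 4))) x"] by linarith
    qed
    moreover have "AE x in M. 0 \<le> real_cond_exp M (F (n - 1)) (\<lambda>x. (t \<bullet> \<epsilon> n x)\<^sup>2) x"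
      by (rule S.real_cond_exp_pos) auto
    ultimately show ?thesis using vAE[OF n]
    proof eventually_elim
      case (elim x)
      have "(norm t)\<^sup>2 * real_cond_exp M (F (n - 1)) (\<lambda>x. norm (\<epsilon> n x) ^ 4) x \<le> (norm t)\<^sup>2 * C"
        using elim by (intro mult_left_mono) auto
      then show ?case using elim by (simp add: B_def distrib_left)
    qed
  qed
  have v_int: "integrable M (v n)" if "n \<ge> 1" for n
    using vbd[OF that] by (intro integrable_const_bound[where B=B]) auto
  then show "n \<ge> 1 \<Longrightarrow> integrable M (v n)" .
  define s2 where "s2 = t \<bullet> (\<Sigma> *v t)"
  define B' where "B' = B + \<bar>s2\<bar>"
  have B': "0 \<le> B'" using C by (auto simp: B'_def B_def)
  obtain L where L: "L > 0" "\<And>S::real^'d^'d. \<bar>t \<bullet> (S *v t)\<bar> \<le> L * norm S"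
    using linear_bounded_pos[OF lin] by auto
  have v_diff: "\<bar>v n x - s2\<bar> \<le> L * norm (cond_cov M (F (n - 1)) (\<epsilon> n) x - \<Sigma>)" for n x
    using L(2)[of "cond_cov M (F (n - 1)) (\<epsilon> n) x - \<Sigma>"]
    by (simp add: v_def s2_def matrix_vector_mult_diff_rdistrib inner_diff_right)
  have "(\<lambda>n. \<integral>x. \<bar>v n x - s2\<bar> \<partial>M) \<longlonglongrightarrow> 0"
  proof (rule LIMSEQ_I)
    fix r :: real assume r: "0 < r"
    \<comment> \<open>Off the event \<open>E n\<close> the deviation of \<open>v n\<close> is at
      most L h = r/2; on it the deviation is at most B', and the probability of \<open>E n\<close>
      tends to 0.\<close>
    define h where "h = r / (2 * L)"
    have h: "h > 0" using r L by (simp add: h_def)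
    define E where "E n = {x \<in> space M. norm (cond_cov M (F (n - 1)) (\<epsilon> n) x - \<Sigma>) > h}" for n
    have [measurable]: "E n \<in> sets M" for n unfolding E_def by measurable
    have "(\<lambda>n. B' * measure M (E n)) \<longlonglongrightarrow> B' * 0"
      using cov h unfolding conv_in_prob_def E_def by (intro tendsto_mult tendsto_const) auto
    then have "\<forall>\<^sub>F n in sequentially. B' * measure M (E n) < r/2"
      using r by (intro order_tendstoD(2)) auto
    then obtain N where N: "\<And>n. n \<ge> N \<Longrightarrow> B' * measure M (E n) < r/2"
      by (auto simp: eventually_sequentially)
    have "(\<integral>x. \<bar>v n x - s2\<bar> \<partial>M) < r" if n: "n \<ge> max N 1" for n
    proof -
      have "(\<integral>x. \<bar>v n x - s2\<bar> \<partial>M) \<le> (\<integral>x. r/2 + B' * indicator (E n) x \<partial>M)"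
      proof (rule integral_mono_AE)
        show "integrable M (\<lambda>x. \<bar>v n x - s2\<bar>)" using v_int n by auto
        show "integrable M (\<lambda>x. r/2 + B' * indicator (E n) x)"
          by (intro Bochner_Integration.integrable_add integrable_const integrable_mult_right integrable_real_indicator)
             (auto simp: less_top[symmetric])
        have "AE x in M. 0 \<le> v n x \<and> v n x \<le> B" using vbd n by simp
        then show "AE x in M. \<bar>v n x - s2\<bar> \<le> r/2 + B' * indicator (E n) x"
        proof (rule AE_mp, intro AE_I2 impI)
          fix x assume x: "x \<in> space M" and b: "0 \<le> v n x \<and> v n x \<le> B"
          show "\<bar>v n x - s2\<bar> \<le> r/2 + B' * indicator (E n) x"
          proof (cases "x \<in> E n")
            case True
            then have "\<bar>v n x - s2\<bar> \<le> B'" using b by (auto simp: B'_def abs_le_iff)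
            then show ?thesis using True r by simp
          next
            case False
            then have "norm (cond_cov M (F (n - 1)) (\<epsilon> n) x - \<Sigma>) \<le> h" using x by (auto simp: E_def)
            then have "L * norm (cond_cov M (F (n - 1)) (\<epsilon> n) x - \<Sigma>) \<le> L * h"
              using L(1) by (intro mult_left_mono) auto
            also have "L * h = r/2" using L(1) by (simp add: h_def)
            finally show ?thesis using v_diff[of n x] False by simp
          qed
        qed
      qed
      also have "\<dots> = r/2 + B' * measure M (E n)"
        by (subst Bochner_Integration.integral_add)
           (auto simp: prob_space less_top[symmetric] intro!: integrable_mult_right integrable_real_indicator)
      also have "\<dots> < r" using N[of n] n by simp
      finally show ?thesis .
    qed
    moreover have "0 \<le> (\<integral>x. \<bar>v n x - s2\<bar> \<partial>M)" for n by simp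
    ultimately show "\<exists>no. \<forall>n\<ge>no. norm ((\<integral>x. \<bar>v n x - s2\<bar> \<partial>M) - 0) < r"
      by (intro exI[of _ "max N 1"]) auto
  qed
  then show "(\<lambda>n. \<integral>x. \<bar>v n x - t \<bullet> (\<Sigma> *v t)\<bar> \<partial>M) \<longlonglongrightarrow> 0" unfolding s2_def .
qed

end

subsection \<open>Asymptotic normality of the average\<close>

theorem theorem4:
  fixes M :: "'a measure"
    and F :: "nat \<Rightarrow> 'a measure"
    and A :: "real^'d^'d"
    and \<Sigma> :: "real^'d^'d"
    and \<gamma> :: "nat \<Rightarrow> real"
    and \<epsilon> \<xi> e \<Delta> :: "nat \<Rightarrow> 'a \<Rightarrow> real^'d"
    and \<Delta>0 :: "real^'d"
  assumes prob: "prob_space M"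
    and filt_sub: "\<And>n. subalgebra M (F n)"
    and filt_mono: "\<And>n. sets (F n) \<subseteq> sets (F (Suc n))"
    and adapt_eps: "\<And>n. n \<ge> 1 \<Longrightarrow> \<epsilon> n \<in> borel_measurable (F n)"
    and adapt_xi: "\<And>n. n \<ge> 1 \<Longrightarrow> \<xi> n \<in> borel_measurable (F n)"
    and adapt_e: "\<And>n. n \<ge> 1 \<Longrightarrow> e n \<in> borel_measurable (F n)"
    and Delta0: "\<Delta> 0 = (\<lambda>x. \<Delta>0)"
    and Delta_rec: "\<And>n x. n \<ge> 1 \<Longrightarrow>
          \<Delta> n x = \<Delta> (n - 1) x - \<gamma> n *\<^sub>R (A *v \<Delta> (n - 1) x)
                   + \<gamma> n *\<^sub>R (\<epsilon> n x + \<xi> n x + e n x)"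
    \<comment> \<open>(i)\<close>
    and A_spd: "sym_pos_def A"
    \<comment> \<open>(ii)\<close>
    and eps_L2: "\<exists>B. \<forall>n\<ge>1. integrable M (\<lambda>x. (norm (\<epsilon> n x))\<^sup>2)
                          \<and> (\<integral>x. (norm (\<epsilon> n x))\<^sup>2 \<partial>M) \<le> B"
    and eps_mds: "\<And>n i. n \<ge> 1 \<Longrightarrow>
          AE x in M. real_cond_exp M (F (n - 1)) (\<lambda>y. \<epsilon> n y $ i) x = 0"
    and eps_4th: "\<exists>C>0. \<forall>n\<ge>1. AE x in M.
          nn_cond_exp M (F (n - 1)) (\<lambda>y. ennreal ((norm (\<epsilon> n y)) ^ 4)) x \<le> ennreal C"
    and Sigma_pd: "sym_pos_def \<Sigma>"
    and eps_cov: "conv_in_prob M (\<lambda>n. cond_cov M (F (n - 1)) (\<epsilon> n)) \<Sigma>"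
    \<comment> \<open>(iii)\<close>
    and xi_L2: "\<exists>B. \<forall>n\<ge>1. integrable M (\<lambda>x. (norm (\<xi> n x))\<^sup>2)
                          \<and> (\<integral>x. (norm (\<xi> n x))\<^sup>2 \<partial>M) \<le> B"
    and xi_mds: "\<And>n i. n \<ge> 1 \<Longrightarrow>
          AE x in M. real_cond_exp M (F (n - 1)) (\<lambda>y. \<xi> n y $ i) x = 0"
    and xi_cond: "\<exists>N K. K > 0 \<and> (\<forall>n\<ge>max N 1. AE x in M.
          nn_cond_exp M (F (n - 1)) (\<lambda>y. ennreal ((norm (\<xi> n y))\<^sup>2)) x \<le> ennreal (K * \<gamma> n))"
    \<comment> \<open>(iv)\<close>
    and e_bound: "\<exists>c N. \<forall>n\<ge>N. integrable M (\<lambda>x. norm (e n x))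
                          \<and> (\<integral>x. norm (e n x) \<partial>M) \<le> c * \<gamma> n"
    \<comment> \<open>(v)\<close>
    and gamma_pos: "\<And>n. n \<ge> 1 \<Longrightarrow> \<gamma> n > 0"
    and gamma_lim: "\<gamma> \<longlonglongrightarrow> 0"
    and gamma_ratio: "(\<lambda>n. (\<gamma> n - \<gamma> (n - 1)) / \<gamma> n) \<in> o(\<gamma>)"
    and gamma_sum: "summable (\<lambda>j. \<gamma> (Suc j) / sqrt (real (Suc j)))"
  shows "conv_in_distr M
           (\<lambda>n x. sqrt (real n) *\<^sub>R ((1 / real n) *\<^sub>R (\<Sum>i=1..n. \<Delta> i x)))
           (mv_normal (matrix_inv A ** \<Sigma> ** matrix_inv A))"
proof -
  interpret vec_filtration M F
    using prob filt_sub filt_mono by (simp add: vec_filtration_def vec_filtration_axioms_def)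
  interpret step_sizes \<gamma>
    using gamma_pos gamma_lim gamma_ratio by (intro step_sizes.intro)
  obtain B1 where B1: "\<And>n. n \<ge> 1 \<Longrightarrow> integrable M (\<lambda>x. (norm (\<epsilon> n x))\<^sup>2)" "\<And>n. n \<ge> 1 \<Longrightarrow> (\<integral>x. (norm (\<epsilon> n x))\<^sup>2 \<partial>M) \<le> B1"
    using eps_L2 by blast
  obtain B2 where B2: "\<And>n. n \<ge> 1 \<Longrightarrow> integrable M (\<lambda>x. (norm (\<xi> n x))\<^sup>2)" "\<And>n. n \<ge> 1 \<Longrightarrow> (\<integral>x. (norm (\<xi> n x))\<^sup>2 \<partial>M) \<le> B2"
    using xi_L2 by blast
  obtain C where C: "C > 0" and fourth: "\<And>n. n \<ge> 1 \<Longrightarrow> AE x in M.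
      nn_cond_exp M (F (n - 1)) (\<lambda>y. ennreal ((norm (\<epsilon> n y)) ^ 4)) x \<le> ennreal C"
    using eps_4th by blast
  have eps_m: "\<epsilon> n \<in> borel_measurable M" and xi_m: "\<xi> n \<in> borel_measurable M" and e_m: "e n \<in> borel_measurable M"
    if "n \<ge> 1" for n
    using that measurable_from_subalg[OF filt_sub] adapt_eps adapt_xi adapt_e by blast+
  have eps_sq: "sq_int M (\<epsilon> n)" and xi_sq: "sq_int M (\<xi> n)" if "n \<ge> 1" for n
    using that eps_m xi_m B1 B2 by (auto simp: sq_int_def)
  define Z where "Z n x = \<epsilon> n x + \<xi> n x" for n x
  define Y where "Y = rec_nat (\<lambda>x. 0) (\<lambda>n f x. f x - \<gamma> (Suc n) *\<^sub>R (A *v f x) + \<gamma> (Suc n) *\<^sub>R Z (Suc n) x)"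
  have Z_sq: "sq_int M (Z n)" if "n \<ge> 1" for n
    unfolding Z_def[abs_def] by (intro sq_int_add eps_sq xi_sq that)
  interpret Y: averaged_recursion M F \<gamma> A Z Y "2 * (B1 + B2)"
  proof
    show "sym_pos_def A" by (rule A_spd)
    show "Y 0 = (\<lambda>x. 0)" by (simp add: Y_def)
    show "Y (Suc n) = (\<lambda>x. Y n x - \<gamma> (Suc n) *\<^sub>R (A *v Y n x) + \<gamma> (Suc n) *\<^sub>R Z (Suc n) x)" for n
      by (simp add: Y_def)
    fix n :: nat assume n: "n \<ge> 1"
    note [measurable] = adapt_eps[OF n] adapt_xi[OF n]
    show "Z n \<in> borel_measurable (F n)" unfolding Z_def[abs_def] by measurable
    show "sq_int M (Z n)" by (rule Z_sq[OF n])
    have "(\<integral>x. (norm (Z n x))\<^sup>2 \<partial>M) \<le> (\<integral>x. 2 * ((norm (\<epsilon> n x))\<^sup>2 + (norm (\<xi> n x))\<^sup>2) \<partial>M)"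
    proof (rule integral_mono)
      fix x
      have "(norm (Z n x))\<^sup>2 \<le> (norm (\<epsilon> n x) + norm (\<xi> n x))\<^sup>2"
        unfolding Z_def by (intro power_mono norm_triangle_ineq) simp
      also have "\<dots> \<le> 2 * ((norm (\<epsilon> n x))\<^sup>2 + (norm (\<xi> n x))\<^sup>2)"
        using sum_squares_bound[of "norm (\<epsilon> n x)" "norm (\<xi> n x)"] by (simp add: power2_sum)
      finally show "(norm (Z n x))\<^sup>2 \<le> 2 * ((norm (\<epsilon> n x))\<^sup>2 + (norm (\<xi> n x))\<^sup>2)" .
    qed (use Z_sq[OF n] B1(1)[OF n] B2(1)[OF n] in \<open>auto intro: sq_int_integrable\<close>)
    also have "\<dots> \<le> 2 * (B1 + B2)" using B1[OF n] B2[OF n] by simp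
    finally show "(\<integral>x. (norm (Z n x))\<^sup>2 \<partial>M) \<le> 2 * (B1 + B2)" .
    show "AE x in M. real_cond_exp M (F (n - 1)) (\<lambda>y. Z n y $ i) x = 0" for i
    proof -
      interpret S: sigma_finite_subalgebra M "F (n - 1)" by (rule sigma_finite_subalgebraI[OF filt_sub])
      have "AE x in M. real_cond_exp M (F (n - 1)) (\<lambda>y. \<epsilon> n y $ i + \<xi> n y $ i) x
          = real_cond_exp M (F (n - 1)) (\<lambda>y. \<epsilon> n y $ i) x + real_cond_exp M (F (n - 1)) (\<lambda>y. \<xi> n y $ i) x"
        by (intro S.real_cond_exp_add integrable_sq_int_nth eps_sq xi_sq n)
      with eps_mds[OF n, of i] xi_mds[OF n, of i] show ?thesis
        unfolding Z_def vector_add_component by eventually_elim simp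
    qed
  qed
  define c where "c n = 1 / sqrt (real n)" for n
  define D where "D n x = \<Delta> n x - Y n x" for n x
  have D_Suc: "D (Suc n) x = D n x - \<gamma> (Suc n) *\<^sub>R (A *v D n x) + \<gamma> (Suc n) *\<^sub>R e (Suc n) x" for n x
    using Delta_rec[of "Suc n" x]
    by (simp add: D_def Y.Y_Suc Z_def matrix_vector_mult_diff_distrib algebra_simps)
  have Delta_m: "\<Delta> n \<in> borel_measurable M" for n
  proof (induction n)
    case (Suc n)
    note [measurable] = Suc eps_m[of "Suc n", simplified] xi_m[of "Suc n", simplified] e_m[of "Suc n", simplified]
    have "\<Delta> (Suc n) = (\<lambda>x. \<Delta> n x - \<gamma> (Suc n) *\<^sub>R (A *v \<Delta> n x) + \<gamma> (Suc n) *\<^sub>R (\<epsilon> (Suc n) x + \<xi> (Suc n) x + e (Suc n) x))"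
      using Delta_rec[of "Suc n"] by auto
    then show ?case by simp
  qed (simp add: Delta0)
  have Y_m: "Y n \<in> borel_measurable M" for n by (rule sq_int_measurable[OF Y.Y_sq])
  have D_m[measurable]: "D n \<in> borel_measurable M" for n
    using Delta_m[of n] Y_m[of n] unfolding D_def[abs_def] by measurable

  \<comment> \<open>The part driven by \<open>e\<close> and by the initial value\<close>
  have null_D: "null_mean M (\<lambda>n x. c n *\<^sub>R (\<Sum>i=1..n. D i x))"
  proof -
    obtain ce N where ce: "\<And>n. n \<ge> N \<Longrightarrow> integrable M (\<lambda>x. norm (e n x))"
      "\<And>n. n \<ge> N \<Longrightarrow> (\<integral>x. norm (e n x) \<partial>M) \<le> ce * \<gamma> n"
      using e_bound by blast
    obtain K n0 where K: "K \<ge> 0" "n0 \<ge> N" "n0 \<ge> 1"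
      "\<And>D e n. (\<And>n. D (Suc n) = D n - \<gamma> (Suc n) *\<^sub>R (A *v D n) + \<gamma> (Suc n) *\<^sub>R e (Suc n)) \<Longrightarrow> n \<ge> n0 \<Longrightarrow>
         (\<Sum>i=n0..n. norm (D i)) \<le> K * (norm (D n0) / \<gamma> n0 + (\<Sum>i=Suc n0..n. norm (e i)))"
      using perturbed_linear_recursion[OF A_spd, of N] by blast
    \<comment> \<open>\<open>a\<close> collects the finitely many early terms, for which no
      integrability is available, so it is disposed of pointwise after scaling by
      \<open>c n\<close>. \<open>b\<close> contains only indices beyond \<open>N\<close>, where
      \<open>e\<close> is integrable, and is treated in mean.\<close>
    define a where "a x = (\<Sum>i=1..<n0. norm (D i x)) + K * (norm (D n0 x) / \<gamma> n0)" for x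
    define b where "b n x = (\<Sum>i=Suc n0..n. norm (e i x))" for n x
    have [measurable]: "a \<in> borel_measurable M" unfolding a_def by measurable
    have b_int: "integrable M (b n)" for n
      unfolding b_def using K(2) by (intro Bochner_Integration.integrable_sum ce) auto
    have b_nn: "0 \<le> b n x" for n x unfolding b_def by (intro sum_nonneg) simp
    have c_lim: "c \<longlonglongrightarrow> 0" unfolding c_def by real_asymp
    have c_nn: "0 \<le> c n" for n by (simp add: c_def)
    have "null_mean M (\<lambda>n x. c n * a x)"
      using c_lim by (intro null_mean_pointwise) (auto intro: tendsto_mult_left_zero)
    moreover have "null_mean M (\<lambda>n x. c n * (K * b n x))"
    proof (rule null_mean_L1)
      show "(\<lambda>x. c n * (K * b n x)) \<in> borel_measurable M" "integrable M (\<lambda>x. norm (c n * (K * b n x)))" for n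
        using b_int[of n] by auto
      \<comment> \<open>By Kronecker's lemma and the summability condition, the sum of the first n
        step sizes is o(sqrt n). The absolute value of \<open>ce\<close> lets the sum be extended
        down to i = 1 by nonnegative terms.\<close>
      have g_lim: "(\<lambda>n. (K * \<bar>ce\<bar>) * ((\<Sum>i=1..n. \<gamma> i) / sqrt (real n))) \<longlonglongrightarrow> 0"
        using tendsto_mult_right_zero[OF kronecker_sqrt[OF less_imp_le[OF gamma_pos] gamma_sum]] by simp
      show "(\<lambda>n. \<integral>x. norm (c n * (K * b n x)) \<partial>M) \<longlonglongrightarrow> 0"
      proof (rule Lim_null_comparison[OF always_eventually g_lim], intro allI)
        fix n
        have "(\<integral>x. b n x \<partial>M) = (\<Sum>i=Suc n0..n. \<integral>x. norm (e i x) \<partial>M)"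
          unfolding b_def using K(2) by (intro Bochner_Integration.integral_sum ce) auto
        also have "\<dots> \<le> (\<Sum>i=Suc n0..n. \<bar>ce\<bar> * \<gamma> i)"
        proof (rule sum_mono)
          fix i assume i: "i \<in> {Suc n0..n}"
          then have "(\<integral>x. norm (e i x) \<partial>M) \<le> ce * \<gamma> i" using K(2) by (intro ce) auto
          also have "\<dots> \<le> \<bar>ce\<bar> * \<gamma> i" using gamma_pos[of i] i by (intro mult_right_mono) auto
          finally show "(\<integral>x. norm (e i x) \<partial>M) \<le> \<bar>ce\<bar> * \<gamma> i" .
        qed
        also have "\<dots> \<le> (\<Sum>i=1..n. \<bar>ce\<bar> * \<gamma> i)"
        proof (rule sum_mono2)
          show "0 \<le> \<bar>ce\<bar> * \<gamma> i" if "i \<in> {1..n} - {Suc n0..n}" for i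
            using gamma_pos[of i] that by (intro mult_nonneg_nonneg) auto
        qed auto
        finally have "(\<integral>x. b n x \<partial>M) \<le> \<bar>ce\<bar> * (\<Sum>i=1..n. \<gamma> i)" by (simp add: sum_distrib_left)
        then have "c n * (K * (\<integral>x. b n x \<partial>M)) \<le> c n * (K * (\<bar>ce\<bar> * (\<Sum>i=1..n. \<gamma> i)))"
          using K(1) c_nn by (intro mult_left_mono) auto
        moreover have "(\<integral>x. norm (c n * (K * b n x)) \<partial>M) = c n * (K * (\<integral>x. b n x \<partial>M))"
          using b_nn K(1) c_nn by (simp add: abs_mult)
        moreover have "norm (\<integral>x. norm (c n * (K * b n x)) \<partial>M) = (\<integral>x. norm (c n * (K * b n x)) \<partial>M)"
          by (simp del: norm_mult)
        moreover have "c n * (K * (\<bar>ce\<bar> * (\<Sum>i=1..n. \<gamma> i))) = (K * \<bar>ce\<bar>) * ((\<Sum>i=1..n. \<gamma> i) / sqrt (real n))"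
          by (simp add: c_def)
        ultimately show "norm (\<integral>x. norm (c n * (K * b n x)) \<partial>M) \<le> (K * \<bar>ce\<bar>) * ((\<Sum>i=1..n. \<gamma> i) / sqrt (real n))"
          by linarith
      qed
    qed
    ultimately have S: "null_mean M (\<lambda>n x. c n * a x + c n * (K * b n x))" by (rule null_mean_add)
    show ?thesis
    proof (rule null_mean_dominated[OF S, of _ 1])
      show "(\<lambda>x. c n *\<^sub>R (\<Sum>i=1..n. D i x)) \<in> borel_measurable M" for n by measurable
      show "\<forall>\<^sub>F n in sequentially. \<forall>x\<in>space M. norm (c n *\<^sub>R (\<Sum>i=1..n. D i x)) \<le> 1 * norm (c n * a x + c n * (K * b n x))"
      proof (intro eventually_sequentiallyI[of n0] ballI)
        fix n x assume n: "n \<ge> n0"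
        have split: "{1..n} = {1..<n0} \<union> {n0..n}" using n K(3) by auto
        have "norm (\<Sum>i=1..n. D i x) \<le> (\<Sum>i=1..n. norm (D i x))" by (rule norm_sum)
        also have "\<dots> = (\<Sum>i=1..<n0. norm (D i x)) + (\<Sum>i=n0..n. norm (D i x))"
          unfolding split by (rule sum.union_disjoint) auto
        also have "\<dots> \<le> a x + K * b n x"
          using K(4)[of "\<lambda>i. D i x" "\<lambda>i. e i x", OF D_Suc n] by (simp add: a_def b_def algebra_simps)
        finally have "c n * norm (\<Sum>i=1..n. D i x) \<le> c n * (a x + K * b n x)"
          using c_nn by (intro mult_left_mono) auto
        then show "norm (c n *\<^sub>R (\<Sum>i=1..n. D i x)) \<le> 1 * norm (c n * a x + c n * (K * b n x))"
          using c_nn[of n] by (simp add: algebra_simps)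
      qed
    qed simp
  qed

  \<comment> \<open>Remainders coming from the martingale noise\<close>
  have xi_lim: "(\<lambda>n. \<integral>x. (norm (\<xi> n x))\<^sup>2 \<partial>M) \<longlonglongrightarrow> 0"
  proof -
    obtain N K where K: "K > 0" "\<And>n. n \<ge> max N 1 \<Longrightarrow> AE x in M.
        nn_cond_exp M (F (n - 1)) (\<lambda>y. ennreal ((norm (\<xi> n y))\<^sup>2)) x \<le> ennreal (K * \<gamma> n)"
      using xi_cond by blast
    have "(\<integral>x. (norm (\<xi> n x))\<^sup>2 \<partial>M) \<le> K * \<gamma> n" if n: "n \<ge> max N 1" for n
    proof (rule cond_bound_imp_moment_bound(2)[OF filt_sub _ _ _ K(2)[OF n]])
      have [measurable]: "\<xi> n \<in> borel_measurable M" using n by (intro xi_m) simp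
      show "(\<lambda>x. (norm (\<xi> n x))\<^sup>2) \<in> borel_measurable M" by measurable
      show "0 \<le> K * \<gamma> n" using K(1) gamma_pos[of n] n by simp
    qed simp
    then have "\<forall>\<^sub>F n in sequentially. norm (\<integral>x. (norm (\<xi> n x))\<^sup>2 \<partial>M) \<le> K * \<gamma> n"
      by (intro eventually_sequentiallyI[of "max N 1"]) auto
    moreover have "(\<lambda>n. K * \<gamma> n) \<longlonglongrightarrow> 0" using gamma_lim by (rule tendsto_mult_right_zero)
    ultimately show ?thesis by (rule Lim_null_comparison)
  qed
  have null_xi: "null_mean M (\<lambda>n x. c n *\<^sub>R (\<Sum>i=1..n. \<xi> i x))"
    unfolding c_def
    by (intro null_mean_L2_scaled sq_int_sum martingale_second_moment_sublinear)
       (use xi_sq adapt_xi xi_mds xi_lim in auto)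
  have null_V: "null_mean M (\<lambda>n x. c n *\<^sub>R Y.V n x)"
    unfolding c_def by (intro null_mean_L2_scaled Y.V_sq Y.V_second_moment_sublinear)
  have null_Y: "null_mean M (\<lambda>n x. c n *\<^sub>R Y n x)"
    unfolding c_def by (intro null_mean_L2_scaled Y.Y_sq Y.Y_second_moment_lims)
  have null_Yg: "null_mean M (\<lambda>n x. c n *\<^sub>R ((1 / \<gamma> n) *\<^sub>R Y n x))"
    unfolding c_def by (intro null_mean_L2_scaled sq_int_scaleR Y.Y_sq Y.Y_second_moment_lims)

  \<comment> \<open>Decomposition into a leading martingale sum and a null remainder\<close>
  define Ai where "Ai = matrix_inv A"
  have Ai: "Ai ** A = mat 1" unfolding Ai_def by (rule matrix_inv_left[OF sym_pos_def_invertible[OF A_spd]])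
  have Ai_sym: "transpose Ai = Ai"
    using sym_pos_def_matrix_inv[OF A_spd] by (simp add: Ai_def sym_pos_def_def)
  have Ai_inv: "invertible Ai"
    using sym_pos_def_invertible[OF sym_pos_def_matrix_inv[OF A_spd]] by (simp add: Ai_def)
  define X where "X n x = c n *\<^sub>R (Ai *v (\<Sum>i=1..n. \<epsilon> i x))" for n x
  \<comment> \<open>The minus sign is put into the matrix, so that each summand falls under
    \<open>null_mean_matrix\<close> or is already known to be null, and \<open>null_mean_add\<close>
    combines them.\<close>
  define R where "R n x = c n *\<^sub>R (\<Sum>i=1..n. D i x) + Ai *v (c n *\<^sub>R (\<Sum>i=1..n. \<xi> i x)) + Ai *v (c n *\<^sub>R Y.V n x)
      + (- Ai) *v (c n *\<^sub>R ((1 / \<gamma> n) *\<^sub>R Y n x)) + c n *\<^sub>R Y n x" for n x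
  have R: "null_mean M R"
    unfolding R_def by (intro null_mean_add null_mean_matrix null_D null_xi null_V null_Y null_Yg)
  define S where "S n x = sqrt (real n) *\<^sub>R ((1 / real n) *\<^sub>R (\<Sum>i=1..n. \<Delta> i x))" for n x
  have S_m[measurable]: "S n \<in> borel_measurable M" for n
    unfolding S_def using Delta_m by measurable
  have X_m: "X n \<in> borel_measurable M" for n
  proof -
    have [measurable]: "(\<lambda>x. \<Sum>i=1..n. \<epsilon> i x) \<in> borel_measurable M"
      by (intro borel_measurable_sum eps_m) auto
    show ?thesis unfolding X_def[abs_def] by measurable
  qed
  have S_eq: "S n x = X n x + R n x" if n: "n \<ge> 1" for n x
  proof -
    have "sqrt (real n) * (1 / real n) = c n"
      using n by (simp add: c_def real_div_sqrt field_simps)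
    then have "S n x = c n *\<^sub>R (\<Sum>i=1..n. D i x + Y i x)"
      by (simp add: S_def D_def)
    also have "\<dots> = c n *\<^sub>R ((\<Sum>i=1..n. D i x) + (\<Sum>i=1..n. Y i x))" by (simp add: sum.distrib)
    also have "(\<Sum>i=1..n. Y i x) = (\<Sum>i<n. Y i x) + Y n x"
    proof -
      \<comment> \<open>As Y 0 = 0, the sum over 1..n equals the sum over 0..n, which exceeds the
        range treated by \<open>sum_Y\<close> by the single term \<open>Y n\<close>.\<close>
      have "(\<Sum>i\<le>n. Y i x) = (\<Sum>i=1..n. Y i x)"
        by (rule sum.mono_neutral_right) (auto simp: Y.Y_0 not_less_eq_eq)
      then show ?thesis by (simp add: lessThan_Suc_atMost[symmetric])
    qed
    also have "(\<Sum>i<n. Y i x) = Ai *v (A *v (\<Sum>i<n. Y i x))"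
      by (simp add: matrix_vector_mul_assoc Ai)
    also have "\<dots> = Ai *v (\<Sum>i=1..n. \<epsilon> i x) + Ai *v (\<Sum>i=1..n. \<xi> i x) + Ai *v Y.V n x - Ai *v ((1 / \<gamma> n) *\<^sub>R Y n x)"
      unfolding Y.sum_Y[OF n] Z_def
      by (simp add: sum.distrib matrix_vector_right_distrib matrix_vector_mult_diff_distrib)
    finally have "S n x = c n *\<^sub>R ((\<Sum>i=1..n. D i x) + (Ai *v (\<Sum>i=1..n. \<epsilon> i x) + Ai *v (\<Sum>i=1..n. \<xi> i x)
        + Ai *v Y.V n x - Ai *v ((1 / \<gamma> n) *\<^sub>R Y n x) + Y n x))" .
    moreover have "(- Ai) *v y = - (Ai *v y)" for y
      by (simp add: matrix_vector_mult_def vec_eq_iff sum_negf)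
    ultimately show ?thesis
      by (simp add: X_def R_def scaleR_add_right scaleR_diff_right matrix_vector_mult_scaleR algebra_simps)
  qed

  \<comment> \<open>Identification of the Gaussian limit through characteristic functions\<close>
  define \<Gamma> where "\<Gamma> = Ai ** \<Sigma> ** Ai"
  have \<Gamma>: "sym_pos_def \<Gamma>"
    using sym_pos_def_congruence[OF Sigma_pd Ai_inv] by (simp add: \<Gamma>_def Ai_sym)
  have cf: "(\<lambda>n. cfun (distr M borel (S n)) t) \<longlonglongrightarrow> cfun (mv_normal \<Gamma>) t" for t
  proof -
    \<comment> \<open>Cramer-Wold: \<open>Ai\<close> is symmetric, so t . X n is the normalised sum
      of the scalars s . \<epsilon> i, and the scalar central limit theorem in direction
      \<open>s\<close> gives the limit at t.\<close>
    define s where "s = Ai *v t"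
    note v = conditional_variance_null[OF filt_sub eps_m eps_sq C fourth eps_cov, where t=s]
    have s\<epsilon>2: "(s \<bullet> \<epsilon> n x)\<^sup>2 \<le> (norm s)\<^sup>2 * (norm (\<epsilon> n x))\<^sup>2" for n x
      using Cauchy_Schwarz_ineq2[of s "\<epsilon> n x"] by (metis abs_ge_zero power2_abs power_mono power_mult_distrib)
    have s\<epsilon>4: "(s \<bullet> \<epsilon> n x) ^ 4 \<le> norm s ^ 4 * norm (\<epsilon> n x) ^ 4" for n x
      using power_mono[OF s\<epsilon>2, of n x 2] by (simp add: power_mult_distrib)
    have e4: "integrable M (\<lambda>x. norm (\<epsilon> n x) ^ 4)" "(\<integral>x. norm (\<epsilon> n x) ^ 4 \<partial>M) \<le> C" if n: "n \<ge> 1" for n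
      using cond_bound_imp_moment_bound[OF filt_sub _ _ _ fourth[OF n]] C eps_m[OF n] by auto
    define K where "K = max ((norm s)\<^sup>2 * B1) (norm s ^ 4 * C)"
    have "(\<lambda>n. CLINT x|M. iexp ((\<Sum>i=1..n. s \<bullet> \<epsilon> i x) / sqrt (real n))) \<longlonglongrightarrow> of_real (exp (- (s \<bullet> (\<Sigma> *v s)) / 2))"
    proof (rule martingale_clt[where F=F and X="\<lambda>n x. s \<bullet> \<epsilon> n x" and K=K
          and v="\<lambda>n x. s \<bullet> (cond_cov M (F (n - 1)) (\<epsilon> n) x *v s)"])
      show "prob_space M" "\<And>n. subalgebra M (F n)" "\<And>n. sets (F n) \<subseteq> sets (F (Suc n))"
        by (rule prob filt_sub filt_mono)+
      show "0 \<le> s \<bullet> (\<Sigma> *v s)"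
        using Sigma_pd by (cases "s = 0") (auto simp: sym_pos_def_def less_imp_le)
      show "(\<lambda>n. \<integral>x. \<bar>s \<bullet> (cond_cov M (F (n - 1)) (\<epsilon> n) x *v s) - s \<bullet> (\<Sigma> *v s)\<bar> \<partial>M) \<longlonglongrightarrow> 0" by (rule v(3))
      fix n :: nat assume n: "n \<ge> 1"
      note [measurable] = adapt_eps[OF n] eps_m[OF n]
      show "(\<lambda>x. s \<bullet> \<epsilon> n x) \<in> borel_measurable (F n)" by measurable
      show i2: "integrable M (\<lambda>x. (s \<bullet> \<epsilon> n x)\<^sup>2)"
      proof (rule Bochner_Integration.integrable_bound)
        show "integrable M (\<lambda>x. (norm s)\<^sup>2 * (norm (\<epsilon> n x))\<^sup>2)" using B1(1)[OF n] by simp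
      qed (use s\<epsilon>2 in auto)
      have "(\<integral>x. (s \<bullet> \<epsilon> n x)\<^sup>2 \<partial>M) \<le> (\<integral>x. (norm s)\<^sup>2 * (norm (\<epsilon> n x))\<^sup>2 \<partial>M)"
        using i2 B1(1)[OF n] s\<epsilon>2 by (intro integral_mono) auto
      also have "\<dots> \<le> (norm s)\<^sup>2 * B1" using B1(2)[OF n] by (simp add: mult_left_mono)
      finally show "(\<integral>x. (s \<bullet> \<epsilon> n x)\<^sup>2 \<partial>M) \<le> K" by (simp add: K_def)
      show i4: "integrable M (\<lambda>x. (s \<bullet> \<epsilon> n x) ^ 4)"
      proof (rule Bochner_Integration.integrable_bound)
        show "integrable M (\<lambda>x. norm s ^ 4 * norm (\<epsilon> n x) ^ 4)" using e4(1)[OF n] by simp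
      qed (use s\<epsilon>4 in \<open>auto simp: power_even_abs\<close>)
      have "(\<integral>x. (s \<bullet> \<epsilon> n x) ^ 4 \<partial>M) \<le> (\<integral>x. norm s ^ 4 * norm (\<epsilon> n x) ^ 4 \<partial>M)"
        using i4 e4(1)[OF n] s\<epsilon>4 by (intro integral_mono) auto
      also have "\<dots> \<le> norm s ^ 4 * C" using e4(2)[OF n] by (simp add: mult_left_mono)
      finally show "(\<integral>x. (s \<bullet> \<epsilon> n x) ^ 4 \<partial>M) \<le> K" by (simp add: K_def)
      show "AE x in M. real_cond_exp M (F (n - 1)) (\<lambda>x. s \<bullet> \<epsilon> n x) x = 0"
      proof -
        interpret S: sigma_finite_subalgebra M "F (n - 1)" by (rule sigma_finite_subalgebraI[OF filt_sub])
        have int: "integrable M (\<lambda>x. \<epsilon> n x $ i)" for i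
          by (rule integrable_sq_int_nth[OF eps_sq[OF n]])
        have "AE x in M. real_cond_exp M (F (n - 1)) (\<lambda>x. \<Sum>i\<in>UNIV. s $ i * \<epsilon> n x $ i) x
            = (\<Sum>i\<in>UNIV. real_cond_exp M (F (n - 1)) (\<lambda>x. s $ i * \<epsilon> n x $ i) x)"
          by (rule S.real_cond_exp_sum) (intro integrable_mult_right int)
        moreover have "AE x in M. \<forall>i. real_cond_exp M (F (n - 1)) (\<lambda>x. s $ i * \<epsilon> n x $ i) x
            = s $ i * real_cond_exp M (F (n - 1)) (\<lambda>x. \<epsilon> n x $ i) x"
          by (intro AE_all_countable[THEN iffD2] allI S.real_cond_exp_cmult int)
        moreover have "AE x in M. \<forall>i. real_cond_exp M (F (n - 1)) (\<lambda>x. \<epsilon> n x $ i) x = 0"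
          by (intro AE_all_countable[THEN iffD2] allI eps_mds n)
        ultimately show ?thesis unfolding inner_vec_def inner_real_def by eventually_elim simp
      qed
      show "AE x in M. real_cond_exp M (F (n - 1)) (\<lambda>x. (s \<bullet> \<epsilon> n x)\<^sup>2) x = s \<bullet> (cond_cov M (F (n - 1)) (\<epsilon> n) x *v s)"
        using n by (intro v(1))
      show "integrable M (\<lambda>x. s \<bullet> (cond_cov M (F (n - 1)) (\<epsilon> n) x *v s))" using n by (intro v(2))
    qed
    moreover have "t \<bullet> X n x = (\<Sum>i=1..n. s \<bullet> \<epsilon> i x) / sqrt (real n)" for n x
      using inner_transpose_vector[of Ai t "\<Sum>i=1..n. \<epsilon> i x"]
      by (simp add: X_def c_def s_def Ai_sym inner_sum_right)
    moreover have "s \<bullet> (\<Sigma> *v s) = t \<bullet> (\<Gamma> *v t)"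
      using inner_transpose_vector[of Ai t "\<Sigma> *v s"]
      by (simp add: \<Gamma>_def s_def Ai_sym matrix_vector_mul_assoc matrix_mul_assoc)
    ultimately have "(\<lambda>n. CLINT x|M. iexp (t \<bullet> X n x)) \<longlonglongrightarrow> of_real (exp (- (t \<bullet> (\<Gamma> *v t)) / 2))" by simp
    from slutsky_cfun[OF X_m R this]
    have "(\<lambda>n. CLINT x|M. iexp (t \<bullet> (X n x + R n x))) \<longlonglongrightarrow> cfun (mv_normal \<Gamma>) t"
      by (simp add: cfun_mv_normal[OF \<Gamma>])
    moreover have "\<forall>\<^sub>F n in sequentially. (CLINT x|M. iexp (t \<bullet> (X n x + R n x))) = cfun (distr M borel (S n)) t"
      unfolding cfun_def by (intro eventually_sequentiallyI[of 1]) (simp add: integral_distr S_eq[symmetric])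
    ultimately show ?thesis by (rule Lim_transform_eventually)
  qed
  have "weak_conv_eucl (\<lambda>n. distr M borel (S n)) (mv_normal \<Gamma>)"
  proof (rule levy_continuity_euclidean[OF _ _ prob_space_mv_normal[OF \<Gamma>] _ cf])
    show "prob_space (distr M borel (S n))" for n by (rule prob_space_distr) measurable
  qed (simp_all add: mv_normal_def)
  then show ?thesis
    unfolding conv_in_distr_def S_def[abs_def] \<Gamma>_def Ai_def .
qed

end
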